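(* Let $T$ be a complete ample affine theory in a language $L$ and let $\lambda$ be an infinite cardinal. Then there is a model $M\vDash T$ which omits all non-extreme types of $T$ (i.e. all non-extreme types in every $S_n(T)$) and satisfies $\lambda\leqslant|M|$.
   Context: Affine (linear) continuous logic. A language $L$ consists of constant symbols, function symbols $F$ (each with an arity and a Lipschitz constant $\lambda_F\geqslant0$) and relation symbols $R$ (each with an arity and a Lipschitz constant $\lambda_R\geqslant 0$), always including a distinguished binary relation symbol $d$ for the metric; $L$ may have any cardinality. An $L$-structure is a complete metric space $(M,d)$ with $c^M\in M$, $F^M:M^n\to M$ $\lambda_F$-Lipschitz, and $R^M:M^n\to\mathbb R$ $\lambda_R$-Lipschitz with $\|R^M\|_\infty\leqslant1$ (so $d\leqslant 1$); $M^n$ carries the metric $\sum_{i<n}2^{-i}d(x_i,y_i)$. Affine formulas are generated by $r$, $d(t_1,t_2)$, $R(t_1,\dots,t_n)$, $r\phi$, $\phi+\psi$, $\sup_x\phi$, $\inf_x\phi$ ($r\in\mathbb R$, $t_i$ terms) and are interpreted as real-valued functions $\phi^M$. A condition is an expression $\phi\leqslant\psi$ (and $\phi=\psi$ abbreviates the two inequalities); an (affine) theory is a set of conditions between sentences; $M\vDash T$ means all conditions of $T$ hold in $M$. $T$ is complete if it has a model and for every sentence $\sigma$ there is a unique $r\in\mathbb R$ with $\sigma=r$ in $T$. For complete $T$, $\mathbb D_n(T)$ is the ordered vector space of formulas $\phi(x_1,\dots,x_n)$ modulo $T$-equivalence, i.e. $\{\phi^M\}$ for any $M\vDash T$, with pointwise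 order and sup-norm. An $n$-type is a positive linear functional $p:\mathbb D_n(T)\to\mathbb R$ with $p(1)=1$; $S_n(T)$ is the compact convex set of all $n$-types. A tuple $\bar a\in M^n$ realizes $p$ if $p=tp(\bar a)$, where $tp(\bar a)(\phi)=\phi^M(\bar a)$; $M$ omits $p$ if no tuple of $M$ realizes $p$. A type $p$ is extreme if it is an extreme point of $S_n(T)$, and non-extreme otherwise. $T$ is ample if it has a model $M$ containing an infinite sequence $(a_n)$ with $d(a_m,a_n)=1$ for all $m\neq n$. $|M|$ is the cardinality of $M$. *)

theory Defs
  imports "HOL-Analysis.Analysis"
begin

unbundle cardinal_syntax

section \<open>Languages, terms and affine formulas\<close>

text \<open>
  Symbols are drawn from types \<open>'c\<close>, \<open>'f\<close>, \<open>'r\<close> of arbitrary size; a language selects the sets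
  of symbols it uses, any of which may be empty. The metric symbol \<open>d\<close> is logical (constructor
  \<open>Dist\<close>) and not listed: in the metric on pairs below it is 2-Lipschitz in every metric space,
  by the triangle inequality.
\<close>

record ('c, 'f, 'r) language =
  cst_syms :: "'c set"
  fun_syms :: "'f set"
  rel_syms :: "'r set"
  fun_ar :: "'f \<Rightarrow> nat"
  rel_ar :: "'r \<Rightarrow> nat"
  fun_lip :: "'f \<Rightarrow> real"
  rel_lip :: "'r \<Rightarrow> real"

definition is_language :: "('c, 'f, 'r) language \<Rightarrow> bool" where
  "is_language L \<longleftrightarrow> (\<forall>F\<in>fun_syms L. 0 \<le> fun_lip L F) \<and> (\<forall>R\<in>rel_syms L. 0 \<le> rel_lip L R)"

datatype ('c, 'f) tm = Var nat | Cst 'c | App 'f "('c, 'f) tm list"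

datatype ('c, 'f, 'r) fm =
    Const real
  | Dist "('c, 'f) tm" "('c, 'f) tm"
  | Rel 'r "('c, 'f) tm list"
  | Scale real "('c, 'f, 'r) fm"
  | Add "('c, 'f, 'r) fm" "('c, 'f, 'r) fm"
  | SupF nat "('c, 'f, 'r) fm"
  | InfF nat "('c, 'f, 'r) fm"

primrec wf_tm :: "('c, 'f, 'r) language \<Rightarrow> ('c, 'f) tm \<Rightarrow> bool" where
  "wf_tm L (Var x) \<longleftrightarrow> True"
| "wf_tm L (Cst c) \<longleftrightarrow> c \<in> cst_syms L"
| "wf_tm L (App F ts) \<longleftrightarrow> F \<in> fun_syms L \<and> length ts = fun_ar L F \<and> list_all (wf_tm L) ts"

primrec wf_fm :: "('c, 'f, 'r) language \<Rightarrow> ('c, 'f, 'r) fm \<Rightarrow> bool" where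
  "wf_fm L (Const r) \<longleftrightarrow> True"
| "wf_fm L (Dist s t) \<longleftrightarrow> wf_tm L s \<and> wf_tm L t"
| "wf_fm L (Rel R ts) \<longleftrightarrow> R \<in> rel_syms L \<and> length ts = rel_ar L R \<and> list_all (wf_tm L) ts"
| "wf_fm L (Scale r \<phi>) \<longleftrightarrow> wf_fm L \<phi>"
| "wf_fm L (Add \<phi> \<psi>) \<longleftrightarrow> wf_fm L \<phi> \<and> wf_fm L \<psi>"
| "wf_fm L (SupF x \<phi>) \<longleftrightarrow> wf_fm L \<phi>"
| "wf_fm L (InfF x \<phi>) \<longleftrightarrow> wf_fm L \<phi>"

primrec fv_tm :: "('c, 'f) tm \<Rightarrow> nat set" where
  "fv_tm (Var x) = {x}"
| "fv_tm (Cst c) = {}"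
| "fv_tm (App F ts) = \<Union> (set (map fv_tm ts))"

primrec fv :: "('c, 'f, 'r) fm \<Rightarrow> nat set" where
  "fv (Const r) = {}"
| "fv (Dist s t) = fv_tm s \<union> fv_tm t"
| "fv (Rel R ts) = \<Union> (set (map fv_tm ts))"
| "fv (Scale r \<phi>) = fv \<phi>"
| "fv (Add \<phi> \<psi>) = fv \<phi> \<union> fv \<psi>"
| "fv (SupF x \<phi>) = fv \<phi> - {x}"
| "fv (InfF x \<phi>) = fv \<phi> - {x}"

text \<open>The \<open>n\<close> distinguished variables are \<open>0, \<dots>, n - 1\<close>.\<close>

definition formulas :: "('c, 'f, 'r) language \<Rightarrow> nat \<Rightarrow> ('c, 'f, 'r) fm set" where
  "formulas L n = {\<phi>. wf_fm L \<phi> \<and> fv \<phi> \<subseteq> {..<n}}"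

definition sentences :: "('c, 'f, 'r) language \<Rightarrow> ('c, 'f, 'r) fm set" where
  "sentences L = {\<phi>. wf_fm L \<phi> \<and> fv \<phi> = {}}"

text \<open>The pair \<open>(\<phi>, \<psi>)\<close> is the condition \<open>\<phi> \<le> \<psi>\<close>.\<close>

type_synonym ('c, 'f, 'r) condition = "('c, 'f, 'r) fm \<times> ('c, 'f, 'r) fm"

definition affine_theory :: "('c, 'f, 'r) language \<Rightarrow> ('c, 'f, 'r) condition set \<Rightarrow> bool" where
  "affine_theory L T \<longleftrightarrow> T \<subseteq> sentences L \<times> sentences L"


section \<open>Structures and models\<close>

record ('c, 'f, 'r, 'a) lstruct =
  carr :: "'a set"
  dst :: "'a \<Rightarrow> 'a \<Rightarrow> real"
  cst_of :: "'c \<Rightarrow> 'a"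
  fun_of :: "'f \<Rightarrow> 'a list \<Rightarrow> 'a"
  rel_of :: "'r \<Rightarrow> 'a list \<Rightarrow> real"

definition tuples :: "'a set \<Rightarrow> nat \<Rightarrow> 'a list set" where
  "tuples A n = {xs. length xs = n \<and> set xs \<subseteq> A}"

definition tuple_dist :: "('a \<Rightarrow> 'a \<Rightarrow> real) \<Rightarrow> 'a list \<Rightarrow> 'a list \<Rightarrow> real" where
  "tuple_dist d xs ys = (\<Sum>i<length xs. (1/2) ^ i * d (xs ! i) (ys ! i))"

text \<open>Structures are nonempty, so that suprema and infima are taken over nonempty sets.\<close>

definition is_structure :: "('c, 'f, 'r) language \<Rightarrow> ('c, 'f, 'r, 'a) lstruct \<Rightarrow> bool" where
  "is_structure L M \<longleftrightarrow>
     carr M \<noteq> {} \<and>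
     Metric_space (carr M) (dst M) \<and> Metric_space.mcomplete (carr M) (dst M) \<and>
     (\<forall>x\<in>carr M. \<forall>y\<in>carr M. dst M x y \<le> 1) \<and>
     (\<forall>c\<in>cst_syms L. cst_of M c \<in> carr M) \<and>
     (\<forall>F\<in>fun_syms L.
        (\<forall>xs\<in>tuples (carr M) (fun_ar L F). fun_of M F xs \<in> carr M) \<and>
        (\<forall>xs\<in>tuples (carr M) (fun_ar L F). \<forall>ys\<in>tuples (carr M) (fun_ar L F).
           dst M (fun_of M F xs) (fun_of M F ys) \<le> fun_lip L F * tuple_dist (dst M) xs ys)) \<and>
     (\<forall>R\<in>rel_syms L.
        (\<forall>xs\<in>tuples (carr M) (rel_ar L R). \<bar>rel_of M R xs\<bar> \<le> 1) \<and>
        (\<forall>xs\<in>tuples (carr M) (rel_ar L R). \<forall>ys\<in>tuples (carr M) (rel_ar L R).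
           \<bar>rel_of M R xs - rel_of M R ys\<bar> \<le> rel_lip L R * tuple_dist (dst M) xs ys))"

primrec tm_val :: "('c, 'f, 'r, 'a) lstruct \<Rightarrow> (nat \<Rightarrow> 'a) \<Rightarrow> ('c, 'f) tm \<Rightarrow> 'a" where
  "tm_val M v (Var x) = v x"
| "tm_val M v (Cst c) = cst_of M c"
| "tm_val M v (App F ts) = fun_of M F (map (tm_val M v) ts)"

primrec fm_val :: "('c, 'f, 'r, 'a) lstruct \<Rightarrow> ('c, 'f, 'r) fm \<Rightarrow> (nat \<Rightarrow> 'a) \<Rightarrow> real" where
  "fm_val M (Const r) v = r"
| "fm_val M (Dist s t) v = dst M (tm_val M v s) (tm_val M v t)"
| "fm_val M (Rel R ts) v = rel_of M R (map (tm_val M v) ts)"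
| "fm_val M (Scale r \<phi>) v = r * fm_val M \<phi> v"
| "fm_val M (Add \<phi> \<psi>) v = fm_val M \<phi> v + fm_val M \<psi> v"
| "fm_val M (SupF x \<phi>) v = (SUP a\<in>carr M. fm_val M \<phi> (v(x := a)))"
| "fm_val M (InfF x \<phi>) v = (INF a\<in>carr M. fm_val M \<phi> (v(x := a)))"

text \<open>For sentences the assignment \<open>v\<close> is irrelevant; free variables are read universally.\<close>

definition holds :: "('c, 'f, 'r, 'a) lstruct \<Rightarrow> ('c, 'f, 'r) condition \<Rightarrow> bool" where
  "holds M c \<longleftrightarrow> (\<forall>v. range v \<subseteq> carr M \<longrightarrow> fm_val M (fst c) v \<le> fm_val M (snd c) v)"

definition is_model ::
  "('c, 'f, 'r) language \<Rightarrow> ('c, 'f, 'r) condition set \<Rightarrow> ('c, 'f, 'r, 'a) lstruct \<Rightarrow> bool" where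
  "is_model L T M \<longleftrightarrow> is_structure L M \<and> (\<forall>c\<in>T. holds M c)"


section \<open>Entailment, complete and ample theories\<close>

text \<open>
  HOL cannot quantify over structures of all types at once, so the notions referring to ``all
  models'' or ``some model'' take as a parameter the type \<open>'m\<close> that provides the carriers of the
  models. A theory that is complete and ample in the usual sense is so over every type \<open>'m\<close> large
  enough to accommodate an ample model; over such a type, entailment has its usual meaning for
  it, since a complete theory is decided by any one of its models.
\<close>

definition entails ::
  "'m itself \<Rightarrow> ('c, 'f, 'r) language \<Rightarrow> ('c, 'f, 'r) condition set \<Rightarrow> ('c, 'f, 'r) condition \<Rightarrow> bool"
  where
  "entails U L T c \<longleftrightarrow> (\<forall>M :: ('c, 'f, 'r, 'm) lstruct. is_model L T M \<longrightarrow> holds M c)"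

definition entails_eq ::
  "'m itself \<Rightarrow> ('c, 'f, 'r) language \<Rightarrow> ('c, 'f, 'r) condition set \<Rightarrow>
     ('c, 'f, 'r) fm \<Rightarrow> ('c, 'f, 'r) fm \<Rightarrow> bool" where
  "entails_eq U L T \<phi> \<psi> \<longleftrightarrow> entails U L T (\<phi>, \<psi>) \<and> entails U L T (\<psi>, \<phi>)"

definition complete_theory ::
  "'m itself \<Rightarrow> ('c, 'f, 'r) language \<Rightarrow> ('c, 'f, 'r) condition set \<Rightarrow> bool" where
  "complete_theory U L T \<longleftrightarrow>
     (\<exists>M :: ('c, 'f, 'r, 'm) lstruct. is_model L T M) \<and>
     (\<forall>\<sigma>\<in>sentences L. \<exists>!r. entails_eq U L T \<sigma> (Const r))"

definition ample_theory ::
  "'m itself \<Rightarrow> ('c, 'f, 'r) language \<Rightarrow> ('c, 'f, 'r) condition set \<Rightarrow> bool" where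
  "ample_theory U L T \<longleftrightarrow>
     (\<exists>M :: ('c, 'f, 'r, 'm) lstruct. is_model L T M \<and>
        (\<exists>a :: nat \<Rightarrow> 'm. range a \<subseteq> carr M \<and> (\<forall>m n. m \<noteq> n \<longrightarrow> dst M (a m) (a n) = 1)))"


section \<open>Types\<close>

definition fm_equiv ::
  "'m itself \<Rightarrow> ('c, 'f, 'r) language \<Rightarrow> ('c, 'f, 'r) condition set \<Rightarrow> nat \<Rightarrow>
     (('c, 'f, 'r) fm \<times> ('c, 'f, 'r) fm) set" where
  "fm_equiv U L T n =
     {(\<phi>, \<psi>). \<phi> \<in> formulas L n \<and> \<psi> \<in> formulas L n \<and> entails_eq U L T \<phi> \<psi>}"

definition fm_class ::
  "'m itself \<Rightarrow> ('c, 'f, 'r) language \<Rightarrow> ('c, 'f, 'r) condition set \<Rightarrow> nat \<Rightarrow>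
     ('c, 'f, 'r) fm \<Rightarrow> ('c, 'f, 'r) fm set" where
  "fm_class U L T n \<phi> = fm_equiv U L T n `` {\<phi>}"

definition D_space ::
  "'m itself \<Rightarrow> ('c, 'f, 'r) language \<Rightarrow> ('c, 'f, 'r) condition set \<Rightarrow> nat \<Rightarrow>
     ('c, 'f, 'r) fm set set" where
  "D_space U L T n = formulas L n // fm_equiv U L T n"

text \<open>
  Positive normalised linear functionals on the quotient, whose operations and order are given
  on representatives. Extensionality makes two types equal as soon as they agree on \<open>D_space\<close>;
  it is preserved by convex combinations.
\<close>

definition n_types ::
  "'m itself \<Rightarrow> ('c, 'f, 'r) language \<Rightarrow> ('c, 'f, 'r) condition set \<Rightarrow> nat \<Rightarrow>
     (('c, 'f, 'r) fm set \<Rightarrow> real) set" where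
  "n_types U L T n =
     {p \<in> extensional (D_space U L T n).
        (\<forall>\<phi>\<in>formulas L n. \<forall>\<psi>\<in>formulas L n.
           p (fm_class U L T n (Add \<phi> \<psi>)) = p (fm_class U L T n \<phi>) + p (fm_class U L T n \<psi>)) \<and>
        (\<forall>r. \<forall>\<phi>\<in>formulas L n.
           p (fm_class U L T n (Scale r \<phi>)) = r * p (fm_class U L T n \<phi>)) \<and>
        (\<forall>\<phi>\<in>formulas L n. entails U L T (Const 0, \<phi>) \<longrightarrow> 0 \<le> p (fm_class U L T n \<phi>)) \<and>
        p (fm_class U L T n (Const 1)) = 1}"

text \<open>The library's \<open>extreme_point_of\<close>, spelled out because function types are not real vector
  spaces there.\<close>

definition extreme_types ::
  "'m itself \<Rightarrow> ('c, 'f, 'r) language \<Rightarrow> ('c, 'f, 'r) condition set \<Rightarrow> nat \<Rightarrow>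
     (('c, 'f, 'r) fm set \<Rightarrow> real) set" where
  "extreme_types U L T n =
     {p \<in> n_types U L T n.
        \<not> (\<exists>q1\<in>n_types U L T n. \<exists>q2\<in>n_types U L T n. \<exists>t. q1 \<noteq> q2 \<and> 0 < t \<and> t < 1 \<and>
             p = (\<lambda>X. (1 - t) * q1 X + t * q2 X))}"

text \<open>
  The \<open>n\<close>-tuple realizing a type is given by the values of an assignment below \<open>n\<close>; its other
  values do not affect formulas in \<open>formulas L n\<close>. The realizing model may have a carrier type
  other than \<open>'m\<close>.
\<close>

definition realizes ::
  "'m itself \<Rightarrow> ('c, 'f, 'r) language \<Rightarrow> ('c, 'f, 'r) condition set \<Rightarrow> nat \<Rightarrow>
     ('c, 'f, 'r, 'a) lstruct \<Rightarrow> (nat \<Rightarrow> 'a) \<Rightarrow> (('c, 'f, 'r) fm set \<Rightarrow> real) \<Rightarrow> bool" where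
  "realizes U L T n M a p \<longleftrightarrow>
     (\<forall>i<n. a i \<in> carr M) \<and> (\<forall>\<phi>\<in>formulas L n. p (fm_class U L T n \<phi>) = fm_val M \<phi> a)"

definition omits ::
  "'m itself \<Rightarrow> ('c, 'f, 'r) language \<Rightarrow> ('c, 'f, 'r) condition set \<Rightarrow> nat \<Rightarrow>
     ('c, 'f, 'r, 'a) lstruct \<Rightarrow> (('c, 'f, 'r) fm set \<Rightarrow> real) \<Rightarrow> bool" where
  "omits U L T n M p \<longleftrightarrow> \<not> (\<exists>a. realizes U L T n M a p)"

text \<open>
  A carrier type for the model to be constructed: it has at least \<open>\<kappa> ^ \<aleph>\<^sub>0\<close> elements, where
  \<open>\<kappa>\<close> is the number of finite strings over the symbols, the reals and \<open>'k\<close>. This is room enough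
  for the metric completion of a term model.
\<close>

type_synonym ('c, 'f, 'r, 'k) univ = "('c + 'f + 'r + 'k + real) list set"

end

theory Submission
  imports Defs
begin

text \<open>
  The model is a Henkin model built inside a closed face of a compact convex set of functionals.

  Start from an ample model \<open>M\<close>. Besides one constant \<open>Ext k\<close> for each \<open>k\<close> in the index type of
  \<open>lam\<close>, adjoin for every formula a constant meant to be a point where the infimum of the formula
  over one of its variables is attained. A type of all these witnesses at once is a state: a positive
  normalised linear functional on the formulas with witnesses substituted for the free variables.
  States form a compact convex set, and two demands are made on them: a formula has at the witness of
  its infimum the value of the infimum, and different \<open>Ext k\<close> have distance \<open>1\<close>. In every state the
  formula is at least its infimum and distances are at most \<open>1\<close>, so both demands say that an affine
  function attains its bound; hence they cut out a closed face. The face is nonempty by compactness: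
  finitely many of the \<open>Ext k\<close> can be interpreted by members of the infinite sequence at mutual
  distance \<open>1\<close>, and infima are attained up to \<open>e\<close>. An extreme point \<open>p\<close> of the face is an extreme
  state (\<open>extreme_witnessed_state_exists\<close>).

  The witnesses with the pseudometric that \<open>p\<close> assigns to them are dense in a complete structure
  (\<open>witness_model_exists\<close>), in which every formula has at witnesses the value given by \<open>p\<close>
  (\<open>fm_val_j\<close>, by the Henkin property). So the structure is a model of the complete theory, and it is
  large because the \<open>Ext k\<close> are separated.

  It remains to see that a tuple \<open>a\<close> of this model has an extreme type
  (\<open>realized_type_indecomposable\<close>). Suppose that its type is \<open>(1 - t) * q1 + t * q2\<close>. Let \<open>P\<close> be the
  joint type of \<open>a\<close> and all witnesses. The crucial point is that the decomposition lifts to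
  \<open>P = (1 - t) * r1 + t * r2\<close> with \<open>r1\<close>, \<open>r2\<close> extending \<open>q1\<close>, \<open>q2\<close>
  (\<open>convex_decomposition_lifts\<close>): the obstruction found by Hahn--Banach is an inequality between
  formulas, and it disappears when the infimum over the witnesses is taken, which is again a formula
  in the variables of \<open>a\<close>. On the witnesses, \<open>r1\<close> and \<open>r2\<close> both coincide with the extreme state
  \<open>p\<close>. Now choose witnesses \<open>c\<close> close to \<open>a\<close>. As \<open>P\<close> gives a small value to the distance of \<open>a\<close> and
  \<open>c\<close>, so do \<open>r1\<close> and \<open>r2\<close>; formulas are Lipschitz, so \<open>q1\<close> and \<open>q2\<close> are both close to the type of
  \<open>c\<close>. Hence \<open>q1 = q2\<close>.
\<close>

section \<open>States on function spaces, and extreme points\<close>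

text \<open>
  Abstracts from the ordered vector spaces \<open>D\<^sub>n(T)\<close>: the members of \<open>E\<close> will be the functions
  that formulas define on assignments.
\<close>

locale function_space =
  fixes E :: "('x \<Rightarrow> real) set"
  assumes one: "(\<lambda>_. 1) \<in> E"
    and add: "\<And>g h. g \<in> E \<Longrightarrow> h \<in> E \<Longrightarrow> (\<lambda>x. g x + h x) \<in> E"
    and scale: "\<And>s g. g \<in> E \<Longrightarrow> (\<lambda>x. s * g x) \<in> E"
    and bounded: "\<And>g. g \<in> E \<Longrightarrow> \<exists>B. \<forall>x. \<bar>g x\<bar> \<le> B"
begin

lemma const: "(\<lambda>_. s) \<in> E"
  using scale[OF one, of s] by simp

lemma uminus: "g \<in> E \<Longrightarrow> (\<lambda>x. - g x) \<in> E"
  using scale[of g "-1"] by simp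

lemma diff: "g \<in> E \<Longrightarrow> h \<in> E \<Longrightarrow> (\<lambda>x. g x - h x) \<in> E"
  using add[OF _ uminus, of g h] by simp

lemma sum: "finite A \<Longrightarrow> (\<And>i. i \<in> A \<Longrightarrow> g i \<in> E) \<Longrightarrow> (\<lambda>x. \<Sum>i\<in>A. g i x) \<in> E"
proof (induction A rule: finite_induct)
  case empty
  then show ?case using const[of 0] by simp
next
  case (insert a A)
  then show ?case using add[of "g a" "\<lambda>x. \<Sum>i\<in>A. g i x"] by simp
qed

end

text \<open>
  The value \<open>0\<close> outside \<open>E\<close> makes states equal as soon as they agree on \<open>E\<close>, and keeps the set of
  states compact in the product topology.
\<close>

definition states :: "('x \<Rightarrow> real) set \<Rightarrow> (('x \<Rightarrow> real) \<Rightarrow> real) set" where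
  "states E = {p. (\<forall>g. g \<notin> E \<longrightarrow> p g = 0) \<and>
     (\<forall>g\<in>E. \<forall>h\<in>E. p (\<lambda>x. g x + h x) = p g + p h) \<and>
     (\<forall>s. \<forall>g\<in>E. p (\<lambda>x. s * g x) = s * p g) \<and>
     (\<forall>g\<in>E. (\<forall>x. 0 \<le> g x) \<longrightarrow> 0 \<le> p g) \<and> p (\<lambda>_. 1) = 1}"

definition extreme_state :: "('x \<Rightarrow> real) set \<Rightarrow> (('x \<Rightarrow> real) \<Rightarrow> real) \<Rightarrow> bool" where
  "extreme_state E p \<longleftrightarrow> p \<in> states E \<and> (\<forall>q1\<in>states E. \<forall>q2\<in>states E. \<forall>t. 0 < t \<longrightarrow> t < 1 \<longrightarrow>
     p = (\<lambda>g. (1 - t) * q1 g + t * q2 g) \<longrightarrow> q1 = p \<and> q2 = p)"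

lemma statesI:
  assumes "\<And>g. g \<notin> E \<Longrightarrow> p g = 0"
    and "\<And>g h. g \<in> E \<Longrightarrow> h \<in> E \<Longrightarrow> p (\<lambda>x. g x + h x) = p g + p h"
    and "\<And>s g. g \<in> E \<Longrightarrow> p (\<lambda>x. s * g x) = s * p g"
    and "\<And>g. g \<in> E \<Longrightarrow> (\<And>x. 0 \<le> g x) \<Longrightarrow> 0 \<le> p g"
    and "p (\<lambda>_. 1) = 1"
  shows "p \<in> states E"
  using assms unfolding states_def by blast

locale state = function_space +
  fixes p
  assumes state: "p \<in> states E"
begin

lemma p_outside: "g \<notin> E \<Longrightarrow> p g = 0"
  and p_add: "g \<in> E \<Longrightarrow> h \<in> E \<Longrightarrow> p (\<lambda>x. g x + h x) = p g + p h"
  and p_scale: "g \<in> E \<Longrightarrow> p (\<lambda>x. s * g x) = s * p g"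
  and p_nonneg: "g \<in> E \<Longrightarrow> (\<And>x. 0 \<le> g x) \<Longrightarrow> 0 \<le> p g"
  and p_one: "p (\<lambda>_. 1) = 1"
  using state unfolding states_def by blast+

lemma p_const: "p (\<lambda>_. s) = s"
  using p_scale[OF one, of s] p_one by simp

lemma p_uminus: "g \<in> E \<Longrightarrow> p (\<lambda>x. - g x) = - p g"
  using p_scale[of g "-1"] by simp

lemma p_diff: "g \<in> E \<Longrightarrow> h \<in> E \<Longrightarrow> p (\<lambda>x. g x - h x) = p g - p h"
  using p_add[OF _ uminus, of g h] by (simp add: p_uminus)

lemma p_mono:
  assumes "g \<in> E" "h \<in> E" "\<And>x. g x \<le> h x"
  shows "p g \<le> p h"
proof -
  have "0 \<le> p (\<lambda>x. h x - g x)" using assms by (intro p_nonneg diff) auto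
  then show ?thesis using assms by (simp add: p_diff)
qed

lemma p_sum:
  "finite A \<Longrightarrow> (\<And>i. i \<in> A \<Longrightarrow> g i \<in> E) \<Longrightarrow> p (\<lambda>x. \<Sum>i\<in>A. g i x) = (\<Sum>i\<in>A. p (g i))"
proof (induction A rule: finite_induct)
  case empty
  then show ?case using p_const[of 0] by simp
next
  case (insert a A)
  then show ?case using p_add[of "g a" "\<lambda>x. \<Sum>i\<in>A. g i x"] sum[of A g] by simp
qed

lemma p_abs_le:
  assumes "g \<in> E" "h \<in> E" "\<And>x. \<bar>g x\<bar> \<le> h x"
  shows "\<bar>p g\<bar> \<le> p h"
proof -
  have "p g \<le> p h" using assms by (intro p_mono) (auto intro: order_trans[OF abs_ge_self])
  moreover have "p (\<lambda>x. - g x) \<le> p h"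
    using assms by (intro p_mono uminus) (auto intro: order_trans[OF abs_ge_minus_self])
  ultimately show ?thesis using assms by (simp add: p_uminus abs_le_iff)
qed

end

context function_space begin

text \<open>
  Tychonoff: a state sends \<open>g\<close> into \<open>[-B, B]\<close> for any bound \<open>B\<close> of \<open>\<bar>g\<bar>\<close>, and each instance of a
  clause in the definition of states constrains finitely many coordinates by a closed condition.
\<close>

lemma compact_states: "compact (states E)" (is ?compact)
  and closed_states: "closed (states E)" (is ?closed)
proof -
  obtain B where B: "\<And>g x. g \<in> E \<Longrightarrow> \<bar>g x\<bar> \<le> B g" using bounded by metis
  let ?B = "\<lambda>g. if g \<in> E then B g else 0"
  have sub: "states E \<subseteq> (\<Pi>\<^sub>E g\<in>UNIV. {- ?B g..?B g})"
  proof
    fix p assume "p \<in> states E"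
    then interpret state E p by unfold_locales
    have "\<bar>p g\<bar> \<le> ?B g" for g
    proof (cases "g \<in> E")
      case True
      have "\<bar>p g\<bar> \<le> p (\<lambda>_. B g)" using B True by (intro p_abs_le const) auto
      then show ?thesis using True p_const by simp
    qed (simp add: p_outside)
    then show "p \<in> (\<Pi>\<^sub>E g\<in>UNIV. {- ?B g..?B g})"
      by (fastforce simp: PiE_def abs_le_iff minus_le_iff)
  qed
  have cpt: "compact (\<Pi>\<^sub>E g\<in>UNIV. {- ?B g..?B g})"
  proof -
    have "compactin (product_topology (\<lambda>_. euclidean) UNIV) (\<Pi>\<^sub>E g\<in>UNIV. {- ?B g..?B g})"
      by (rule compactin_PiE[THEN iffD2], rule disjI2, rule ballI, unfold compactin_euclidean_iff, rule compact_Icc)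
    then show ?thesis unfolding euclidean_product_topology compactin_euclidean_iff .
  qed
  have cont: "continuous_on UNIV (\<lambda>p :: ('x \<Rightarrow> real) \<Rightarrow> real. p g)" for g
    by (rule continuous_on_product_coordinates)
  show ?closed
    unfolding states_def Ball_def
    by (intro closed_Collect_conj closed_Collect_all closed_Collect_imp open_Collect_const
        closed_Collect_eq closed_Collect_le continuous_intros cont)
  with cpt have "compact ((\<Pi>\<^sub>E g\<in>UNIV. {- ?B g..?B g}) \<inter> states E)" by (rule compact_Int_closed)
  with sub show ?compact by (simp add: Int_absorb1)
qed

end

text \<open>
  The argument of Krein and Milman. By compactness there is a minimal closed face. If two of its
  points differed in a coordinate \<open>e\<close>, its points with least \<open>e\<close>-th coordinate would form a smaller
  closed face; so it has only one point, and this point is extreme.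
\<close>

lemma compact_has_extreme_point:
  fixes K :: "('a \<Rightarrow> real) set"
  assumes "compact K" "closed K" "K \<noteq> {}"
  shows "\<exists>p\<in>K. \<forall>q1\<in>K. \<forall>q2\<in>K. \<forall>t. 0 < t \<longrightarrow> t < 1 \<longrightarrow> p = (\<lambda>x. (1 - t) * q1 x + t * q2 x) \<longrightarrow> q1 = q2"
proof -
  define face where "face F \<longleftrightarrow> F \<subseteq> K \<and> closed F \<and> F \<noteq> {} \<and>
    (\<forall>q1\<in>K. \<forall>q2\<in>K. \<forall>t. 0 < t \<longrightarrow> t < 1 \<longrightarrow> (\<lambda>x. (1 - t) * q1 x + t * q2 x) \<in> F \<longrightarrow> q1 \<in> F \<and> q2 \<in> F)"
    for F
  have faceK: "face K" using assms(2,3) by (simp add: face_def)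
  let ?A = "Collect face"
  have "\<exists>m\<in>?A. \<forall>a\<in>?A. a \<subseteq> m \<longrightarrow> a = m"
  proof (rule predicate_Zorn[where P="\<lambda>a b. b \<subseteq> a"])
    show "partial_order_on ?A (relation_of (\<lambda>a b. b \<subseteq> a) ?A)"
      by (rule partial_order_on_relation_ofI) auto
  next
    fix C assume C: "C \<in> Chains (relation_of (\<lambda>a b. b \<subseteq> a) ?A)"
    have CA: "face X" if "X \<in> C" for X using C that by (auto simp: Chains_def relation_of_def)
    have lin: "X \<subseteq> Y \<or> Y \<subseteq> X" if "X \<in> C" "Y \<in> C" for X Y
      using C that by (auto simp: Chains_def relation_of_def)
    show "\<exists>u\<in>?A. \<forall>a\<in>C. u \<subseteq> a"
    proof (cases "C = {}")
      case True
      then show ?thesis using faceK by blast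
    next
      case False
      have least: "\<exists>m\<in>D. \<forall>X\<in>D. m \<subseteq> X" if "finite D" "D \<noteq> {}" "D \<subseteq> C" for D
        using that
      proof (induction D rule: finite_ne_induct)
        case (insert X D)
        then obtain m where "m \<in> D" "\<forall>Y\<in>D. m \<subseteq> Y" by auto
        moreover have "m \<subseteq> X \<or> X \<subseteq> m" using lin[of m X] \<open>m \<in> D\<close> insert.prems by auto
        ultimately show ?case by (metis insert_iff order_refl order_trans)
      qed simp
      have "K \<inter> \<Inter>C \<noteq> {}"
      proof (rule compact_imp_fip[OF assms(1)])
        show "closed X" if "X \<in> C" for X using CA[OF that] by (simp add: face_def)
        show "K \<inter> \<Inter>D \<noteq> {}" if D: "finite D" "D \<subseteq> C" for D
        proof (cases "D = {}")
          case True
          then show ?thesis using assms(3) by simp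
        next
          case False
          then obtain m where m: "m \<in> D" "\<forall>X\<in>D. m \<subseteq> X" using least[OF D(1) _ D(2)] by metis
          then have "face m" using D(2) CA[of m] by auto
          then have "m \<noteq> {}" "m \<subseteq> K" by (simp_all add: face_def)
          moreover have "m \<subseteq> \<Inter>D" using m by blast
          ultimately show ?thesis by blast
        qed
      qed
      have sub: "X \<subseteq> K" if "X \<in> C" for X using CA[OF that] by (simp add: face_def)
      then have "\<Inter>C \<subseteq> K" using False by blast
      with \<open>K \<inter> \<Inter>C \<noteq> {}\<close> have ne: "\<Inter>C \<noteq> {}" by blast
      have "face (\<Inter>C)"
        unfolding face_def
      proof (intro conjI ballI allI impI)
        show "closed (\<Inter>C)" using CA by (simp add: face_def closed_Inter)
      next
        fix q1 q2 t
        assume q: "q1 \<in> K" "q2 \<in> K" "0 < (t::real)" "t < 1" "(\<lambda>x. (1 - t) * q1 x + t * q2 x) \<in> \<Inter>C"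
        have "q1 \<in> X \<and> q2 \<in> X" if "X \<in> C" for X
          using CA[OF that] q that unfolding face_def by blast
        then show "q1 \<in> \<Inter>C" "q2 \<in> \<Inter>C" by auto
      qed (use \<open>\<Inter>C \<subseteq> K\<close> ne in auto)
      then show ?thesis by auto
    qed
  qed
  then obtain F where F: "face F" and min: "\<And>G. face G \<Longrightarrow> G \<subseteq> F \<Longrightarrow> G = F" by blast
  have coord: "continuous_on F (\<lambda>p. p e)" for e
    by (rule continuous_on_subset[OF continuous_on_product_coordinates]) simp
  have const: "q e = q' e" if "q \<in> F" "q' \<in> F" for q q' e
  proof -
    have "compact F" using F assms(1) by (metis face_def compact_Int_closed inf.absorb_iff2)
    moreover have "F \<noteq> {}" using F by (simp add: face_def)
    ultimately obtain m where m: "m \<in> F" "\<forall>q\<in>F. m e \<le> q e"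
      using continuous_attains_inf[OF _ _ coord] by blast
    let ?G = "F \<inter> {q. q e = m e}"
    have "face ?G"
      unfolding face_def
    proof (intro conjI ballI allI impI)
      show "?G \<subseteq> K" using F by (auto simp: face_def)
      show "closed ?G" using F
        by (auto simp: face_def intro!: closed_Int closed_Collect_eq continuous_on_product_coordinates continuous_intros)
      show "?G \<noteq> {}" using m by auto
    next
      fix q1 q2 t assume q: "q1 \<in> K" "q2 \<in> K" "0 < (t::real)" "t < 1" "(\<lambda>x. (1 - t) * q1 x + t * q2 x) \<in> ?G"
      then have in_F: "q1 \<in> F" "q2 \<in> F" using F by (auto simp: face_def)
      have eq: "(1 - t) * q1 e + t * q2 e = m e" using q by simp
      have "m e \<le> q1 e" "m e \<le> q2 e" using m in_F by auto
      then have "(1 - t) * m e \<le> (1 - t) * q1 e" "t * m e \<le> t * q2 e" using q by auto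
      moreover have "m e = (1 - t) * m e + t * m e" by (simp add: algebra_simps)
      ultimately have "(1 - t) * q1 e = (1 - t) * m e" "t * q2 e = t * m e"
        using eq by linarith+
      then have "q1 e = m e" "q2 e = m e" using q(3,4) by simp_all
      then show "q1 \<in> ?G" "q2 \<in> ?G" using in_F by auto
    qed
    then have "?G = F" by (rule min) auto
    then have "q e = m e" "q' e = m e" using that by blast+
    then show ?thesis by simp
  qed
  have "F \<noteq> {}" "F \<subseteq> K" using F by (auto simp: face_def)
  then obtain p where p: "p \<in> F" "p \<in> K" by blast
  show ?thesis
  proof (intro bexI[OF _ p(2)] ballI allI impI)
    fix q1 q2 t assume "q1 \<in> K" "q2 \<in> K" "0 < (t::real)" "t < 1" "p = (\<lambda>x. (1 - t) * q1 x + t * q2 x)"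
    then have "q1 \<in> F" "q2 \<in> F" using F p by (auto simp: face_def)
    then show "q1 = q2" using const by blast
  qed
qed

section \<open>Sublinear functionals and lifting of convex decompositions\<close>

text \<open>
  Hahn--Banach, with the linear functional found as a minimal sublinear one. If \<open>f\<close> is minimal, then
  for each \<open>y\<close> the functional \<open>x \<mapsto> INF s\<ge>0. f (x + s * y) - s * f y\<close> is sublinear and at most \<open>f\<close>,
  hence equal to \<open>f\<close>; its member for \<open>s = 1\<close> shows that \<open>f\<close> is superadditive.
\<close>

lemma (in function_space) linear_below_sublinear:
  assumes sub: "\<And>g h. g \<in> E \<Longrightarrow> h \<in> E \<Longrightarrow> N (\<lambda>x. g x + h x) \<le> N g + N h"
    and hom: "\<And>s g. 0 \<le> s \<Longrightarrow> g \<in> E \<Longrightarrow> N (\<lambda>x. s * g x) = s * N g"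
  obtains f :: "('x \<Rightarrow> real) \<Rightarrow> real"
  where "\<And>g. g \<notin> E \<Longrightarrow> f g = 0" "\<And>g. g \<in> E \<Longrightarrow> f g \<le> N g"
    "\<And>g h. g \<in> E \<Longrightarrow> h \<in> E \<Longrightarrow> f (\<lambda>x. g x + h x) = f g + f h"
    "\<And>s g. g \<in> E \<Longrightarrow> f (\<lambda>x. s * g x) = s * f g"
proof -
  define S where "S f \<longleftrightarrow> (\<forall>g. g \<notin> E \<longrightarrow> f g = 0) \<and> (\<forall>g\<in>E. f g \<le> N g) \<and>
    (\<forall>g\<in>E. \<forall>h\<in>E. f (\<lambda>x. g x + h x) \<le> f g + f h) \<and>
    (\<forall>s\<ge>0. \<forall>g\<in>E. f (\<lambda>x. s * g x) = s * f g)" for f :: "('x \<Rightarrow> real) \<Rightarrow> real"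
  have out: "f g = 0" if "S f" "g \<notin> E" for f g using that by (simp add: S_def)
  have le: "f g \<le> N g" if "S f" "g \<in> E" for f g using that by (simp add: S_def)
  have subadd: "f (\<lambda>x. g x + h x) \<le> f g + f h" if "S f" "g \<in> E" "h \<in> E" for f g h
    using that by (simp add: S_def)
  have poshom: "f (\<lambda>x. s * g x) = s * f g" if "S f" "0 \<le> s" "g \<in> E" for f s g
    using that by (simp add: S_def)
  have zero: "f (\<lambda>_. 0) = 0" if "S f" for f
    using poshom[OF that _ one, of 0] by simp
  have neg: "- f (\<lambda>x. - g x) \<le> f g" if "S f" "g \<in> E" for f g
    using subadd[OF that uminus[OF that(2)]] zero[OF that(1)] by simp
  have lower: "- N (\<lambda>x. - g x) \<le> f g" if "S f" "g \<in> E" for f g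
    using neg[OF that] le[OF that(1) uminus[OF that(2)]] by simp
  let ?A = "Collect S"
  have "\<exists>m\<in>?A. \<forall>a\<in>?A. (\<forall>e. a e \<le> m e) \<longrightarrow> a = m"
  proof (rule predicate_Zorn[where P="\<lambda>f g. \<forall>e. g e \<le> f e"])
    show "partial_order_on ?A (relation_of (\<lambda>f g. \<forall>e. g e \<le> f e) ?A)"
      by (rule partial_order_on_relation_ofI) (auto intro: order_trans intro!: ext antisym)
  next
    fix C assume C: "C \<in> Chains (relation_of (\<lambda>f g. \<forall>e. g e \<le> f e) ?A)"
    have CS: "S f" if "f \<in> C" for f using C that by (auto simp: Chains_def relation_of_def)
    have lin: "(\<forall>e. f e \<le> g e) \<or> (\<forall>e. g e \<le> f e)" if "f \<in> C" "g \<in> C" for f g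
      using C that by (auto simp: Chains_def relation_of_def)
    show "\<exists>u\<in>?A. \<forall>a\<in>C. \<forall>e. u e \<le> a e"
    proof (cases "C = {}")
      case True
      have "S (\<lambda>g. if g \<in> E then N g else 0)"
        unfolding S_def using sub hom add scale by auto
      with True show ?thesis by auto
    next
      case False
      define u where "u e = (if e \<in> E then INF f\<in>C. f e else 0)" for e
      have bdd: "bdd_below ((\<lambda>f. f e) ` C)" if "e \<in> E" for e
        using lower[OF CS that] by (intro bdd_belowI2)
      have u_le: "u e \<le> f e" if "f \<in> C" for f e
        using that bdd[of e] out[OF CS[OF that], of e] by (auto simp: u_def intro: cINF_lower)
      have u_ge: "c \<le> u e" if "\<And>f. f \<in> C \<Longrightarrow> c \<le> f e" "e \<in> E" for c e
        using that False by (auto simp: u_def intro: cINF_greatest)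
      have "S u"
        unfolding S_def
      proof (intro conjI allI ballI impI)
        show "u g = 0" if "g \<notin> E" for g using that by (simp add: u_def)
        show "u g \<le> N g" if "g \<in> E" for g
          using False u_le le[OF CS] that by (meson ex_in_conv order_trans)
      next
        fix g h assume gh: "g \<in> E" "h \<in> E"
        have *: "u (\<lambda>x. g x + h x) \<le> f1 g + f2 h" if f: "f1 \<in> C" "f2 \<in> C" for f1 f2
        proof -
          obtain f where f: "f \<in> C" "f g \<le> f1 g" "f h \<le> f2 h"
            using lin[OF f] f by (metis order_refl)
          have "u (\<lambda>x. g x + h x) \<le> f g + f h"
            using u_le[OF f(1)] subadd[OF CS[OF f(1)] gh] by (rule order_trans)
          with f show ?thesis by simp
        qed
        have "u (\<lambda>x. g x + h x) - f2 h \<le> u g" if "f2 \<in> C" for f2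
          using *[OF _ that] gh by (intro u_ge) (auto simp: algebra_simps)
        then have "u (\<lambda>x. g x + h x) - u g \<le> u h"
          using gh by (intro u_ge) (auto simp: algebra_simps)
        then show "u (\<lambda>x. g x + h x) \<le> u g + u h" by simp
      next
        fix s :: real and g assume s: "0 \<le> s" and g: "g \<in> E"
        have 1: "s * u g \<le> u (\<lambda>x. s * g x)"
          using s g by (intro u_ge scale) (auto simp: poshom[OF CS] intro: mult_left_mono u_le)
        have 2: "u (\<lambda>x. s * g x) \<le> s * f g" if "f \<in> C" for f
          using u_le[OF that] poshom[OF CS[OF that] s g] by metis
        have "u (\<lambda>x. s * g x) \<le> s * u g"
        proof (cases "s = 0")
          case True
          then show ?thesis using 2 False by auto
        next
          case False
          with s have "u (\<lambda>x. s * g x) / s \<le> u g"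
            using 2 g by (intro u_ge) (auto simp: field_simps)
          with False s show ?thesis by (simp add: field_simps)
        qed
        with 1 show "u (\<lambda>x. s * g x) = s * u g" by simp
      qed
      with u_le show ?thesis by auto
    qed
  qed
  then obtain f where f: "S f" and min: "\<And>h. S h \<Longrightarrow> (\<And>e. h e \<le> f e) \<Longrightarrow> h = f" by blast
  note f_sub = subadd[OF f] and f_hom = poshom[OF f]
  have superadd: "f x + f y \<le> f (\<lambda>z. x z + y z)" if x: "x \<in> E" and y: "y \<in> E" for x y
  proof -
    define k where "k s x = f (\<lambda>z. x z + s * y z) - s * f y" for s x
    define h where "h x = (if x \<in> E then INF s\<in>{0..}. k s x else 0)" for x
    have k_lower: "- f (\<lambda>z. - x z) \<le> k s x" if "0 \<le> s" "x \<in> E" for s x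
    proof -
      have "s * f y = f (\<lambda>z. (x z + s * y z) + - x z)" using f_hom[OF that(1) y] by simp
      also have "\<dots> \<le> f (\<lambda>z. x z + s * y z) + f (\<lambda>z. - x z)"
        using that y by (intro f_sub add scale uminus)
      finally show ?thesis by (simp add: k_def)
    qed
    have bdd: "bdd_below ((\<lambda>s. k s x) ` {0..})" if "x \<in> E" for x
      using k_lower[OF _ that] by (intro bdd_belowI2) auto
    have h_le: "h x \<le> k s x" if "0 \<le> s" "x \<in> E" for s x
      using that bdd[of x] by (auto simp: h_def intro: cINF_lower)
    have h_ge: "c \<le> h x" if "\<And>s. 0 \<le> s \<Longrightarrow> c \<le> k s x" "x \<in> E" for c x
      using that by (auto simp: h_def intro!: cINF_greatest)
    have h_le_f: "h x \<le> f x" for x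
      using h_le[of 0 x] out[OF f, of x] by (cases "x \<in> E") (auto simp: k_def h_def)
    have "S h"
      unfolding S_def
    proof (intro conjI allI ballI impI)
      show "h g = 0" if "g \<notin> E" for g using that by (simp add: h_def)
      show "h g \<le> N g" if "g \<in> E" for g
        using h_le_f[of g] le[OF f that] by simp
    next
      fix g g' assume g: "g \<in> E" "g' \<in> E"
      have *: "h (\<lambda>z. g z + g' z) \<le> k s g + k s' g'" if "0 \<le> s" "0 \<le> s'" for s s'
      proof -
        have "h (\<lambda>z. g z + g' z) \<le> f (\<lambda>z. (g z + s * y z) + (g' z + s' * y z)) - (s + s') * f y"
          using h_le[of "s + s'" "\<lambda>z. g z + g' z"] that add g by (simp add: k_def algebra_simps)
        also have "\<dots> \<le> k s g + k s' g'"
          using f_sub[of "\<lambda>z. g z + s * y z" "\<lambda>z. g' z + s' * y z"] g y add scale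
          by (simp add: k_def algebra_simps)
        finally show ?thesis .
      qed
      have "h (\<lambda>x. g x + g' x) - k s' g' \<le> h g" if "0 \<le> s'" for s'
        using *[OF _ that] g by (intro h_ge) (auto simp: algebra_simps)
      then have "h (\<lambda>x. g x + g' x) - h g \<le> h g'"
        using g by (intro h_ge) (auto simp: algebra_simps)
      then show "h (\<lambda>x. g x + g' x) \<le> h g + h g'" by simp
    next
      fix a :: real and g assume a: "0 \<le> a" and g: "g \<in> E"
      show "h (\<lambda>z. a * g z) = a * h g"
      proof (cases "a = 0")
        case True
        have "k s (\<lambda>_. 0) = 0" if "0 \<le> s" for s
          using f_hom[OF that y] by (simp add: k_def)
        then have "0 \<le> h (\<lambda>_. 0)" by (intro h_ge const) simp
        moreover have "h (\<lambda>_. 0) \<le> 0" using h_le_f[of "\<lambda>_. 0"] zero[OF f] by simp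
        ultimately show ?thesis using True by simp
      next
        case False
        with a have a: "0 < a" by simp
        have k_scale: "k (a * s) (\<lambda>z. a * g z) = a * k s g" if "0 \<le> s" for s
        proof -
          have "f (\<lambda>z. a * (g z + s * y z)) = a * f (\<lambda>z. g z + s * y z)"
            using a g y by (intro f_hom add scale) auto
          then show ?thesis by (simp add: k_def algebra_simps)
        qed
        have "a * h g \<le> k s (\<lambda>z. a * g z)" if s: "0 \<le> s" for s
        proof -
          have "a * h g \<le> a * k (s / a) g" using a s g by (intro mult_left_mono h_le) auto
          also have "\<dots> = k s (\<lambda>z. a * g z)" using k_scale[of "s / a"] a s by simp
          finally show ?thesis .
        qed
        then have "a * h g \<le> h (\<lambda>z. a * g z)" using g by (intro h_ge scale)
        moreover have "h (\<lambda>z. a * g z) / a \<le> h g"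
        proof (rule h_ge[OF _ g])
          fix s :: real assume "0 \<le> s"
          then have "h (\<lambda>z. a * g z) \<le> a * k s g"
            using h_le[of "a * s" "\<lambda>z. a * g z"] k_scale[of s] scale[OF g] a by simp
          then show "h (\<lambda>z. a * g z) / a \<le> k s g" using a by (simp add: field_simps)
        qed
        ultimately show ?thesis using a by (simp add: field_simps)
      qed
    qed
    then have "h = f" using h_le_f by (rule min)
    with h_le[of 1 x] x show ?thesis by (simp add: k_def)
  qed
  have add_f: "f (\<lambda>z. x z + y z) = f x + f y" if "x \<in> E" "y \<in> E" for x y
    using superadd[OF that] f_sub[OF that] by simp
  have scale_f: "f (\<lambda>z. s * x z) = s * f x" if "x \<in> E" for s x
  proof (cases "0 \<le> s")
    case True
    then show ?thesis using that by (rule f_hom)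
  next
    case False
    have "f (\<lambda>z. s * x z) + f (\<lambda>z. - s * x z) = f (\<lambda>z. s * x z + - s * x z)"
      using add_f[OF scale[OF that] scale[OF that], of s "- s"] by simp
    moreover have "f (\<lambda>z. - s * x z) = - s * f x" using False that by (intro f_hom) auto
    ultimately show ?thesis using zero[OF f] by simp
  qed
  show ?thesis
    by (rule that[of f]) (auto intro: out[OF f] le[OF f] add_f scale_f)
qed

text \<open>
  The lifting property behind the whole proof. The hypothesis \<open>inf\<close> says that every \<open>\<psi>\<close> in \<open>E\<close> has
  a greatest minorant in \<open>A\<close>; for formulas this is the infimum over the variables that \<open>A\<close> lacks.

  The functional \<open>r1\<close> must extend \<open>q1\<close>, be positive and satisfy \<open>(1 - t) * r1 \<le> P\<close> on nonnegative
  functions. These three demands say that \<open>r1\<close> lies below the sublinear functional \<open>N g\<close>, the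
  infimum of \<open>P \<psi> / (1 - t) + q1 \<theta>\<close> over all \<open>\<psi> \<ge> 0\<close> in \<open>E\<close> and \<open>\<theta>\<close> in \<open>A\<close> with \<open>g \<le> \<psi> + \<theta>\<close>.
  That \<open>N\<close> does not fall below \<open>q1\<close> on \<open>A\<close> is where minorants are used: \<open>\<tau> - \<theta> \<le> \<psi>\<close> with the
  left-hand side in \<open>A\<close> gives \<open>\<tau> - \<theta> \<le> \<iota>\<close> for the greatest minorant \<open>\<iota>\<close> of \<open>\<psi>\<close>, and
  \<open>(1 - t) * q1 \<iota> \<le> P \<iota> \<le> P \<psi>\<close> because \<open>0 \<le> \<iota> \<le> \<psi>\<close>.
\<close>

lemma convex_decomposition_lifts:
  assumes E: "function_space E" and A: "function_space A" and sub: "A \<subseteq> E"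
    and P: "P \<in> states E" and q1: "q1 \<in> states A" and q2: "q2 \<in> states A"
    and t: "0 < t" "t < 1"
    and eq: "\<And>\<theta>. \<theta> \<in> A \<Longrightarrow> P \<theta> = (1 - t) * q1 \<theta> + t * q2 \<theta>"
    and inf: "\<And>\<psi>. \<psi> \<in> E \<Longrightarrow>
      \<exists>\<iota>\<in>A. (\<forall>x. \<iota> x \<le> \<psi> x) \<and> (\<forall>\<theta>\<in>A. (\<forall>x. \<theta> x \<le> \<psi> x) \<longrightarrow> (\<forall>x. \<theta> x \<le> \<iota> x))"
  obtains r1 r2 where "r1 \<in> states E" "r2 \<in> states E" "\<And>\<theta>. \<theta> \<in> A \<Longrightarrow> r1 \<theta> = q1 \<theta>"
    "\<And>\<theta>. \<theta> \<in> A \<Longrightarrow> r2 \<theta> = q2 \<theta>" "P = (\<lambda>g. (1 - t) * r1 g + t * r2 g)"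
proof -
  interpret E: state E P using E P by (simp add: state_def state_axioms_def)
  interpret A: state A q1 using A q1 by (simp add: state_def state_axioms_def)
  interpret q2: state A q2 using A q2 by (simp add: state_def state_axioms_def)
  define U where "U g = {P \<psi> / (1 - t) + q1 \<theta> | \<psi> \<theta>. \<psi> \<in> E \<and> \<theta> \<in> A \<and> (\<forall>x. 0 \<le> \<psi> x) \<and>
    (\<forall>x. g x \<le> \<psi> x + \<theta> x)}" for g
  define N where "N g = Inf (U g)" for g
  have U_I: "P \<psi> / (1 - t) + q1 \<theta> \<in> U g"
    if "\<psi> \<in> E" "\<theta> \<in> A" "\<And>x. 0 \<le> \<psi> x" "\<And>x. g x \<le> \<psi> x + \<theta> x" for g \<psi> \<theta>
    using that unfolding U_def by blast
  have key: "q1 \<tau> \<le> u" if "\<tau> \<in> A" "\<And>x. \<tau> x \<le> g x" and u: "u \<in> U g" for \<tau> g u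
  proof -
    obtain \<psi> \<theta> where u: "u = P \<psi> / (1 - t) + q1 \<theta>" and \<psi>: "\<psi> \<in> E" "\<theta> \<in> A" "\<And>x. 0 \<le> \<psi> x"
      and le: "\<And>x. g x \<le> \<psi> x + \<theta> x"
      using u unfolding U_def by blast
    obtain \<iota> where \<iota>: "\<iota> \<in> A" "\<And>x. \<iota> x \<le> \<psi> x"
      and great: "\<And>\<theta> x. \<theta> \<in> A \<Longrightarrow> (\<And>x. \<theta> x \<le> \<psi> x) \<Longrightarrow> \<theta> x \<le> \<iota> x"
      using inf[OF \<psi>(1)] by blast
    have \<iota>E: "\<iota> \<in> E" using \<iota>(1) sub by blast
    have "\<tau> x - \<theta> x \<le> \<psi> x" for x
      using that(2)[of x] le[of x] by simp
    then have "\<tau> x - \<theta> x \<le> \<iota> x" for x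
      using great[OF A.diff[OF that(1) \<psi>(2)]] by simp
    then have "q1 (\<lambda>x. \<tau> x - \<theta> x) \<le> q1 \<iota>"
      by (intro A.p_mono A.diff that(1) \<psi>(2) \<iota>(1))
    then have "q1 \<tau> - q1 \<theta> \<le> q1 \<iota>" using that(1) \<psi>(2) by (simp add: A.p_diff)
    also have "0 \<le> \<iota> x" for x using great[OF A.const, of 0] \<psi>(3) by simp
    then have "0 \<le> q2 \<iota>" using \<iota>(1) by (intro q2.p_nonneg)
    then have "(1 - t) * q1 \<iota> \<le> P \<iota>" using eq[OF \<iota>(1)] t by simp
    then have "q1 \<iota> \<le> P \<iota> / (1 - t)" using t by (simp add: field_simps)
    also have "P \<iota> / (1 - t) \<le> P \<psi> / (1 - t)"
      using E.p_mono[OF \<iota>E \<psi>(1) \<iota>(2)] t by (simp add: divide_right_mono)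
    finally show ?thesis using u by simp
  qed
  have ne: "U g \<noteq> {}" and bdd: "bdd_below (U g)" if g: "g \<in> E" for g
  proof -
    obtain B where B: "\<And>x. \<bar>g x\<bar> \<le> B" using E.bounded[OF g] by blast
    have "P (\<lambda>_. 0) / (1 - t) + q1 (\<lambda>_. B) \<in> U g"
      using B by (intro U_I E.const A.const) (auto intro: order_trans[OF abs_ge_self])
    then show "U g \<noteq> {}" by blast
    have "q1 (\<lambda>_. - B) \<le> u" if "u \<in> U g" for u
      using key[OF A.const _ that, of "- B"] B by (simp add: abs_le_iff minus_le_iff)
    then show "bdd_below (U g)" by (rule bdd_belowI)
  qed
  have N_le: "N g \<le> u" if "u \<in> U g" "g \<in> E" for u g
    unfolding N_def using that bdd by (intro cInf_lower)
  have N_ge: "c \<le> N g" if "\<And>u. u \<in> U g \<Longrightarrow> c \<le> u" "g \<in> E" for c g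
    unfolding N_def using that ne by (intro cInf_greatest)
  have U_scale: "s * u \<in> U (\<lambda>x. s * g x)" if s: "0 \<le> s" and "u \<in> U g" for s u g
  proof -
    obtain \<psi> \<theta> where u: "u = P \<psi> / (1 - t) + q1 \<theta>" and \<psi>: "\<psi> \<in> E" "\<theta> \<in> A" "\<And>x. 0 \<le> \<psi> x"
      and le: "\<And>x. g x \<le> \<psi> x + \<theta> x"
      using \<open>u \<in> U g\<close> unfolding U_def by blast
    have "P (\<lambda>x. s * \<psi> x) / (1 - t) + q1 (\<lambda>x. s * \<theta> x) \<in> U (\<lambda>x. s * g x)"
      using s \<psi> mult_left_mono[OF le s]
      by (intro U_I E.scale A.scale) (auto simp: algebra_simps)
    then show ?thesis using u \<psi> by (simp add: E.p_scale A.p_scale algebra_simps)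
  qed
  obtain f where f0: "\<And>g. g \<notin> E \<Longrightarrow> f g = 0" and f_le: "\<And>g. g \<in> E \<Longrightarrow> f g \<le> N g"
    and f_add: "\<And>g h. g \<in> E \<Longrightarrow> h \<in> E \<Longrightarrow> f (\<lambda>x. g x + h x) = f g + f h"
    and f_scale: "\<And>s g. g \<in> E \<Longrightarrow> f (\<lambda>x. s * g x) = s * f g"
  proof (rule E.linear_below_sublinear[of N])
    fix g h assume gh: "g \<in> E" "h \<in> E"
    have *: "N (\<lambda>x. g x + h x) \<le> u + v" if "u \<in> U g" "v \<in> U h" for u v
    proof -
      obtain \<psi> \<theta> where u: "u = P \<psi> / (1 - t) + q1 \<theta>" and \<psi>: "\<psi> \<in> E" "\<theta> \<in> A" "\<And>x. 0 \<le> \<psi> x"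
        and le: "\<And>x. g x \<le> \<psi> x + \<theta> x"
        using \<open>u \<in> U g\<close> unfolding U_def by blast
      obtain \<psi>' \<theta>' where v: "v = P \<psi>' / (1 - t) + q1 \<theta>'" and \<psi>': "\<psi>' \<in> E" "\<theta>' \<in> A" "\<And>x. 0 \<le> \<psi>' x"
        and le': "\<And>x. h x \<le> \<psi>' x + \<theta>' x"
        using \<open>v \<in> U h\<close> unfolding U_def by blast
      have "P (\<lambda>x. \<psi> x + \<psi>' x) / (1 - t) + q1 (\<lambda>x. \<theta> x + \<theta>' x) \<in> U (\<lambda>x. g x + h x)"
      proof (intro U_I E.add A.add \<psi> \<psi>')
        show "0 \<le> \<psi> x + \<psi>' x" for x using \<psi>(3)[of x] \<psi>'(3)[of x] by simp
        show "g x + h x \<le> \<psi> x + \<psi>' x + (\<theta> x + \<theta>' x)" for x using le[of x] le'[of x] by simp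
      qed
      then have "u + v \<in> U (\<lambda>x. g x + h x)"
        using u v \<psi> \<psi>' by (simp add: E.p_add A.p_add add_divide_distrib algebra_simps)
      then show ?thesis using gh by (intro N_le E.add)
    qed
    have "N (\<lambda>x. g x + h x) - v \<le> N g" if "v \<in> U h" for v
      using *[OF _ that] gh by (intro N_ge) (auto simp: algebra_simps)
    then have "N (\<lambda>x. g x + h x) - N g \<le> N h"
      using gh by (intro N_ge) (auto simp: algebra_simps)
    then show "N (\<lambda>x. g x + h x) \<le> N g + N h" by simp
  next
    fix s :: real and g assume s: "0 \<le> s" and g: "g \<in> E"
    have upper: "N (\<lambda>x. s * g x) \<le> s * N g" if s: "0 < s" and g: "g \<in> E" for s g
    proof -
      have "N (\<lambda>x. s * g x) / s \<le> N g"
      proof (rule N_ge[OF _ g])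
        fix u assume "u \<in> U g"
        then have "N (\<lambda>x. s * g x) \<le> s * u"
          using s g by (intro N_le U_scale E.scale) auto
        then show "N (\<lambda>x. s * g x) / s \<le> u" using s by (simp add: field_simps)
      qed
      then show ?thesis using s by (simp add: field_simps)
    qed
    show "N (\<lambda>x. s * g x) = s * N g"
    proof (cases "s = 0")
      case True
      have "P (\<lambda>_. 0) / (1 - t) + q1 (\<lambda>_. 0) \<in> U (\<lambda>_. 0)" by (intro U_I E.const A.const) auto
      then have "N (\<lambda>_. 0) \<le> 0" using N_le[OF _ E.const] by (fastforce simp: E.p_const A.p_const)
      moreover have "0 \<le> N (\<lambda>_. 0)"
        using key[OF A.const, of 0 "\<lambda>_. 0"] by (intro N_ge E.const) (auto simp: A.p_const)
      ultimately show ?thesis using True by simp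
    next
      case False
      with s have s: "0 < s" by simp
      have "N (\<lambda>x. inverse s * (s * g x)) \<le> inverse s * N (\<lambda>x. s * g x)"
        using s g by (intro upper E.scale) auto
      then have "s * N g \<le> N (\<lambda>x. s * g x)" using s by (simp add: field_simps)
      then show ?thesis using upper[OF s g] by simp
    qed
  qed blast
  have f_q1: "f \<theta> = q1 \<theta>" if \<theta>: "\<theta> \<in> A" for \<theta>
  proof -
    have le: "f \<theta> \<le> q1 \<theta>" if "\<theta> \<in> A" for \<theta>
    proof -
      have "P (\<lambda>_. 0) / (1 - t) + q1 \<theta> \<in> U \<theta>" using that by (intro U_I E.const) auto
      then have "N \<theta> \<le> q1 \<theta>" using N_le[of _ \<theta>] that sub by (fastforce simp: E.p_const)
      then show ?thesis using f_le[of \<theta>] that sub by force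
    qed
    have "f (\<lambda>x. - \<theta> x) = - f \<theta>" using f_scale[of \<theta> "-1"] \<theta> sub by auto
    then show ?thesis using le[OF \<theta>] le[OF A.uminus[OF \<theta>]] A.p_uminus[OF \<theta>] by simp
  qed
  have f_nonneg: "0 \<le> f g" and f_le_P: "(1 - t) * f g \<le> P g" if g: "g \<in> E" "\<And>x. 0 \<le> g x" for g
  proof -
    have "P (\<lambda>_. 0) / (1 - t) + q1 (\<lambda>_. 0) \<in> U (\<lambda>x. - g x)"
      using g by (intro U_I E.const A.const) auto
    then have "N (\<lambda>x. - g x) \<le> 0" using N_le[OF _ E.uminus[OF g(1)]] by (fastforce simp: E.p_const A.p_const)
    then have "f (\<lambda>x. - g x) \<le> 0" using f_le[OF E.uminus[OF g(1)]] by simp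
    then show "0 \<le> f g" using f_scale[of g "-1"] g by simp
    have "P g / (1 - t) + q1 (\<lambda>_. 0) \<in> U g" using g by (intro U_I A.const) auto
    then have "f g \<le> P g / (1 - t)" using N_le[OF _ g(1)] f_le[OF g(1)] by (fastforce simp: A.p_const)
    then show "(1 - t) * f g \<le> P g" using t by (simp add: field_simps)
  qed
  \<comment> \<open>the complementary summand, positive because \<open>(1 - t) * f \<le> P\<close> on nonnegative functions\<close>
  define r2 where "r2 g = (P g - (1 - t) * f g) / t" for g
  show ?thesis
  proof (rule that[of f r2])
    show "f \<in> states E"
      using f0 f_add f_scale f_nonneg f_q1[OF A.one] A.p_one by (intro statesI) auto
    show "r2 \<in> states E"
    proof (rule statesI)
      show "r2 g = 0" if "g \<notin> E" for g using that by (simp add: r2_def f0 E.p_outside)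
      show "r2 (\<lambda>x. g x + h x) = r2 g + r2 h" if "g \<in> E" "h \<in> E" for g h
        using that t by (simp add: r2_def f_add E.p_add field_simps)
      show "r2 (\<lambda>x. s * g x) = s * r2 g" if "g \<in> E" for s g
        using that t by (simp add: r2_def f_scale E.p_scale field_simps)
      show "0 \<le> r2 g" if "g \<in> E" "\<And>x. 0 \<le> g x" for g
        using f_le_P[OF that] t by (simp add: r2_def)
      show "r2 (\<lambda>_. 1) = 1"
        using f_q1[OF A.one] A.p_one E.p_one t by (simp add: r2_def)
    qed
    show "r2 \<theta> = q2 \<theta>" if "\<theta> \<in> A" for \<theta>
      using eq[OF that] f_q1[OF that] t by (simp add: r2_def)
    show "P = (\<lambda>g. (1 - t) * f g + t * r2 g)"
      using t by (simp add: r2_def fun_eq_iff)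
  qed (rule f_q1)
qed

section \<open>Completion of pseudometrics and extension of Lipschitz maps\<close>

text \<open>
  A point is represented by its distance function, as in the Kuratowski embedding: the completion
  consists of the uniform limits of functions \<open>D c\<close>, with the uniform distance. Points at distance
  \<open>0\<close> have equal distance functions, so the quotient of the pseudometric comes for free. The injection
  \<open>enc\<close> moves the completion to the carrier type that is wanted.
\<close>

lemma pseudometric_completion:
  fixes D :: "'c \<Rightarrow> 'c \<Rightarrow> real" and enc :: "('c \<Rightarrow> real) \<Rightarrow> 'u"
  assumes refl: "\<And>x. D x x = 0" and sym: "\<And>x y. D x y = D y x"
    and tri: "\<And>x y z. D x z \<le> D x y + D y z"
    and nonneg: "\<And>x y. 0 \<le> D x y" and le_one: "\<And>x y. D x y \<le> 1" and inj: "inj enc"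
  obtains Y dY j where "Metric_space Y dY" "Metric_space.mcomplete Y dY"
    "\<And>y z. y \<in> Y \<Longrightarrow> z \<in> Y \<Longrightarrow> dY y z \<le> (1 :: real)"
    "\<And>c. j c \<in> (Y :: 'u set)" "\<And>c c'. dY (j c) (j c') = D c c'"
    "\<And>y e. y \<in> Y \<Longrightarrow> 0 < e \<Longrightarrow> \<exists>c. dY (j c) y < e"
proof -
  define Y0 where "Y0 = {f. \<forall>e>0. \<exists>c. \<forall>x. \<bar>f x - D c x\<bar> \<le> e}"
  define d where "d f g = (if f \<in> Y0 \<and> g \<in> Y0 then SUP x. \<bar>f x - g x\<bar> else 0)" for f g :: "'c \<Rightarrow> real"
  have D_in: "D c \<in> Y0" for c unfolding Y0_def by (auto intro!: exI[of _ c])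
  have diff: "\<bar>f x - g x\<bar> \<le> 1" if "f \<in> Y0" "g \<in> Y0" for f g x
  proof (rule field_le_epsilon)
    fix e :: real assume "0 < e"
    then have "0 < e / 2" by simp
    then obtain a b where "\<forall>x. \<bar>f x - D a x\<bar> \<le> e / 2" "\<forall>x. \<bar>g x - D b x\<bar> \<le> e / 2"
      using \<open>f \<in> Y0\<close> \<open>g \<in> Y0\<close> unfolding Y0_def by blast
    then have "\<bar>f x - D a x\<bar> \<le> e / 2" "\<bar>g x - D b x\<bar> \<le> e / 2" by auto
    with nonneg[of a x] le_one[of a x] nonneg[of b x] le_one[of b x]
    show "\<bar>f x - g x\<bar> \<le> 1 + e" by linarith
  qed
  have d_ge: "\<bar>f x - g x\<bar> \<le> d f g" if "f \<in> Y0" "g \<in> Y0" for f g x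
    unfolding d_def using diff[OF that] that by (auto intro!: cSUP_upper bdd_aboveI2)
  have d_le: "d f g \<le> e" if "\<And>x. \<bar>f x - g x\<bar> \<le> e" for f g e
    unfolding d_def using that order_trans[OF abs_ge_zero that] by (auto intro!: cSUP_least)
  have d_D: "d (D c) f = f c" if "f \<in> Y0" for c f
  proof (rule antisym)
    have f: "\<bar>f x - D c x\<bar> \<le> f c" for x
    proof (rule field_le_epsilon)
      fix e :: real assume "0 < e"
      then have "0 < e / 2" by simp
      then obtain a where "\<forall>x. \<bar>f x - D a x\<bar> \<le> e / 2"
        using \<open>f \<in> Y0\<close> unfolding Y0_def by blast
      then have "\<bar>f x - D a x\<bar> \<le> e / 2" "\<bar>f c - D a c\<bar> \<le> e / 2" by auto
      with tri[of a x c] tri[of c x a] sym[of a c] show "\<bar>f x - D c x\<bar> \<le> f c + e" by linarith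
    qed
    then show "d (D c) f \<le> f c" by (intro d_le) (simp add: abs_minus_commute)
    show "f c \<le> d (D c) f" using d_ge[OF D_in that, of c c] refl[of c] by simp
  qed
  interpret Y0: Metric_space Y0 d
  proof
    show "0 \<le> d f g" for f g
      using d_ge[of f g] order_trans[OF abs_ge_zero] by (cases "f \<in> Y0 \<and> g \<in> Y0") (force simp: d_def)+
    show "d f g = d g f" for f g by (simp add: d_def abs_minus_commute)
    show "d f g = 0 \<longleftrightarrow> f = g" if "f \<in> Y0" "g \<in> Y0" for f g
    proof
      assume "d f g = 0"
      then have "\<bar>f x - g x\<bar> \<le> 0" for x using d_ge[OF that, of x] by simp
      then show "f = g" by auto
    qed (simp add: d_def)
    show "d f h \<le> d f g + d g h" if "f \<in> Y0" "g \<in> Y0" "h \<in> Y0" for f g h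
    proof (rule d_le)
      show "\<bar>f x - h x\<bar> \<le> d f g + d g h" for x
        using d_ge[OF that(1,2), of x] d_ge[OF that(2,3), of x] by linarith
    qed
  qed
  define Y where "Y = enc ` Y0"
  define dY where "dY u v = d (inv enc u) (inv enc v)" for u v
  have dY_enc: "dY (enc f) (enc g) = d f g" for f g
    using inj by (simp add: dY_def)
  interpret Y: Metric_space Y dY
  proof
    show "0 \<le> dY u v" for u v by (simp add: dY_def)
    show "dY u v = dY v u" for u v by (simp add: dY_def Y0.commute)
    show "dY u v = 0 \<longleftrightarrow> u = v" if "u \<in> Y" "v \<in> Y" for u v
      using that inj by (auto simp: Y_def dY_enc)
    show "dY u w \<le> dY u v + dY v w" if "u \<in> Y" "v \<in> Y" "w \<in> Y" for u v w
      using that Y0.triangle by (auto simp: Y_def dY_enc)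
  qed
  have complete: "Y.mcomplete"
    unfolding Y.mcomplete_def
  proof (intro allI impI)
    fix \<sigma> assume \<sigma>: "Y.MCauchy \<sigma>"
    then have "\<sigma> n \<in> Y" for n by (auto simp: Y.MCauchy_def)
    then have "\<exists>f. f \<in> Y0 \<and> \<sigma> n = enc f" for n by (auto simp: Y_def)
    then obtain f where f: "\<And>n. f n \<in> Y0" and \<sigma>_eq: "\<And>n. \<sigma> n = enc (f n)" by metis
    have unif: "\<exists>N. \<forall>n\<ge>N. \<forall>m\<ge>N. \<forall>x. \<bar>f n x - f m x\<bar> < e" if e: "0 < e" for e
    proof -
      obtain N where "\<And>n m. N \<le> n \<Longrightarrow> N \<le> m \<Longrightarrow> d (f n) (f m) < e"
        using \<sigma> e unfolding Y.MCauchy_def \<sigma>_eq dY_enc by meson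
      then show ?thesis using d_ge[OF f f] by (meson le_less_trans)
    qed
    have "Cauchy (\<lambda>n. f n x)" for x
      using unif unfolding Cauchy_def dist_real_def by blast
    then have "\<exists>l. (\<lambda>n. f n x) \<longlonglongrightarrow> l" for x
      by (simp add: Cauchy_convergent_iff convergent_def)
    then obtain g where g: "\<And>x. (\<lambda>n. f n x) \<longlonglongrightarrow> g x" by metis
    have lim: "\<exists>N. \<forall>n\<ge>N. \<forall>x. \<bar>f n x - g x\<bar> \<le> e" if e: "0 < e" for e
    proof -
      obtain N where N: "\<And>n m x. N \<le> n \<Longrightarrow> N \<le> m \<Longrightarrow> \<bar>f n x - f m x\<bar> < e"
        using unif[OF e] by blast
      have "\<bar>f n x - g x\<bar> \<le> e" if "N \<le> n" for n x
      proof (rule LIMSEQ_le_const2)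
        show "(\<lambda>m. \<bar>f n x - f m x\<bar>) \<longlonglongrightarrow> \<bar>f n x - g x\<bar>"
          by (intro tendsto_intros g)
        show "\<exists>M. \<forall>m\<ge>M. \<bar>f n x - f m x\<bar> \<le> e"
          using N[OF that] less_imp_le by blast
      qed
      then show ?thesis by blast
    qed
    have g_in: "g \<in> Y0"
      unfolding Y0_def
    proof (intro CollectI allI impI)
      fix e :: real assume "0 < e"
      then have e: "0 < e / 2" by simp
      obtain n where n: "\<And>x. \<bar>f n x - g x\<bar> \<le> e / 2" using lim[OF e] by blast
      obtain c where c: "\<And>x. \<bar>f n x - D c x\<bar> \<le> e / 2" using f[of n] e unfolding Y0_def by blast
      have "\<bar>g x - D c x\<bar> \<le> e" for x using n[of x] c[of x] by linarith
      then show "\<exists>c. \<forall>x. \<bar>g x - D c x\<bar> \<le> e" by blast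
    qed
    have "\<forall>\<^sub>F n in sequentially. dY (\<sigma> n) (enc g) < e" if e: "0 < e" for e
    proof -
      obtain N where "\<And>n x. N \<le> n \<Longrightarrow> \<bar>f n x - g x\<bar> \<le> e / 2" using lim[OF half_gt_zero[OF e]] by blast
      then have "d (f n) g \<le> e / 2" if "N \<le> n" for n using that by (intro d_le)
      then have "\<forall>n\<ge>N. dY (\<sigma> n) (enc g) < e"
        using e by (force simp: \<sigma>_eq dY_enc)
      then show ?thesis by (auto simp: eventually_sequentially)
    qed
    moreover have "enc g \<in> Y" "\<sigma> n \<in> Y" for n using g_in f by (auto simp: Y_def \<sigma>_eq)
    ultimately have "limitin Y.mtopology \<sigma> (enc g) sequentially"
      unfolding Y.limitin_metric by simp
    then show "\<exists>l. limitin Y.mtopology \<sigma> l sequentially" ..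
  qed
  show ?thesis
  proof (rule that[of Y dY "\<lambda>c. enc (D c)"])
    show "Metric_space Y dY" ..
    show "dY y z \<le> 1" if "y \<in> Y" "z \<in> Y" for y z
      using that diff by (auto simp: Y_def dY_enc intro!: d_le)
    show "dY (enc (D c)) (enc (D c')) = D c c'" for c c'
      using d_D[OF D_in, of c c'] sym by (simp add: dY_enc)
    show "\<exists>c. dY (enc (D c)) y < e" if y: "y \<in> Y" and e: "0 < e" for y e
    proof -
      obtain f where f: "f \<in> Y0" "y = enc f" using y by (auto simp: Y_def)
      have "0 < e / 2" using e by simp
      then obtain c where "\<forall>x. \<bar>f x - D c x\<bar> \<le> e / 2" using f(1) unfolding Y0_def by blast
      then have "d (D c) f \<le> e / 2" by (intro d_le) (simp add: abs_minus_commute)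
      then have "dY (enc (D c)) y < e" using e f(2) by (simp add: dY_enc)
      then show ?thesis ..
    qed
  qed (use D_in complete in \<open>auto simp: Y_def\<close>)
qed

text \<open>
  Interprets the function and relation symbols on a completion. The map \<open>H\<close> is the limit of \<open>G\<close>
  along tuples of dense points; the Lipschitz bound makes the values of \<open>G\<close> Cauchy, makes the limit
  independent of the choices, and passes to the limit.
\<close>

lemma lipschitz_extends_from_dense:
  fixes j :: "'c \<Rightarrow> 'y" and G :: "'c list \<Rightarrow> 'z"
  assumes Y: "Metric_space Y dY" and j: "\<And>c. j c \<in> Y"
    and dense: "\<And>y e. y \<in> Y \<Longrightarrow> 0 < e \<Longrightarrow> \<exists>c. dY (j c) y < e"
    and Z: "Metric_space Z dZ" and compl: "Metric_space.mcomplete Z dZ"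
    and G: "\<And>cs. length cs = n \<Longrightarrow> G cs \<in> Z"
    and lip: "\<And>cs ds. length cs = n \<Longrightarrow> length ds = n \<Longrightarrow>
      dZ (G cs) (G ds) \<le> K * tuple_dist dY (map j cs) (map j ds)"
    and K: "0 \<le> (K :: real)"
  obtains H where "\<And>ys. ys \<in> tuples Y n \<Longrightarrow> H ys \<in> Z"
    "\<And>cs. length cs = n \<Longrightarrow> H (map j cs) = G cs"
    "\<And>ys zs. ys \<in> tuples Y n \<Longrightarrow> zs \<in> tuples Y n \<Longrightarrow> dZ (H ys) (H zs) \<le> K * tuple_dist dY ys zs"
proof -
  interpret Y: Metric_space Y dY by (rule Y)
  interpret Z: Metric_space Z dZ by (rule Z)
  have td_tri: "tuple_dist dY xs zs \<le> tuple_dist dY xs ys + tuple_dist dY ys zs"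
    if "xs \<in> tuples Y n" "ys \<in> tuples Y n" "zs \<in> tuples Y n" for xs ys zs
  proof -
    have "dY (xs ! i) (zs ! i) \<le> dY (xs ! i) (ys ! i) + dY (ys ! i) (zs ! i)" if "i < n" for i
      using that \<open>xs \<in> _\<close> \<open>ys \<in> _\<close> \<open>zs \<in> _\<close> by (intro Y.triangle) (auto simp: tuples_def)
    then have "tuple_dist dY xs zs \<le> (\<Sum>i<n. (1/2)^i * (dY (xs ! i) (ys ! i) + dY (ys ! i) (zs ! i)))"
      using that by (auto simp: tuple_dist_def tuples_def intro!: sum_mono)
    also have "\<dots> = tuple_dist dY xs ys + tuple_dist dY ys zs"
      using that by (simp add: tuple_dist_def tuples_def sum.distrib algebra_simps)
    finally show ?thesis .
  qed
  have td_sym: "tuple_dist dY xs ys = tuple_dist dY ys xs"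
    if "xs \<in> tuples Y n" "ys \<in> tuples Y n" for xs ys
    using that by (simp add: tuple_dist_def tuples_def Y.commute)
  have "\<exists>c. dY (j c) y < (1/2)^k" if "y \<in> Y" for y k
    using dense[OF that, of "(1/2)^k"] by simp
  then obtain s where s: "\<And>y k. y \<in> Y \<Longrightarrow> dY (j (s y k)) y < (1/2)^k" by metis
  define approx where "approx ys k = map (\<lambda>y. s y k) ys" for ys and k :: nat
  have jt: "map j cs \<in> tuples Y n" if "length cs = n" for cs
    using that j by (auto simp: tuples_def)
  have len: "length (approx ys k) = n" if "ys \<in> tuples Y n" for ys k
    using that by (simp add: approx_def tuples_def)
  have to_zero: "(\<lambda>k. tuple_dist dY (map j (approx ys k)) ys) \<longlonglongrightarrow> 0" if ys: "ys \<in> tuples Y n" for ys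
  proof -
    have "(\<lambda>k. dY (j (s (ys ! i) k)) (ys ! i)) \<longlonglongrightarrow> 0" if "i < n" for i
    proof (rule tendsto_sandwich[where f="\<lambda>_. 0" and h="\<lambda>k. (1/2)^k"])
      have "ys ! i \<in> Y" using that ys by (auto simp: tuples_def)
      then show "\<forall>\<^sub>F k in sequentially. dY (j (s (ys ! i) k)) (ys ! i) \<le> (1/2)^k"
        using s less_imp_le by (intro always_eventually) blast
      show "(\<lambda>k. (1/2)^k :: real) \<longlonglongrightarrow> 0" by (rule LIMSEQ_realpow_zero) auto
    qed auto
    then have "(\<lambda>k. \<Sum>i<n. (1/2)^i * dY (j (s (ys ! i) k)) (ys ! i)) \<longlonglongrightarrow> (\<Sum>i<n. (1/2)^i * 0)"
      by (intro tendsto_intros) auto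
    then show ?thesis using ys by (simp add: tuple_dist_def approx_def tuples_def)
  qed
  have step: "dZ (G cs) (G ds) \<le> K * (tuple_dist dY (map j cs) ys + tuple_dist dY ys zs
      + tuple_dist dY (map j ds) zs)"
    if "length cs = n" "length ds = n" "ys \<in> tuples Y n" "zs \<in> tuples Y n" for cs ds ys zs
  proof -
    have "tuple_dist dY (map j cs) (map j ds) \<le>
      tuple_dist dY (map j cs) ys + tuple_dist dY ys zs + tuple_dist dY (map j ds) zs"
      using td_tri[OF jt[OF that(1)] that(3) jt[OF that(2)]] td_tri[OF that(3,4) jt[OF that(2)]]
        td_sym[OF jt[OF that(2)] that(4)] by simp
    then show ?thesis using lip[OF that(1,2)] mult_left_mono[OF _ K] order_trans by blast
  qed
  have "\<exists>z. z \<in> Z \<and> (\<lambda>k. dZ (G (approx ys k)) z) \<longlonglongrightarrow> 0" if ys: "ys \<in> tuples Y n" for ys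
  proof -
    have td0: "tuple_dist dY ys ys = 0" using ys by (auto simp: tuple_dist_def tuples_def subset_iff)
    have "Z.MCauchy (\<lambda>k. G (approx ys k))"
      unfolding Z.MCauchy_def
    proof (intro conjI allI impI)
      show "range (\<lambda>k. G (approx ys k)) \<subseteq> Z" using G len[OF ys] by auto
      fix e :: real assume "0 < e"
      then have "0 < e / (2 * (K + 1))" using K by simp
      then obtain N where N: "\<And>k. N \<le> k \<Longrightarrow> tuple_dist dY (map j (approx ys k)) ys < e / (2 * (K + 1))"
        using order_tendstoD(2)[OF to_zero[OF ys]] by (auto simp: eventually_sequentially)
      have "dZ (G (approx ys k)) (G (approx ys l)) < e" if "N \<le> k" "N \<le> l" for k l
      proof -
        have "dZ (G (approx ys k)) (G (approx ys l)) \<le>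
          K * (tuple_dist dY (map j (approx ys k)) ys + tuple_dist dY (map j (approx ys l)) ys)"
          using step[OF len len ys ys, OF ys ys] td0 by simp
        also have "\<dots> \<le> K * (e / (2 * (K + 1)) + e / (2 * (K + 1)))"
          using N[OF that(1)] N[OF that(2)] K by (intro mult_left_mono) auto
        also have "\<dots> = e * (K / (K + 1))" using K by (simp add: divide_simps)
        also have "\<dots> < e * 1" using K \<open>0 < e\<close> by (intro mult_strict_left_mono) auto
        finally show ?thesis by simp
      qed
      then show "\<exists>N. \<forall>k l. N \<le> k \<longrightarrow> N \<le> l \<longrightarrow> dZ (G (approx ys k)) (G (approx ys l)) < e" by blast
    qed
    then show ?thesis using compl unfolding Z.mcomplete_def Z.limitin_metric_dist_null by blast
  qed
  then obtain H where HZ: "\<And>ys. ys \<in> tuples Y n \<Longrightarrow> H ys \<in> Z"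
    and H: "\<And>ys. ys \<in> tuples Y n \<Longrightarrow> (\<lambda>k. dZ (G (approx ys k)) (H ys)) \<longlonglongrightarrow> 0" by metis
  show ?thesis
  proof (rule that[of H])
    show "H (map j cs) = G cs" if cs: "length cs = n" for cs
    proof -
      note t = jt[OF cs]
      let ?a = "\<lambda>k. approx (map j cs) k"
      have "dZ (H (map j cs)) (G cs) \<le> 0"
      proof (rule LIMSEQ_le_const)
        show "(\<lambda>k. dZ (G (?a k)) (H (map j cs)) + K * tuple_dist dY (map j (?a k)) (map j cs)) \<longlonglongrightarrow> 0"
          using tendsto_add[OF H[OF t] tendsto_mult[OF tendsto_const[of K] to_zero[OF t]]] by simp
        have "dZ (H (map j cs)) (G cs) \<le>
            dZ (G (?a k)) (H (map j cs)) + K * tuple_dist dY (map j (?a k)) (map j cs)" for k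
          using Z.triangle[OF HZ[OF t] G[OF len[OF t]] G[OF cs], of k] lip[OF len[OF t] cs, of k]
          by (simp add: Z.commute)
        then show "\<exists>N. \<forall>k\<ge>N. dZ (H (map j cs)) (G cs) \<le>
            dZ (G (?a k)) (H (map j cs)) + K * tuple_dist dY (map j (?a k)) (map j cs)" by blast
      qed
      then show ?thesis using Z.zero[OF HZ[OF t] G[OF cs]] Z.nonneg by (meson antisym)
    qed
    show "dZ (H ys) (H zs) \<le> K * tuple_dist dY ys zs"
      if ys: "ys \<in> tuples Y n" and zs: "zs \<in> tuples Y n" for ys zs
    proof (rule LIMSEQ_le_const)
      let ?a = "approx ys" and ?b = "approx zs"
      have "(\<lambda>k. dZ (G (?a k)) (H ys) + K * (tuple_dist dY (map j (?a k)) ys + tuple_dist dY ys zs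
          + tuple_dist dY (map j (?b k)) zs) + dZ (G (?b k)) (H zs))
          \<longlonglongrightarrow> 0 + K * (0 + tuple_dist dY ys zs + 0) + 0"
        by (intro tendsto_intros H to_zero ys zs)
      then show "(\<lambda>k. dZ (G (?a k)) (H ys) + K * (tuple_dist dY (map j (?a k)) ys + tuple_dist dY ys zs
          + tuple_dist dY (map j (?b k)) zs) + dZ (G (?b k)) (H zs)) \<longlonglongrightarrow> K * tuple_dist dY ys zs"
        by simp
      have "dZ (H ys) (H zs) \<le> dZ (G (?a k)) (H ys) + K * (tuple_dist dY (map j (?a k)) ys
          + tuple_dist dY ys zs + tuple_dist dY (map j (?b k)) zs) + dZ (G (?b k)) (H zs)" for k
        using Z.triangle[OF HZ[OF ys] G[OF len[OF ys]] HZ[OF zs], of k]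
          Z.triangle[OF G[OF len[OF ys]] G[OF len[OF zs]] HZ[OF zs], of k k]
          step[OF len[OF ys] len[OF zs] ys zs, of k k]
        by (simp add: Z.commute)
      then show "\<exists>N. \<forall>k\<ge>N. dZ (H ys) (H zs) \<le> dZ (G (?a k)) (H ys) + K * (tuple_dist dY (map j (?a k)) ys
          + tuple_dist dY ys zs + tuple_dist dY (map j (?b k)) zs) + dZ (G (?b k)) (H zs)" by blast
    qed
  qed (rule HZ)
qed

section \<open>Witnesses and their encoding as strings\<close>

text \<open>
  \<open>Ext k\<close> are the points that will have mutual distance \<open>1\<close>. \<open>Wit \<phi> x cs\<close> is to attain the infimum
  of \<open>\<phi>\<close> over the variable \<open>x\<close> when the other variables \<open>i < length cs\<close> have the values \<open>cs ! i\<close>;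
  since the \<open>cs\<close> may be witnesses themselves, no iteration of the construction is necessary.
\<close>

datatype ('c, 'f, 'r, 'k) wit = Ext 'k | Wit "('c, 'f, 'r) fm" nat "('c, 'f, 'r, 'k) wit list"

text \<open>
  This holds at every \<open>t\<close> exactly when the code is injective and no code word is a proper prefix of
  another. Unlike injectivity alone, it passes from the parts of a term to the term by structural induction.
\<close>

definition uniquely_decodable_at :: "('b \<Rightarrow> 'a list) \<Rightarrow> 'b \<Rightarrow> bool" where
  "uniquely_decodable_at e t \<longleftrightarrow> (\<forall>s xs ys. e t @ xs = e s @ ys \<longrightarrow> t = s \<and> xs = ys)"

lemma uniquely_decodable_atD:
  "uniquely_decodable_at e t \<Longrightarrow> e t @ xs = e s @ ys \<Longrightarrow> t = s \<and> xs = ys"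
  unfolding uniquely_decodable_at_def by blast

lemma uniquely_decodable_list:
  assumes "\<And>t. t \<in> set ts \<Longrightarrow> uniquely_decodable_at e t" "length ts = length ss"
    "concat (map e ts) @ xs = concat (map e ss) @ ys"
  shows "ts = ss \<and> xs = ys"
  using assms
proof (induction ts arbitrary: ss)
  case (Cons t ts)
  then obtain s ss' where ss: "ss = s # ss'" by (cases ss) auto
  have "e t @ concat (map e ts) @ xs = e s @ concat (map e ss') @ ys"
    using Cons.prems(3) ss by simp
  then have "t = s \<and> concat (map e ts) @ xs = concat (map e ss') @ ys"
    using Cons.prems(1)[of t] uniquely_decodable_atD by fastforce
  then show ?case using Cons.IH[of ss'] Cons.prems ss by simp
qed simp

text \<open>
  Symbols and numbers are letters. The number of arguments is part of the code, so that a list of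
  codes can be taken apart.
\<close>

primrec enc_tm :: "('c, 'f) tm \<Rightarrow> ('c + 'f + 'r + 'k + real) list" where
  "enc_tm (Var n) = [Inr (Inr (Inr (Inr (real n))))]"
| "enc_tm (Cst c) = [Inl c]"
| "enc_tm (App F ts) = Inr (Inl F) # Inr (Inr (Inr (Inr (real (length ts))))) # concat (map enc_tm ts)"

lemma enc_tm_decodable: "uniquely_decodable_at enc_tm t"
proof (induction t)
  case (Var x)
  show ?case unfolding uniquely_decodable_at_def
  proof (intro allI impI)
    fix s xs ys assume "enc_tm (Var x) @ xs = enc_tm s @ ys"
    then show "Var x = s \<and> xs = ys" by (cases s) auto
  qed
next
  case (Cst x)
  show ?case unfolding uniquely_decodable_at_def
  proof (intro allI impI)
    fix s xs ys assume "enc_tm (Cst x) @ xs = enc_tm s @ ys"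
    then show "Cst x = s \<and> xs = ys" by (cases s) auto
  qed
next
  case (App F ts)
  show ?case unfolding uniquely_decodable_at_def
  proof (intro allI impI)
    fix s xs and ys :: "('a + 'b + 'c + 'd + real) list" assume "enc_tm (App F ts) @ xs = enc_tm s @ ys"
    then obtain ss where s: "s = App F ss" "length ts = length ss"
      and eq: "concat (map enc_tm ts) @ xs = concat (map enc_tm ss) @ ys" by (cases s) auto
    have "ts = ss \<and> xs = ys"
      by (rule uniquely_decodable_list[OF App s(2) eq])
    with s show "App F ts = s \<and> xs = ys" by simp
  qed
qed

abbreviation num :: "real \<Rightarrow> 'c + 'f + 'r + 'k + real" where
  "num x \<equiv> Inr (Inr (Inr (Inr x)))"

primrec enc_fm :: "('c, 'f, 'r) fm \<Rightarrow> ('c + 'f + 'r + 'k + real) list" where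
  "enc_fm (Const r) = [num 0, num r]"
| "enc_fm (Dist s t) = num 1 # enc_tm s @ enc_tm t"
| "enc_fm (Rel R ts) = num 2 # Inr (Inr (Inl R)) # num (real (length ts)) # concat (map enc_tm ts)"
| "enc_fm (Scale r \<phi>) = num 3 # num r # enc_fm \<phi>"
| "enc_fm (Add \<phi> \<psi>) = num 4 # enc_fm \<phi> @ enc_fm \<psi>"
| "enc_fm (SupF x \<phi>) = num 5 # num (real x) # enc_fm \<phi>"
| "enc_fm (InfF x \<phi>) = num 6 # num (real x) # enc_fm \<phi>"

lemma enc_fm_decodable: "uniquely_decodable_at enc_fm \<phi>"
  unfolding uniquely_decodable_at_def
proof (induction \<phi>)
  case (Const r)
  show ?case
  proof (intro allI impI)
    fix s :: "('a, 'b, 'c) fm" and xs ys :: "('a + 'b + 'c + 'd + real) list"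
    assume "enc_fm (Const r) @ xs = enc_fm s @ ys"
    then show "Const r = s \<and> xs = ys" by (cases s) auto
  qed
next
  case (Dist u v)
  show ?case
  proof (intro allI impI)
    fix s :: "('a, 'b, 'c) fm" and xs ys :: "('a + 'b + 'c + 'd + real) list"
    assume *: "enc_fm (Dist u v) @ xs = enc_fm s @ ys"
    then obtain u' v' where s: "s = Dist u' v'" by (cases s) auto
    with * have "enc_tm u @ enc_tm v @ xs = enc_tm u' @ enc_tm v' @ ys" by simp
    then have "u = u'" "enc_tm v @ xs = enc_tm v' @ ys"
      using uniquely_decodable_atD[OF enc_tm_decodable] by blast+
    with s show "Dist u v = s \<and> xs = ys"
      using uniquely_decodable_atD[OF enc_tm_decodable] by blast
  qed
next
  case (Rel R ts)
  show ?case
  proof (intro allI impI)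
    fix s :: "('a, 'b, 'c) fm" and xs ys :: "('a + 'b + 'c + 'd + real) list"
    assume *: "enc_fm (Rel R ts) @ xs = enc_fm s @ ys"
    then obtain ss where s: "s = Rel R ss" "length ts = length ss"
      and eq: "concat (map enc_tm ts) @ xs = concat (map enc_tm ss) @ ys" by (cases s) auto
    have "ts = ss \<and> xs = ys"
      by (rule uniquely_decodable_list[OF _ s(2) eq]) (rule enc_tm_decodable)
    with s show "Rel R ts = s \<and> xs = ys" by simp
  qed
next
  case (Scale r \<phi>)
  show ?case
  proof (intro allI impI)
    fix s :: "('a, 'b, 'c) fm" and xs ys :: "('a + 'b + 'c + 'd + real) list"
    assume "enc_fm (Scale r \<phi>) @ xs = enc_fm s @ ys"
    then show "Scale r \<phi> = s \<and> xs = ys" using Scale by (cases s) auto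
  qed
next
  case (Add \<phi> \<psi>)
  show ?case
  proof (intro allI impI)
    fix s :: "('a, 'b, 'c) fm" and xs ys :: "('a + 'b + 'c + 'd + real) list"
    assume *: "enc_fm (Add \<phi> \<psi>) @ xs = enc_fm s @ ys"
    then obtain \<phi>' \<psi>' where s: "s = Add \<phi>' \<psi>'" by (cases s) auto
    with * have "enc_fm \<phi> @ enc_fm \<psi> @ xs = enc_fm \<phi>' @ enc_fm \<psi>' @ ys" by simp
    then have "\<phi> = \<phi>' \<and> enc_fm \<psi> @ xs = enc_fm \<psi>' @ ys"
      using Add.IH(1) by blast
    with s show "Add \<phi> \<psi> = s \<and> xs = ys" using Add.IH(2) by blast
  qed
next
  case (SupF x \<phi>)
  show ?case
  proof (intro allI impI)
    fix s :: "('a, 'b, 'c) fm" and xs ys :: "('a + 'b + 'c + 'd + real) list"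
    assume "enc_fm (SupF x \<phi>) @ xs = enc_fm s @ ys"
    then show "SupF x \<phi> = s \<and> xs = ys" using SupF by (cases s) auto
  qed
next
  case (InfF x \<phi>)
  show ?case
  proof (intro allI impI)
    fix s :: "('a, 'b, 'c) fm" and xs ys :: "('a + 'b + 'c + 'd + real) list"
    assume "enc_fm (InfF x \<phi>) @ xs = enc_fm s @ ys"
    then show "InfF x \<phi> = s \<and> xs = ys" using InfF by (cases s) auto
  qed
qed

primrec enc_wit :: "('c, 'f, 'r, 'k) wit \<Rightarrow> ('c + 'f + 'r + 'k + real) list" where
  "enc_wit (Ext k) = [Inr (Inr (Inr (Inl k)))]"
| "enc_wit (Wit \<phi> x cs) =
    num (real x) # num (real (length cs)) # enc_fm \<phi> @ concat (map enc_wit cs)"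

lemma enc_wit_decodable: "uniquely_decodable_at enc_wit c"
proof (induction c)
  case (Ext k)
  show ?case unfolding uniquely_decodable_at_def
  proof (intro allI impI)
    fix s :: "('a, 'b, 'c, 'd) wit" and xs ys
    assume "enc_wit (Ext k) @ xs = enc_wit s @ ys"
    then show "Ext k = s \<and> xs = ys" by (cases s) auto
  qed
next
  case (Wit \<phi> x cs)
  show ?case unfolding uniquely_decodable_at_def
  proof (intro allI impI)
    fix s :: "('a, 'b, 'c, 'd) wit" and xs ys
    assume "enc_wit (Wit \<phi> x cs) @ xs = enc_wit s @ ys"
    then obtain \<phi>' ds where s: "s = Wit \<phi>' x ds" "length cs = length ds"
      and eq: "enc_fm \<phi> @ concat (map enc_wit cs) @ xs = enc_fm \<phi>' @ concat (map enc_wit ds) @ ys"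
      by (cases s) auto
    from eq have "\<phi> = \<phi>'" "concat (map enc_wit cs) @ xs = concat (map enc_wit ds) @ ys"
      using uniquely_decodable_atD[OF enc_fm_decodable] by blast+
    with s show "Wit \<phi> x cs = s \<and> xs = ys"
      using uniquely_decodable_list[OF Wit s(2)] by blast
  qed
qed

text \<open>
  A real function on the witnesses is coded by its graph, a set of strings.
\<close>

lemma ex_inj_wit_functions_univ:
  "\<exists>enc :: (('c, 'f, 'r, 'k) wit \<Rightarrow> real) \<Rightarrow> ('c, 'f, 'r, 'k) univ. inj enc"
proof
  let ?enc = "\<lambda>f :: ('c, 'f, 'r, 'k) wit \<Rightarrow> real. range (\<lambda>c. num (f c) # enc_wit c) :: ('c, 'f, 'r, 'k) univ"
  show "inj ?enc"
  proof (rule injI, rule ext)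
    fix f g c assume "?enc f = ?enc g"
    then have "num (f c) # enc_wit c \<in> ?enc g" by blast
    then obtain d where "num (f c) # enc_wit c = num (g d) # (enc_wit d :: ('c + 'f + 'r + 'k + real) list)"
      by blast
    then have "f c = g d" "enc_wit c @ [] = enc_wit d @ ([] :: ('c + 'f + 'r + 'k + real) list)" by simp_all
    moreover have "c = d" using uniquely_decodable_atD[OF enc_wit_decodable calculation(2)] by blast
    ultimately show "f c = g c" by simp
  qed
qed

section \<open>Renaming, bounds and moduli of formulas\<close>

lemma finite_fv_tm: "finite (fv_tm t)"
  by (induction t) auto

lemma finite_fv: "finite (fv \<phi>)"
  by (induction \<phi>) (auto simp: finite_fv_tm)

lemma tm_val_cong: "(\<And>x. x \<in> fv_tm t \<Longrightarrow> v x = w x) \<Longrightarrow> tm_val M v t = tm_val M w t"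
proof (induction t)
  case (App F ts)
  have "map (tm_val M v) ts = map (tm_val M w) ts"
    using App.prems by (intro map_cong[OF refl] App.IH) auto
  then show ?case by (simp only: tm_val.simps)
qed auto

lemma map_tm_val_cong:
  "(\<And>x t. t \<in> set ts \<Longrightarrow> x \<in> fv_tm t \<Longrightarrow> v x = w x) \<Longrightarrow> map (tm_val M v) ts = map (tm_val M w) ts"
  by (auto intro: tm_val_cong)

lemma fm_val_cong: "(\<And>x. x \<in> fv \<phi> \<Longrightarrow> v x = w x) \<Longrightarrow> fm_val M \<phi> v = fm_val M \<phi> w"
proof (induction \<phi> arbitrary: v w)
  case (Dist s t)
  then show ?case using tm_val_cong[of s v w M] tm_val_cong[of t v w M] by simp
next
  case (Rel R ts)
  then have "map (tm_val M v) ts = map (tm_val M w) ts" by (intro map_tm_val_cong) auto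
  then show ?case by (simp only: fm_val.simps)
next
  case (Add \<phi> \<psi>)
  have "fm_val M \<phi> v = fm_val M \<phi> w" "fm_val M \<psi> v = fm_val M \<psi> w"
    using Add.prems by (auto intro!: Add.IH)
  then show ?case by simp
next
  case (Scale r \<phi>)
  have "fm_val M \<phi> v = fm_val M \<phi> w" using Scale.prems by (auto intro!: Scale.IH)
  then show ?case by simp
next
  case (SupF x \<phi>)
  have "fm_val M \<phi> (v(x := a)) = fm_val M \<phi> (w(x := a))" for a
    using SupF.prems by (intro SupF.IH) auto
  then show ?case by simp
next
  case (InfF x \<phi>)
  have "fm_val M \<phi> (v(x := a)) = fm_val M \<phi> (w(x := a))" for a
    using InfF.prems by (intro InfF.IH) auto
  then show ?case by simp
qed simp

primrec ren_tm :: "(nat \<Rightarrow> nat) \<Rightarrow> ('c, 'f) tm \<Rightarrow> ('c, 'f) tm" where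
  "ren_tm f (Var x) = Var (f x)"
| "ren_tm f (Cst c) = Cst c"
| "ren_tm f (App F ts) = App F (map (ren_tm f) ts)"

definition fresh_for :: "nat set \<Rightarrow> nat" where
  "fresh_for X = (SOME z. z \<notin> X)"

lemma fresh_for: "finite X \<Longrightarrow> fresh_for X \<notin> X"
  unfolding fresh_for_def by (metis ex_new_if_finite infinite_UNIV_nat someI_ex)

text \<open>
  Substitution of variables for variables. The map \<open>f\<close> need not be injective, so bound variables
  are renamed to fresh ones; identifying variables is needed in \<open>identify_variables\<close>.
\<close>

primrec ren :: "('c, 'f, 'r) fm \<Rightarrow> (nat \<Rightarrow> nat) \<Rightarrow> ('c, 'f, 'r) fm" where
  "ren (Const r) f = Const r"
| "ren (Dist s t) f = Dist (ren_tm f s) (ren_tm f t)"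
| "ren (Rel R ts) f = Rel R (map (ren_tm f) ts)"
| "ren (Scale r \<phi>) f = Scale r (ren \<phi> f)"
| "ren (Add \<phi> \<psi>) f = Add (ren \<phi> f) (ren \<psi> f)"
| "ren (SupF x \<phi>) f =
    (let z = fresh_for (f ` (fv \<phi> - {x})) in SupF z (ren \<phi> (f(x := z))))"
| "ren (InfF x \<phi>) f =
    (let z = fresh_for (f ` (fv \<phi> - {x})) in InfF z (ren \<phi> (f(x := z))))"

lemma wf_ren_tm: "wf_tm L t \<Longrightarrow> wf_tm L (ren_tm f t)"
  by (induction t) (auto simp: list_all_iff)

lemma wf_ren: "wf_fm L \<phi> \<Longrightarrow> wf_fm L (ren \<phi> f)"
  by (induction \<phi> arbitrary: f) (auto simp: wf_ren_tm list_all_iff Let_def)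

lemma fv_ren_tm: "fv_tm (ren_tm f t) = f ` fv_tm t"
  by (induction t) auto

lemma fv_ren: "fv (ren \<phi> f) \<subseteq> f ` fv \<phi>"
proof (induction \<phi> arbitrary: f)
  case (SupF x \<phi>)
  let ?z = "fresh_for (f ` (fv \<phi> - {x}))"
  have "(f(x := ?z)) ` fv \<phi> - {?z} \<subseteq> f ` (fv \<phi> - {x})" by auto
  then show ?case using SupF.IH[of "f(x := ?z)"] unfolding ren.simps Let_def fv.simps by blast
next
  case (InfF x \<phi>)
  let ?z = "fresh_for (f ` (fv \<phi> - {x}))"
  have "(f(x := ?z)) ` fv \<phi> - {?z} \<subseteq> f ` (fv \<phi> - {x})" by auto
  then show ?case using InfF.IH[of "f(x := ?z)"] unfolding ren.simps Let_def fv.simps by blast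
next
  case (Add \<phi> \<psi>)
  then show ?case unfolding ren.simps fv.simps image_Un by blast
qed (auto simp: fv_ren_tm)

lemma tm_val_ren_tm: "tm_val M v (ren_tm f t) = tm_val M (v \<circ> f) t"
proof (induction t)
  case (App F ts)
  have "map (tm_val M v) (map (ren_tm f) ts) = map (tm_val M (v \<circ> f)) ts"
    unfolding map_map by (intro map_cong[OF refl]) (metis App comp_apply)
  then show ?case by (simp only: tm_val.simps ren_tm.simps)
qed auto

lemma fm_val_ren: "fm_val M (ren \<phi> f) v = fm_val M \<phi> (v \<circ> f)"
proof (induction \<phi> arbitrary: f v)
  case (Rel R ts)
  have "map (tm_val M v) (map (ren_tm f) ts) = map (tm_val M (v \<circ> f)) ts"
    unfolding map_map by (intro map_cong[OF refl]) (metis tm_val_ren_tm comp_apply)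
  then show ?case by (simp only: fm_val.simps ren.simps)
next
  case (SupF x \<phi>)
  let ?z = "fresh_for (f ` (fv \<phi> - {x}))"
  have "?z \<notin> f ` (fv \<phi> - {x})" by (rule fresh_for) (simp add: finite_fv)
  then have z: "f y \<noteq> ?z" if "y \<in> fv \<phi>" "y \<noteq> x" for y
    using that by (metis imageI insertE insert_Diff_single insert_Diff insertI1 DiffI singletonD)
  have "fm_val M (ren \<phi> (f(x := ?z))) (v(?z := a)) = fm_val M \<phi> ((v \<circ> f)(x := a))" for a
    unfolding SupF.IH by (intro fm_val_cong) (auto dest: z)
  then show ?case by (simp only: ren.simps Let_def fm_val.simps)
next
  case (InfF x \<phi>)
  let ?z = "fresh_for (f ` (fv \<phi> - {x}))"
  have "?z \<notin> f ` (fv \<phi> - {x})" by (rule fresh_for) (simp add: finite_fv)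
  then have z: "f y \<noteq> ?z" if "y \<in> fv \<phi>" "y \<noteq> x" for y
    using that by (metis imageI insertE insert_Diff_single insert_Diff insertI1 DiffI singletonD)
  have "fm_val M (ren \<phi> (f(x := ?z))) (v(?z := a)) = fm_val M \<phi> ((v \<circ> f)(x := a))" for a
    unfolding InfF.IH by (intro fm_val_cong) (auto dest: z)
  then show ?case by (simp only: ren.simps Let_def fm_val.simps)
qed (auto simp: tm_val_ren_tm)

text \<open>
  Bounds and Lipschitz constants that depend on the formula only and are valid in every structure.
\<close>

primrec fm_bound :: "('c, 'f, 'r) fm \<Rightarrow> real" where
  "fm_bound (Const r) = \<bar>r\<bar>"
| "fm_bound (Dist s t) = 1"
| "fm_bound (Rel R ts) = 1"
| "fm_bound (Scale r \<phi>) = \<bar>r\<bar> * fm_bound \<phi>"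
| "fm_bound (Add \<phi> \<psi>) = fm_bound \<phi> + fm_bound \<psi>"
| "fm_bound (SupF x \<phi>) = fm_bound \<phi>"
| "fm_bound (InfF x \<phi>) = fm_bound \<phi>"

primrec tm_lip :: "('c, 'f, 'r) language \<Rightarrow> ('c, 'f) tm \<Rightarrow> real" where
  "tm_lip L (Var x) = 1"
| "tm_lip L (Cst c) = 0"
| "tm_lip L (App F ts) = fun_lip L F * sum_list (map (tm_lip L) ts)"

primrec fm_lip :: "('c, 'f, 'r) language \<Rightarrow> ('c, 'f, 'r) fm \<Rightarrow> real" where
  "fm_lip L (Const r) = 0"
| "fm_lip L (Dist s t) = tm_lip L s + tm_lip L t"
| "fm_lip L (Rel R ts) = rel_lip L R * sum_list (map (tm_lip L) ts)"
| "fm_lip L (Scale r \<phi>) = \<bar>r\<bar> * fm_lip L \<phi>"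
| "fm_lip L (Add \<phi> \<psi>) = fm_lip L \<phi> + fm_lip L \<psi>"
| "fm_lip L (SupF x \<phi>) = fm_lip L \<phi>"
| "fm_lip L (InfF x \<phi>) = fm_lip L \<phi>"

lemma abs_SUP_le:
  fixes f :: "'a \<Rightarrow> real"
  assumes "S \<noteq> {}" "\<And>a. a \<in> S \<Longrightarrow> \<bar>f a\<bar> \<le> B"
  shows "\<bar>SUP a\<in>S. f a\<bar> \<le> B" "\<bar>INF a\<in>S. f a\<bar> \<le> B"
proof -
  obtain a where a: "a \<in> S" using assms(1) by blast
  have up: "f a \<le> B" and lo: "- B \<le> f a" if "a \<in> S" for a
    using assms(2)[OF that] by (simp_all add: abs_le_iff)
  have "- B \<le> (SUP a\<in>S. f a)"
    by (rule cSUP_upper2[OF _ a]) (use up lo a in \<open>auto intro!: bdd_aboveI2\<close>)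
  moreover have "(SUP a\<in>S. f a) \<le> B" using assms(1) up by (intro cSUP_least)
  ultimately show "\<bar>SUP a\<in>S. f a\<bar> \<le> B" by simp
  have "(INF a\<in>S. f a) \<le> B"
    by (rule cINF_lower2[OF _ a]) (use up lo a in \<open>auto intro!: bdd_belowI2\<close>)
  moreover have "- B \<le> (INF a\<in>S. f a)" using assms(1) lo by (intro cINF_greatest)
  ultimately show "\<bar>INF a\<in>S. f a\<bar> \<le> B" by simp
qed

lemma abs_SUP_diff_le:
  fixes f g :: "'a \<Rightarrow> real"
  assumes "S \<noteq> {}" and f: "\<And>a. a \<in> S \<Longrightarrow> \<bar>f a\<bar> \<le> B" and g: "\<And>a. a \<in> S \<Longrightarrow> \<bar>g a\<bar> \<le> B"
    and fg: "\<And>a. a \<in> S \<Longrightarrow> \<bar>f a - g a\<bar> \<le> e"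
  shows "\<bar>(SUP a\<in>S. f a) - (SUP a\<in>S. g a)\<bar> \<le> e" "\<bar>(INF a\<in>S. f a) - (INF a\<in>S. g a)\<bar> \<le> e"
proof -
  have bdd: "bdd_above (f ` S)" "bdd_above (g ` S)" "bdd_below (f ` S)" "bdd_below (g ` S)"
    using f g by (auto intro!: bdd_aboveI2[of _ _ B] bdd_belowI2[of _ "- B"] simp: abs_le_iff minus_le_iff)
  have d: "f a \<le> g a + e" "g a \<le> f a + e" if "a \<in> S" for a using fg[OF that] by linarith+
  have "(SUP a\<in>S. f a) \<le> (SUP a\<in>S. g a) + e"
    using assms(1) d(1) cSUP_upper[OF _ bdd(2)] by (intro cSUP_least) (fastforce intro: order_trans)+
  moreover have "(SUP a\<in>S. g a) \<le> (SUP a\<in>S. f a) + e"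
    using assms(1) d(2) cSUP_upper[OF _ bdd(1)] by (intro cSUP_least) (fastforce intro: order_trans)+
  ultimately show "\<bar>(SUP a\<in>S. f a) - (SUP a\<in>S. g a)\<bar> \<le> e" by linarith
  have "(INF a\<in>S. g a) - e \<le> (INF a\<in>S. f a)"
  proof (rule cINF_greatest[OF assms(1)])
    show "(INF a\<in>S. g a) - e \<le> f a" if "a \<in> S" for a
      using cINF_lower[OF bdd(4) that] d(2)[OF that] by linarith
  qed
  moreover have "(INF a\<in>S. f a) - e \<le> (INF a\<in>S. g a)"
  proof (rule cINF_greatest[OF assms(1)])
    show "(INF a\<in>S. f a) - e \<le> g a" if "a \<in> S" for a
      using cINF_lower[OF bdd(3) that] d(1)[OF that] by linarith
  qed
  ultimately show "\<bar>(INF a\<in>S. f a) - (INF a\<in>S. g a)\<bar> \<le> e" by linarith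
qed

locale struct =
  fixes L :: "('c, 'f, 'r) language" and M :: "('c, 'f, 'r, 'a) lstruct"
  assumes lang: "is_language L" and struct: "is_structure L M"
begin

lemma nonempty: "carr M \<noteq> {}"
  and metric: "Metric_space (carr M) (dst M)"
  and dst_le_1: "x \<in> carr M \<Longrightarrow> y \<in> carr M \<Longrightarrow> dst M x y \<le> 1"
  and cst_in: "c \<in> cst_syms L \<Longrightarrow> cst_of M c \<in> carr M"
  and fun_in: "F \<in> fun_syms L \<Longrightarrow> xs \<in> tuples (carr M) (fun_ar L F) \<Longrightarrow> fun_of M F xs \<in> carr M"
  and fun_lip: "F \<in> fun_syms L \<Longrightarrow> xs \<in> tuples (carr M) (fun_ar L F) \<Longrightarrow>
    ys \<in> tuples (carr M) (fun_ar L F) \<Longrightarrow>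
    dst M (fun_of M F xs) (fun_of M F ys) \<le> fun_lip L F * tuple_dist (dst M) xs ys"
  and rel_le_1: "R \<in> rel_syms L \<Longrightarrow> xs \<in> tuples (carr M) (rel_ar L R) \<Longrightarrow> \<bar>rel_of M R xs\<bar> \<le> 1"
  and rel_lip: "R \<in> rel_syms L \<Longrightarrow> xs \<in> tuples (carr M) (rel_ar L R) \<Longrightarrow>
    ys \<in> tuples (carr M) (rel_ar L R) \<Longrightarrow>
    \<bar>rel_of M R xs - rel_of M R ys\<bar> \<le> rel_lip L R * tuple_dist (dst M) xs ys"
  using struct unfolding is_structure_def by blast+

sublocale Metric_space "carr M" "dst M" by (rule metric)

lemma fun_lip_nonneg: "F \<in> fun_syms L \<Longrightarrow> 0 \<le> fun_lip L F"
  and rel_lip_nonneg: "R \<in> rel_syms L \<Longrightarrow> 0 \<le> rel_lip L R"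
  using lang unfolding is_language_def by blast+

lemma tm_val_in: "wf_tm L t \<Longrightarrow> (\<And>x. x \<in> fv_tm t \<Longrightarrow> v x \<in> carr M) \<Longrightarrow> tm_val M v t \<in> carr M"
proof (induction t)
  case (App F ts)
  have "tm_val M v t \<in> carr M" if "t \<in> set ts" for t
    using App that by (auto simp: list_all_iff)
  then show ?case using App.prems by (auto intro!: fun_in simp: tuples_def)
qed (auto intro: cst_in)

lemma tm_vals_in:
  assumes "list_all (wf_tm L) ts" "\<And>x t. t \<in> set ts \<Longrightarrow> x \<in> fv_tm t \<Longrightarrow> v x \<in> carr M" "length ts = n"
  shows "map (tm_val M v) ts \<in> tuples (carr M) n"
  using assms tm_val_in by (auto simp: tuples_def list_all_iff)

lemma fm_val_bounded:
  "wf_fm L \<phi> \<Longrightarrow> (\<And>x. x \<in> fv \<phi> \<Longrightarrow> v x \<in> carr M) \<Longrightarrow> \<bar>fm_val M \<phi> v\<bar> \<le> fm_bound \<phi>"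
proof (induction \<phi> arbitrary: v)
  case (Dist s t)
  then show ?case by (auto intro!: dst_le_1 tm_val_in)
next
  case (Rel R ts)
  then have "map (tm_val M v) ts \<in> tuples (carr M) (rel_ar L R)" by (intro tm_vals_in) auto
  then show ?case using rel_le_1 Rel by simp
next
  case (Scale r \<phi>)
  then show ?case by (simp add: abs_mult mult_left_mono)
next
  case (Add \<phi> \<psi>)
  have "\<bar>fm_val M \<phi> v\<bar> \<le> fm_bound \<phi>" "\<bar>fm_val M \<psi> v\<bar> \<le> fm_bound \<psi>"
    using Add.prems by (auto intro!: Add.IH)
  then show ?case by simp
next
  case (SupF x \<phi>)
  then show ?case by (simp, intro abs_SUP_le nonempty SupF.IH) auto
next
  case (InfF x \<phi>)
  then show ?case by (simp, intro abs_SUP_le nonempty InfF.IH) auto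
qed simp

lemma tuple_dist_le:
  assumes "\<And>t. t \<in> set ts \<Longrightarrow> dst M (f t) (g t) \<le> h t"
  shows "tuple_dist (dst M) (map f ts) (map g ts) \<le> sum_list (map h ts)"
proof -
  have "(1/2) ^ i * dst M (f (ts ! i)) (g (ts ! i)) \<le> h (ts ! i)" if "i < length ts" for i
  proof -
    have "(1/2) ^ i * dst M (f (ts ! i)) (g (ts ! i)) \<le> 1 * dst M (f (ts ! i)) (g (ts ! i))"
      by (intro mult_right_mono) (simp_all add: power_le_one)
    then show ?thesis using assms[of "ts ! i"] that by simp
  qed
  then have "tuple_dist (dst M) (map f ts) (map g ts) \<le> (\<Sum>i<length ts. h (ts ! i))"
    by (auto simp: tuple_dist_def intro!: sum_mono)
  also have "\<dots> = sum_list (map h ts)"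
    by (simp add: sum_list_sum_nth atLeast0LessThan)
  finally show ?thesis .
qed

lemma tm_val_lipschitz:
  assumes "wf_tm L t" "0 \<le> e"
    and "\<And>x. x \<in> fv_tm t \<Longrightarrow> v x \<in> carr M" "\<And>x. x \<in> fv_tm t \<Longrightarrow> w x \<in> carr M"
    and "\<And>x. x \<in> fv_tm t \<Longrightarrow> dst M (v x) (w x) \<le> e"
  shows "dst M (tm_val M v t) (tm_val M w t) \<le> tm_lip L t * e"
  using assms
proof (induction t)
  case (Cst c)
  then show ?case using cst_in by simp
next
  case (App F ts)
  have "dst M (tm_val M v t) (tm_val M w t) \<le> tm_lip L t * e" if "t \<in> set ts" for t
    by (rule App.IH[OF that]) (use App.prems that in \<open>auto simp: list_all_iff\<close>)
  then have "tuple_dist (dst M) (map (tm_val M v) ts) (map (tm_val M w) ts)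
      \<le> sum_list (map (\<lambda>t. tm_lip L t * e) ts)" by (rule tuple_dist_le)
  then have "fun_lip L F * tuple_dist (dst M) (map (tm_val M v) ts) (map (tm_val M w) ts)
      \<le> fun_lip L F * (sum_list (map (tm_lip L) ts) * e)"
    using App.prems fun_lip_nonneg by (intro mult_left_mono) (auto simp: sum_list_mult_const)
  moreover have "dst M (tm_val M v (App F ts)) (tm_val M w (App F ts))
      \<le> fun_lip L F * tuple_dist (dst M) (map (tm_val M v) ts) (map (tm_val M w) ts)"
    using App.prems by (simp, intro fun_lip tm_vals_in) auto
  ultimately show ?case by (simp add: mult.assoc)
qed simp

lemma fm_val_lipschitz:
  assumes "wf_fm L \<phi>" "0 \<le> e"
    and "\<And>x. x \<in> fv \<phi> \<Longrightarrow> v x \<in> carr M" "\<And>x. x \<in> fv \<phi> \<Longrightarrow> w x \<in> carr M"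
    and "\<And>x. x \<in> fv \<phi> \<Longrightarrow> dst M (v x) (w x) \<le> e"
  shows "\<bar>fm_val M \<phi> v - fm_val M \<phi> w\<bar> \<le> fm_lip L \<phi> * e"
  using assms
proof (induction \<phi> arbitrary: v w)
  case (Dist s t)
  have "dst M (tm_val M v s) (tm_val M w s) \<le> tm_lip L s * e"
    "dst M (tm_val M v t) (tm_val M w t) \<le> tm_lip L t * e"
    using Dist by (auto intro!: tm_val_lipschitz)
  moreover have in_carr: "tm_val M v s \<in> carr M" "tm_val M w s \<in> carr M" "tm_val M v t \<in> carr M" "tm_val M w t \<in> carr M"
    using Dist by (auto intro!: tm_val_in)
  ultimately show ?case
    using triangle[OF in_carr(1,2,3)] triangle[OF in_carr(2,4,3)]
      triangle[OF in_carr(2,1,4)] triangle[OF in_carr(1,3,4)]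
    by (simp add: commute algebra_simps abs_le_iff)
next
  case (Rel R ts)
  have "dst M (tm_val M v t) (tm_val M w t) \<le> tm_lip L t * e" if "t \<in> set ts" for t
    using Rel that by (auto simp: list_all_iff intro!: tm_val_lipschitz)
  then have "tuple_dist (dst M) (map (tm_val M v) ts) (map (tm_val M w) ts)
      \<le> sum_list (map (\<lambda>t. tm_lip L t * e) ts)" by (rule tuple_dist_le)
  then have "rel_lip L R * tuple_dist (dst M) (map (tm_val M v) ts) (map (tm_val M w) ts)
      \<le> rel_lip L R * (sum_list (map (tm_lip L) ts) * e)"
    using Rel.prems rel_lip_nonneg by (intro mult_left_mono) (auto simp: sum_list_mult_const)
  moreover have "\<bar>fm_val M (Rel R ts) v - fm_val M (Rel R ts) w\<bar>
      \<le> rel_lip L R * tuple_dist (dst M) (map (tm_val M v) ts) (map (tm_val M w) ts)"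
    using Rel.prems by (simp, intro rel_lip tm_vals_in) auto
  ultimately show ?case by (simp add: mult.assoc)
next
  case (Scale r \<phi>)
  have "\<bar>r\<bar> * \<bar>fm_val M \<phi> v - fm_val M \<phi> w\<bar> \<le> \<bar>r\<bar> * (fm_lip L \<phi> * e)"
    using Scale.prems by (intro mult_left_mono Scale.IH) auto
  then show ?case by (simp add: abs_mult[symmetric] algebra_simps)
next
  case (Add \<phi> \<psi>)
  have "\<bar>fm_val M \<phi> v - fm_val M \<phi> w\<bar> \<le> fm_lip L \<phi> * e" "\<bar>fm_val M \<psi> v - fm_val M \<psi> w\<bar> \<le> fm_lip L \<psi> * e"
    using Add.prems by (auto intro!: Add.IH)
  then show ?case by (simp add: algebra_simps)
next
  case (SupF x \<phi>)
  have "\<bar>fm_val M \<phi> (v(x := a))\<bar> \<le> fm_bound \<phi>" "\<bar>fm_val M \<phi> (w(x := a))\<bar> \<le> fm_bound \<phi>"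
    "\<bar>fm_val M \<phi> (v(x := a)) - fm_val M \<phi> (w(x := a))\<bar> \<le> fm_lip L \<phi> * e" if "a \<in> carr M" for a
    using SupF.prems that by (auto intro!: SupF.IH fm_val_bounded)
  then show ?case by (simp, intro abs_SUP_diff_le(1)[OF nonempty]) auto
next
  case (InfF x \<phi>)
  have "\<bar>fm_val M \<phi> (v(x := a))\<bar> \<le> fm_bound \<phi>" "\<bar>fm_val M \<phi> (w(x := a))\<bar> \<le> fm_bound \<phi>"
    "\<bar>fm_val M \<phi> (v(x := a)) - fm_val M \<phi> (w(x := a))\<bar> \<le> fm_lip L \<phi> * e" if "a \<in> carr M" for a
    using InfF.prems that by (auto intro!: InfF.IH fm_val_bounded)
  then show ?case by (simp, intro abs_SUP_diff_le(2)[OF nonempty]) auto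
qed simp

lemma wf_foldr_InfF: "wf_fm L (foldr InfF xs \<phi>) \<longleftrightarrow> wf_fm L \<phi>"
  by (induction xs) auto

lemma fv_foldr_InfF: "fv (foldr InfF xs \<phi>) = fv \<phi> - set xs"
  by (induction xs) auto

lemma le_INF_iff_bounded:
  assumes "wf_fm L \<phi>" "\<And>y. y \<in> fv \<phi> - {x} \<Longrightarrow> v y \<in> carr M"
  shows "c \<le> (INF a\<in>carr M. fm_val M \<phi> (v(x := a))) \<longleftrightarrow> (\<forall>a\<in>carr M. c \<le> fm_val M \<phi> (v(x := a)))"
proof (rule le_cINF_iff[OF nonempty])
  have "\<bar>fm_val M \<phi> (v(x := a))\<bar> \<le> fm_bound \<phi>" if "a \<in> carr M" for a
    using assms that by (intro fm_val_bounded) auto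
  then show "bdd_below ((\<lambda>a. fm_val M \<phi> (v(x := a))) ` carr M)"
    by (intro bdd_belowI2[of _ "- fm_bound \<phi>"]) (auto simp: abs_le_iff minus_le_iff)
qed

text \<open>
  The iterated infimum as a greatest lower bound over all changes of the variables in \<open>xs\<close>.
  With \<open>xs\<close> listing all free variables it turns lower bounds of formulas into statements about
  sentences, and with other \<open>xs\<close> it produces minorants for \<open>convex_decomposition_lifts\<close>.
\<close>

lemma le_foldr_InfF_iff:
  assumes "wf_fm L \<phi>" "range v \<subseteq> carr M"
  shows "c \<le> fm_val M (foldr InfF xs \<phi>) v \<longleftrightarrow>
    (\<forall>w. range w \<subseteq> carr M \<longrightarrow> (\<forall>x. x \<notin> set xs \<longrightarrow> w x = v x) \<longrightarrow> c \<le> fm_val M \<phi> w)"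
  using assms(2)
proof (induction xs arbitrary: v)
  case Nil
  have "w = v" if "\<forall>x. w x = v x" for w using that by auto
  then show ?case using Nil by auto
next
  case (Cons x xs)
  have "c \<le> fm_val M (foldr InfF (x # xs) \<phi>) v \<longleftrightarrow>
      (\<forall>a\<in>carr M. c \<le> fm_val M (foldr InfF xs \<phi>) (v(x := a)))"
    using Cons.prems assms(1) by (simp, intro le_INF_iff_bounded) (auto simp: wf_foldr_InfF)
  also have "\<dots> \<longleftrightarrow> (\<forall>a\<in>carr M. \<forall>w. range w \<subseteq> carr M \<longrightarrow> (\<forall>y. y \<notin> set xs \<longrightarrow> w y = (v(x := a)) y) \<longrightarrow> c \<le> fm_val M \<phi> w)"
  proof (rule ball_cong[OF HOL.refl])
    fix a assume "a \<in> carr M"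
    then have "range (v(x := a)) \<subseteq> carr M" using Cons.prems by auto
    then show "(c \<le> fm_val M (foldr InfF xs \<phi>) (v(x := a))) \<longleftrightarrow> (\<forall>w. range w \<subseteq> carr M \<longrightarrow>
        (\<forall>y. y \<notin> set xs \<longrightarrow> w y = (v(x := a)) y) \<longrightarrow> c \<le> fm_val M \<phi> w)" by (rule Cons.IH)
  qed
  also have "\<dots> \<longleftrightarrow> (\<forall>w. range w \<subseteq> carr M \<longrightarrow> (\<forall>y. y \<notin> set (x # xs) \<longrightarrow> w y = v y) \<longrightarrow> c \<le> fm_val M \<phi> w)"
  proof (intro iffI allI impI ballI)
    fix w assume *: "\<forall>a\<in>carr M. \<forall>w. range w \<subseteq> carr M \<longrightarrow> (\<forall>y. y \<notin> set xs \<longrightarrow> w y = (v(x := a)) y) \<longrightarrow> c \<le> fm_val M \<phi> w"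
      and w: "range w \<subseteq> carr M" "\<forall>y. y \<notin> set (x # xs) \<longrightarrow> w y = v y"
    then have "w x \<in> carr M" by auto
    moreover have "\<forall>y. y \<notin> set xs \<longrightarrow> w y = (v(x := w x)) y" using w by auto
    ultimately show "c \<le> fm_val M \<phi> w" using * w(1) by blast
  next
    fix a w assume *: "\<forall>w. range w \<subseteq> carr M \<longrightarrow> (\<forall>y. y \<notin> set (x # xs) \<longrightarrow> w y = v y) \<longrightarrow> c \<le> fm_val M \<phi> w"
      and w: "range w \<subseteq> carr M" "\<forall>y. y \<notin> set xs \<longrightarrow> w y = (v(x := a)) y"
    then have "\<forall>y. y \<notin> set (x # xs) \<longrightarrow> w y = v y" by auto
    then show "c \<le> fm_val M \<phi> w" using * w(1) by blast
  qed
  finally show ?case .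
qed

end

section \<open>Spaces of formula instances\<close>

text \<open>
  Makes every function into \<open>'a\<close> usable as an assignment, so that instances of formulas are functions
  on a full function type.
\<close>

definition retract :: "('c, 'f, 'r, 'a) lstruct \<Rightarrow> 'a \<Rightarrow> 'a" where
  "retract M a = (if a \<in> carr M then a else (SOME b. b \<in> carr M))"

definition tm_inst ::
  "('c, 'f, 'r, 'a) lstruct \<Rightarrow> ('c, 'f) tm \<Rightarrow> (nat \<Rightarrow> 'i) \<Rightarrow> ('i \<Rightarrow> 'a) \<Rightarrow> 'a" where
  "tm_inst M t v = (\<lambda>I. tm_val M (\<lambda>x. retract M (I (v x))) t)"

text \<open>
  The formula \<open>\<phi>\<close> with the index \<open>v x\<close> put for the variable \<open>x\<close>, as a function of the points
  \<open>I i\<close> that interpret the indices. Indices will be witnesses, sometimes together with the numbers of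
  the variables of a type.
\<close>

definition inst ::
  "('c, 'f, 'r, 'a) lstruct \<Rightarrow> ('c, 'f, 'r) fm \<Rightarrow> (nat \<Rightarrow> 'i) \<Rightarrow> ('i \<Rightarrow> 'a) \<Rightarrow> real" where
  "inst M \<phi> v = (\<lambda>I. fm_val M \<phi> (\<lambda>x. retract M (I (v x))))"

definition inst_space ::
  "('c, 'f, 'r) language \<Rightarrow> ('c, 'f, 'r, 'a) lstruct \<Rightarrow> 'i set \<Rightarrow> (('i \<Rightarrow> 'a) \<Rightarrow> real) set" where
  "inst_space L M A = {inst M \<phi> v | \<phi> v. wf_fm L \<phi> \<and> v ` fv \<phi> \<subseteq> A}"

lemma inst_in_space: "wf_fm L \<phi> \<Longrightarrow> v ` fv \<phi> \<subseteq> A \<Longrightarrow> inst M \<phi> v \<in> inst_space L M A"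
  unfolding inst_space_def by blast

lemma inst_in_UNIV: "wf_fm L \<phi> \<Longrightarrow> inst M \<phi> v \<in> inst_space L M UNIV"
  by (rule inst_in_space) auto

lemma inst_spaceE:
  assumes "g \<in> inst_space L M A"
  obtains \<phi> v where "g = inst M \<phi> v" "wf_fm L \<phi>" "v ` fv \<phi> \<subseteq> A"
  using assms unfolding inst_space_def by blast

lemma inst_space_mono: "A \<subseteq> B \<Longrightarrow> inst_space L M A \<subseteq> inst_space L M B"
  unfolding inst_space_def by blast

lemma inst_cong: "(\<And>x. x \<in> fv \<phi> \<Longrightarrow> v x = w x) \<Longrightarrow> inst M \<phi> v = inst M \<phi> w"
  unfolding inst_def by (intro ext fm_val_cong) simp

lemma inst_ren: "inst M (ren \<phi> f) v = inst M \<phi> (v \<circ> f)"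
  unfolding inst_def fm_val_ren by (simp add: comp_def)

lemma tm_inst_cong: "(\<And>x. x \<in> fv_tm t \<Longrightarrow> v x = w x) \<Longrightarrow> tm_inst M t v = tm_inst M t w"
  unfolding tm_inst_def by (intro ext tm_val_cong) simp

lemma tm_inst_ren: "tm_inst M (ren_tm f t) v = tm_inst M t (v \<circ> f)"
  unfolding tm_inst_def tm_val_ren_tm by (simp add: comp_def)

lemma inst_Const: "inst M (Const r) v = (\<lambda>_. r)"
  and inst_Add: "inst M (Add \<phi> \<psi>) v = (\<lambda>I. inst M \<phi> v I + inst M \<psi> v I)"
  and inst_Scale: "inst M (Scale r \<phi>) v = (\<lambda>I. r * inst M \<phi> v I)"
  and inst_Dist: "inst M (Dist s t) v = (\<lambda>I. dst M (tm_inst M s v I) (tm_inst M t v I))"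
  by (simp_all add: inst_def tm_inst_def)

text \<open>
  Two instances can be written with the same assignment, using even variables for one of them and
  odd variables for the other. This makes the instances a vector space.
\<close>

lemma merge_assignments:
  fixes v w :: "nat \<Rightarrow> 'i"
  obtains u :: "nat \<Rightarrow> 'i" and f g :: "nat \<Rightarrow> nat" where "u \<circ> f = v" "u \<circ> g = w"
proof -
  let ?u = "\<lambda>n. if even n then v (n div 2) else w (n div 2)"
  have "?u \<circ> (\<lambda>n. 2 * n) = v" "?u \<circ> (\<lambda>n. 2 * n + 1) = w" by auto
  then show ?thesis by (rule that)
qed

text \<open>
  Variables that carry the same index are merged, so that different variables of the new formula can
  be given independent values.
\<close>

lemma identify_variables:
  fixes v :: "nat \<Rightarrow> 'i"
  obtains u :: "nat \<Rightarrow> 'i" and f :: "nat \<Rightarrow> nat"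
  where "\<And>x. x \<in> fv \<phi> \<Longrightarrow> u (f x) = v x" "inj_on u (fv (ren \<phi> f))"
proof -
  obtain e :: "'i \<Rightarrow> nat" where e: "inj_on e (v ` fv \<phi>)"
    using finite_imp_inj_to_nat_seg[OF finite_imageI[OF finite_fv, of v \<phi>]] by metis
  define u where "u = inv_into (v ` fv \<phi>) e"
  have sub: "fv (ren \<phi> (e \<circ> v)) \<subseteq> e ` v ` fv \<phi>"
    using fv_ren[of \<phi> "e \<circ> v"] by (simp add: image_comp)
  show ?thesis
  proof (rule that[of u "e \<circ> v"])
    show "u ((e \<circ> v) x) = v x" if "x \<in> fv \<phi>" for x
      using that e by (simp add: u_def)
    show "inj_on u (fv (ren \<phi> (e \<circ> v)))"
      unfolding u_def by (rule inj_on_subset[OF inj_on_inv_into[OF order_refl] sub])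
  qed
qed

context struct begin

lemma retract_in: "retract M a \<in> carr M"
  unfolding retract_def using nonempty some_in_eq[of "carr M"] by auto

lemma retract_id: "a \<in> carr M \<Longrightarrow> retract M a = a"
  unfolding retract_def by simp

lemma tm_inst_in: "wf_tm L t \<Longrightarrow> tm_inst M t v I \<in> carr M"
  unfolding tm_inst_def by (intro tm_val_in retract_in)

lemma inst_InfF_le:
  assumes "wf_fm L \<phi>"
  shows "inst M (InfF x \<phi>) v I \<le> inst M \<phi> (v(x := c)) I"
proof -
  let ?w = "\<lambda>y. retract M (I (v y))"
  have "inst M (InfF x \<phi>) v I \<le> (INF b\<in>carr M. fm_val M \<phi> (?w(x := b)))" by (simp add: inst_def)
  then have "inst M (InfF x \<phi>) v I \<le> fm_val M \<phi> (?w(x := retract M (I c)))"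
    using assms by (subst (asm) le_INF_iff_bounded) (auto intro: retract_in)
  also have "?w(x := retract M (I c)) = (\<lambda>y. retract M (I ((v(x := c)) y)))" by auto
  finally show ?thesis by (simp only: inst_def)
qed

lemma function_space_inst: "function_space (inst_space L M A)"
proof
  show "(\<lambda>_. 1) \<in> inst_space L M A"
    using inst_in_space[of L "Const 1" undefined A M] by (simp add: inst_Const)
next
  fix g h assume "g \<in> inst_space L M A" "h \<in> inst_space L M A"
  then obtain \<phi> v \<psi> w where g: "g = inst M \<phi> v" "wf_fm L \<phi>" "v ` fv \<phi> \<subseteq> A"
    and h: "h = inst M \<psi> w" "wf_fm L \<psi>" "w ` fv \<psi> \<subseteq> A" by (metis inst_spaceE)
  obtain u and f f' :: "nat \<Rightarrow> nat" where u: "u \<circ> f = v" "u \<circ> f' = w" by (rule merge_assignments[of v w])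
  have "(\<lambda>x. g x + h x) = inst M (Add (ren \<phi> f) (ren \<psi> f')) u"
    by (simp add: inst_Add inst_ren u g(1) h(1))
  also have "\<dots> \<in> inst_space L M A"
  proof (rule inst_in_space)
    have "u ` fv (ren \<phi> f) \<subseteq> v ` fv \<phi>" "u ` fv (ren \<psi> f') \<subseteq> w ` fv \<psi>"
      using fv_ren[of \<phi> f] fv_ren[of \<psi> f'] u by (auto simp flip: u simp: image_comp[symmetric])
    then show "u ` fv (Add (ren \<phi> f) (ren \<psi> f')) \<subseteq> A"
      using g(3) h(3) unfolding fv.simps image_Un by blast
  qed (use g h in \<open>auto intro: wf_ren\<close>)
  finally show "(\<lambda>x. g x + h x) \<in> inst_space L M A" .
next
  fix s g assume "g \<in> inst_space L M A"
  then obtain \<phi> v where g: "g = inst M \<phi> v" "wf_fm L \<phi>" "v ` fv \<phi> \<subseteq> A" by (rule inst_spaceE)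
  then have "inst M (Scale s \<phi>) v \<in> inst_space L M A" by (intro inst_in_space) auto
  then show "(\<lambda>x. s * g x) \<in> inst_space L M A" by (simp add: inst_Scale g(1))
next
  fix g assume "g \<in> inst_space L M A"
  then obtain \<phi> v where g: "g = inst M \<phi> v" "wf_fm L \<phi>" "v ` fv \<phi> \<subseteq> A" by (rule inst_spaceE)
  have "\<bar>g I\<bar> \<le> fm_bound \<phi>" for I
    unfolding g(1) inst_def using g(2) by (intro fm_val_bounded retract_in)
  then show "\<exists>B. \<forall>x. \<bar>g x\<bar> \<le> B" by blast
qed

lemma dst_inst_in_space:
  assumes "wf_tm L s" "wf_tm L t"
  shows "(\<lambda>I. dst M (tm_inst M s v I) (tm_inst M t w I)) \<in> inst_space L M UNIV"
proof -
  obtain u and f g :: "nat \<Rightarrow> nat" where u: "u \<circ> f = v" "u \<circ> g = w" by (rule merge_assignments[of v w])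
  have "inst M (Dist (ren_tm f s) (ren_tm g t)) u \<in> inst_space L M UNIV"
    using assms by (intro inst_in_UNIV) (simp add: wf_ren_tm)
  then show ?thesis by (simp add: inst_Dist tm_inst_ren u)
qed

text \<open>
  The minorant is the infimum over the variables whose index lies outside \<open>A\<close>. It is the greatest one
  because, once variables with equal index are identified, any values \<open>w\<close> of these variables come
  from an interpretation \<open>J\<close> that agrees with \<open>I\<close> on \<open>A\<close>, and functions in the space for \<open>A\<close> cannot
  tell \<open>J\<close> from \<open>I\<close>.
\<close>

lemma greatest_lower_bound_in_inst_space:
  assumes "\<psi> \<in> inst_space L M UNIV"
  shows "\<exists>\<iota>\<in>inst_space L M A. (\<forall>I. \<iota> I \<le> \<psi> I) \<and>
    (\<forall>\<theta>\<in>inst_space L M A. (\<forall>I. \<theta> I \<le> \<psi> I) \<longrightarrow> (\<forall>I. \<theta> I \<le> \<iota> I))"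
proof -
  obtain \<phi>0 v0 where "\<psi> = inst M \<phi>0 v0" "wf_fm L \<phi>0" using assms by (rule inst_spaceE)
  moreover obtain u and f :: "nat \<Rightarrow> nat" where u: "\<And>x. x \<in> fv \<phi>0 \<Longrightarrow> u (f x) = v0 x"
    and inj: "inj_on u (fv (ren \<phi>0 f))" using identify_variables[of \<phi>0 v0] by metis
  moreover define \<phi> where "\<phi> = ren \<phi>0 f"
  ultimately have \<psi>: "\<psi> = inst M \<phi> u" and wf: "wf_fm L \<phi>" and inj: "inj_on u (fv \<phi>)"
    by (auto simp: inst_ren wf_ren intro: inst_cong)
  obtain xs where xs: "set xs = {x \<in> fv \<phi>. u x \<notin> A}"
    using finite_list[of "{x \<in> fv \<phi>. u x \<notin> A}"] finite_fv[of \<phi>] by auto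
  let ?v = "\<lambda>I x. retract M (I (u x))"
  let ?\<iota> = "inst M (foldr InfF xs \<phi>) u"
  have range: "range (?v I) \<subseteq> carr M" for I using retract_in by auto
  have glb: "c \<le> ?\<iota> I \<longleftrightarrow> (\<forall>w. range w \<subseteq> carr M \<longrightarrow> (\<forall>x. x \<notin> set xs \<longrightarrow> w x = ?v I x) \<longrightarrow> c \<le> fm_val M \<phi> w)"
    for c I unfolding inst_def by (rule le_foldr_InfF_iff[OF wf range])
  show ?thesis
  proof (intro bexI conjI ballI allI impI)
    show "?\<iota> I \<le> \<psi> I" for I
      using glb[of "?\<iota> I" I] range[of I] unfolding \<psi> by (auto simp: inst_def)
    show "?\<iota> \<in> inst_space L M A"
      using wf xs by (intro inst_in_space) (auto simp: wf_foldr_InfF fv_foldr_InfF)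
  next
    fix \<theta> I assume "\<theta> \<in> inst_space L M A" and le: "\<forall>I. \<theta> I \<le> \<psi> I"
    then obtain \<eta> v where \<theta>: "\<theta> = inst M \<eta> v" "v ` fv \<eta> \<subseteq> A" by (metis inst_spaceE)
    show "\<theta> I \<le> ?\<iota> I"
      unfolding glb
    proof (intro allI impI)
      fix w assume w: "range w \<subseteq> carr M" "\<forall>x. x \<notin> set xs \<longrightarrow> w x = ?v I x"
      define J where "J i = (if i \<in> u ` set xs then w (inv_into (set xs) u i) else I i)" for i
      have inj_xs: "inj_on u (set xs)" using inj xs by (auto intro: inj_on_subset)
      have JA: "J i = I i" if "i \<in> A" for i using that xs by (auto simp: J_def)
      have Jw: "retract M (J (u x)) = w x" if "x \<in> fv \<phi>" for x
      proof (cases "x \<in> set xs")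
        case True
        then show ?thesis using inj_xs w(1) by (auto simp: J_def intro!: retract_id)
      next
        case False
        then have "u x \<in> A" using that xs by auto
        then show ?thesis using False w(2) by (simp add: JA)
      qed
      have "\<theta> I = \<theta> J"
        unfolding \<theta>(1) inst_def using \<theta>(2) JA by (intro fm_val_cong) auto
      also have "\<dots> \<le> \<psi> J" using le by blast
      also have "\<psi> J = fm_val M \<phi> w"
        unfolding \<psi> inst_def by (intro fm_val_cong Jw)
      finally show "\<theta> I \<le> fm_val M \<phi> w" .
    qed
  qed
qed

end

text \<open>
  Agreement on sentences is enough: the infimum over all free variables is a sentence.
\<close>

lemma lower_bound_transfers:
  assumes "struct L M" "struct L N"
    and eq: "\<And>\<sigma> v w. \<sigma> \<in> sentences L \<Longrightarrow> range v \<subseteq> carr M \<Longrightarrow> range w \<subseteq> carr N \<Longrightarrow>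
      fm_val M \<sigma> v = fm_val N \<sigma> w"
    and wf: "wf_fm L \<phi>" and bound: "\<And>w. range w \<subseteq> carr N \<Longrightarrow> c \<le> fm_val N \<phi> w"
    and v: "range v \<subseteq> carr M"
  shows "c \<le> fm_val M \<phi> v"
proof -
  interpret M: struct L M by fact
  interpret N: struct L N by fact
  obtain xs where xs: "set xs = fv \<phi>" using finite_list[OF finite_fv] by blast
  obtain b where "b \<in> carr N" using N.nonempty by blast
  then have w: "range (\<lambda>_ :: nat. b) \<subseteq> carr N" by auto
  have "foldr InfF xs \<phi> \<in> sentences L"
    using wf xs by (simp add: sentences_def M.wf_foldr_InfF M.fv_foldr_InfF)
  then have "fm_val M (foldr InfF xs \<phi>) v = fm_val N (foldr InfF xs \<phi>) (\<lambda>_. b)"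
    using v w by (rule eq)
  moreover have "c \<le> fm_val N (foldr InfF xs \<phi>) (\<lambda>_. b)"
    using bound by (subst N.le_foldr_InfF_iff[OF wf w]) blast
  ultimately show ?thesis using M.le_foldr_InfF_iff[OF wf v, of c xs] v by auto
qed

section \<open>An extreme state with witnesses\<close>

text \<open>
  The variable \<open>x\<close> is sent to the witness itself. Variables beyond \<open>cs\<close> get an arbitrary value; every
  assignment of a given formula is matched on its free variables once \<open>cs\<close> is long enough.
\<close>

definition wit_asg :: "('c, 'f, 'r) fm \<Rightarrow> nat \<Rightarrow> ('c, 'f, 'r, 'k) wit list \<Rightarrow> nat \<Rightarrow> ('c, 'f, 'r, 'k) wit" where
  "wit_asg \<phi> x cs = (\<lambda>i. if i = x then Wit \<phi> x cs else if i < length cs then cs ! i else Ext undefined)"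

text \<open>
  The tolerance \<open>e\<close> is positive for the states obtained by evaluation and \<open>0\<close> in the limit.
\<close>

definition witnessed ::
  "('c, 'f, 'r) language \<Rightarrow> ('c, 'f, 'r, 'a) lstruct \<Rightarrow> real \<Rightarrow>
    (((('c, 'f, 'r, 'k) wit \<Rightarrow> 'a) \<Rightarrow> real) \<Rightarrow> real) \<Rightarrow> bool" where
  "witnessed L M e p \<longleftrightarrow> (\<forall>\<phi> x cs. wf_fm L \<phi> \<longrightarrow>
     p (inst M \<phi> (wit_asg \<phi> x cs)) \<le> p (inst M (InfF x \<phi>) (wit_asg \<phi> x cs)) + e)"

text \<open>
  Distances are at most \<open>1\<close>, so this asks for distance exactly \<open>1\<close>; stated as a lower bound it is a
  closed condition, met at the edge of the admissible range.
\<close>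

definition separated ::
  "('c, 'f, 'r, 'a) lstruct \<Rightarrow> 'k set \<Rightarrow>
    (((('c, 'f, 'r, 'k) wit \<Rightarrow> 'a) \<Rightarrow> real) \<Rightarrow> real) \<Rightarrow> bool" where
  "separated M K p \<longleftrightarrow> (\<forall>k\<in>K. \<forall>l\<in>K. k \<noteq> l \<longrightarrow>
     1 \<le> p (inst M (Dist (Var 0) (Var 1)) (\<lambda>i. if i = 0 then Ext k else Ext l)))"

text \<open>
  Evaluation of witnesses in \<open>M\<close>, with \<open>h\<close> interpreting the points \<open>Ext k\<close>. For a formula that is
  not well formed the choice may fail and the value lie outside the carrier, hence the retraction. The
  default \<open>h undefined\<close> is the value of the default \<open>Ext undefined\<close> in \<open>wit_asg\<close>.
\<close>

primrec interp ::
  "('c, 'f, 'r, 'a) lstruct \<Rightarrow> real \<Rightarrow> ('k \<Rightarrow> 'a) \<Rightarrow> ('c, 'f, 'r, 'k) wit \<Rightarrow> 'a" where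
  "interp M e h (Ext k) = h k"
| "interp M e h (Wit \<phi> x cs) = (let ds = map (interp M e h) cs;
     v = (\<lambda>i. retract M (if i < length ds then ds ! i else h undefined))
     in SOME a. a \<in> carr M \<and> fm_val M \<phi> (v(x := a)) \<le> (INF b\<in>carr M. fm_val M \<phi> (v(x := b))) + e)"

context struct begin

lemma interp_witnesses:
  assumes e: "0 < e" and wf: "wf_fm L \<phi>"
  shows "inst M \<phi> (wit_asg \<phi> x cs) (interp M e h) \<le> inst M (InfF x \<phi>) (wit_asg \<phi> x cs) (interp M e h) + e"
proof -
  let ?I = "interp M e h"
  define v where "v i = retract M (if i < length cs then ?I (cs ! i) else h undefined)" for i
  let ?inf = "INF b\<in>carr M. fm_val M \<phi> (v(x := b))"
  let ?P = "\<lambda>a. a \<in> carr M \<and> fm_val M \<phi> (v(x := a)) \<le> ?inf + e"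
  have v: "range v \<subseteq> carr M" using retract_in by (auto simp: v_def)
  have "\<exists>a. ?P a"
  proof (rule ccontr)
    assume "\<not> ?thesis"
    then have "\<forall>a\<in>carr M. ?inf + e \<le> fm_val M \<phi> (v(x := a))" by (meson linear)
    then have "?inf + e \<le> ?inf" using wf v by (subst le_INF_iff_bounded) auto
    then show False using e by simp
  qed
  moreover have v_eq: "v = (\<lambda>i. retract M (if i < length (map ?I cs) then map ?I cs ! i else h undefined))"
    by (auto simp: v_def)
  have "?I (Wit \<phi> x cs) = (SOME a. ?P a)"
    by (simp only: interp.simps Let_def v_eq)
  ultimately have a: "?P (?I (Wit \<phi> x cs))" by (metis (mono_tags, lifting) someI_ex)
  let ?w = "\<lambda>i. retract M (?I (wit_asg \<phi> x cs i))"
  have w: "?w = v(x := ?I (Wit \<phi> x cs))"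
    using a by (auto simp: v_def wit_asg_def retract_id)
  have "inst M \<phi> (wit_asg \<phi> x cs) ?I = fm_val M \<phi> (v(x := ?I (Wit \<phi> x cs)))"
    unfolding inst_def w ..
  also have "\<dots> \<le> ?inf + e" using a by blast
  also have "?inf = inst M (InfF x \<phi>) (wit_asg \<phi> x cs) ?I"
    unfolding inst_def fm_val.simps w by simp
  finally show ?thesis .
qed

lemma evaluation_state:
  fixes I :: "'i \<Rightarrow> 'a"
  shows "(\<lambda>g. if g \<in> inst_space L M UNIV then g I else 0) \<in> states (inst_space L M UNIV)"
proof -
  interpret E: function_space "inst_space L M (UNIV :: 'i set)" by (rule function_space_inst)
  show ?thesis by (rule statesI) (auto simp: E.add E.scale E.one)
qed

text \<open>
  The set \<open>K\<close> of states that are witnessed and separated is nonempty by compactness: for a positive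
  tolerance and a finite set of indices, evaluation at \<open>interp\<close> satisfies the demands, and finitely
  many such demands reduce to a single one. An extreme point of \<open>K\<close> is an extreme state because \<open>K\<close>
  is a face: each demand says that an affine function of the state, never negative, has the value
  \<open>0\<close>, and when \<open>(1 - t) * x + t * y\<close> is \<open>0\<close> for nonnegative \<open>x\<close> and \<open>y\<close>, both are \<open>0\<close>.
\<close>

lemma extreme_witnessed_state_exists:
  fixes a :: "nat \<Rightarrow> 'a"
  assumes a: "range a \<subseteq> carr M" "\<And>m n. m \<noteq> n \<Longrightarrow> dst M (a m) (a n) = 1"
  obtains p :: "((('c, 'f, 'r, 'k) wit \<Rightarrow> 'a) \<Rightarrow> real) \<Rightarrow> real"
  where "extreme_state (inst_space L M UNIV) p" "witnessed L M 0 p" "separated M UNIV p"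
proof -
  let ?E = "inst_space L M (UNIV :: ('c, 'f, 'r, 'k) wit set)"
  let ?d = "\<lambda>k l. inst M (Dist (Var 0) (Var 1)) (\<lambda>i. if i = 0 then Ext k else Ext l :: ('c, 'f, 'r, 'k) wit)"
  interpret E: function_space ?E by (rule function_space_inst)
  define P where "P s = {p. witnessed L M (fst s) p \<and> separated M (snd s) p}"
    for s :: "real \<times> 'k set"
  define J where "J = {s :: real \<times> 'k set. 0 < fst s \<and> finite (snd s)}"
  define K where "K = states ?E \<inter> \<Inter> (P ` J)"
  have coord: "continuous_on UNIV (\<lambda>p :: ((('c, 'f, 'r, 'k) wit \<Rightarrow> 'a) \<Rightarrow> real) \<Rightarrow> real. p g)" for g
    by (rule continuous_on_product_coordinates)
  have closed_P: "closed (P s)" for s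
    unfolding P_def witnessed_def separated_def Ball_def
    by (intro closed_Collect_conj closed_Collect_all closed_Collect_imp open_Collect_const
        closed_Collect_le continuous_intros coord)
  have P_mono: "P s \<subseteq> P s'" if "fst s \<le> fst s'" "snd s' \<subseteq> snd s" for s s'
  proof (rule subsetI)
    fix p assume "p \<in> P s"
    then have w: "witnessed L M (fst s) p" and sp: "separated M (snd s) p" by (simp_all add: P_def)
    have "witnessed L M (fst s') p"
      unfolding witnessed_def
    proof (intro allI impI)
      fix \<phi> x and cs :: "('c, 'f, 'r, 'k) wit list" assume "wf_fm L \<phi>"
      then have "p (inst M \<phi> (wit_asg \<phi> x cs)) \<le> p (inst M (InfF x \<phi>) (wit_asg \<phi> x cs)) + fst s"
        using w by (simp add: witnessed_def)
      then show "p (inst M \<phi> (wit_asg \<phi> x cs)) \<le> p (inst M (InfF x \<phi>) (wit_asg \<phi> x cs)) + fst s'"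
        using that(1) by simp
    qed
    moreover have "separated M (snd s') p" using sp that(2) unfolding separated_def by blast
    ultimately show "p \<in> P s'" by (simp add: P_def)
  qed
  have P_inhabited: "states ?E \<inter> P s \<noteq> {}" if "s \<in> J" for s
  proof -
    have e: "0 < fst s" and "finite (snd s)" using that by (auto simp: J_def)
    then obtain f :: "'k \<Rightarrow> nat" where f: "inj_on f (snd s)"
      using finite_imp_inj_to_nat_seg by metis
    let ?I = "interp M (fst s) (a \<circ> f) :: ('c, 'f, 'r, 'k) wit \<Rightarrow> 'a"
    let ?p = "\<lambda>g. if g \<in> ?E then g ?I else 0"
    have "witnessed L M (fst s) ?p"
      unfolding witnessed_def
    proof (intro allI impI)
      fix \<phi> x and cs :: "('c, 'f, 'r, 'k) wit list" assume wf: "wf_fm L \<phi>"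
      have in_E: "inst M \<phi> (wit_asg \<phi> x cs) \<in> ?E" "inst M (InfF x \<phi>) (wit_asg \<phi> x cs) \<in> ?E"
        using wf by (auto intro!: inst_in_UNIV)
      show "?p (inst M \<phi> (wit_asg \<phi> x cs)) \<le> ?p (inst M (InfF x \<phi>) (wit_asg \<phi> x cs)) + fst s"
        using interp_witnesses[OF e wf] in_E by simp
    qed
    moreover have "separated M (snd s) ?p"
      unfolding separated_def
    proof (intro ballI impI)
      fix k l assume kl: "k \<in> snd s" "l \<in> snd s" "k \<noteq> l"
      then have "f k \<noteq> f l" using f by (auto dest: inj_onD)
      then show "1 \<le> ?p (?d k l)"
        using a by (simp add: inst_in_UNIV, simp add: inst_Dist tm_inst_def retract_id range_subsetD)
    qed
    ultimately show ?thesis using evaluation_state[of ?I] unfolding P_def by auto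
  qed
  have "K \<noteq> {}"
    unfolding K_def
  proof (rule compact_imp_fip_image[OF E.compact_states closed_P])
    fix D assume D: "finite D" "D \<subseteq> J"
    \<comment> \<open>the smallest tolerance and the largest index set that \<open>D\<close> asks for\<close>
    let ?s = "(Min (insert 1 (fst ` D)), \<Union> (snd ` D))"
    have "?s \<in> J" using D by (auto simp: J_def)
    moreover have "P ?s \<subseteq> P s" if "s \<in> D" for s
      using that D(1) by (intro P_mono) auto
    then have "P ?s \<subseteq> \<Inter> (P ` D)" by blast
    ultimately show "states ?E \<inter> \<Inter> (P ` D) \<noteq> {}" using P_inhabited[of ?s] by blast
  qed
  moreover have "closed (\<Inter> (P ` J))" using closed_P by auto
  then have "compact K" "closed K"
    unfolding K_def using E.compact_states E.closed_states by (auto intro: compact_Int_closed)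
  ultimately have "\<exists>p\<in>K. \<forall>q1\<in>K. \<forall>q2\<in>K. \<forall>t. 0 < t \<longrightarrow> t < 1 \<longrightarrow> p = (\<lambda>x. (1 - t) * q1 x + t * q2 x) \<longrightarrow> q1 = q2"
    by (intro compact_has_extreme_point)
  then obtain p where p: "p \<in> K" and
    ext: "\<forall>q1\<in>K. \<forall>q2\<in>K. \<forall>t. 0 < t \<longrightarrow> t < 1 \<longrightarrow> p = (\<lambda>x. (1 - t) * q1 x + t * q2 x) \<longrightarrow> q1 = q2"
    by (rule bexE)
  have K_I: "q \<in> K" if "q \<in> states ?E" "witnessed L M 0 q" "separated M UNIV q" for q
  proof -
    have "q \<in> P (0, UNIV)" using that by (simp add: P_def)
    then have "q \<in> P s" if "s \<in> J" for s using P_mono[of "(0, UNIV)" s] that by (auto simp: J_def)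
    then show ?thesis using that(1) by (auto simp: K_def)
  qed
  have pE: "p \<in> states ?E" and pP: "\<And>s. s \<in> J \<Longrightarrow> p \<in> P s" using p by (auto simp: K_def)
  have wit: "witnessed L M 0 p"
    unfolding witnessed_def
  proof (intro allI impI)
    fix \<phi> x and cs :: "('c, 'f, 'r, 'k) wit list" assume wf: "wf_fm L \<phi>"
    have "p (inst M \<phi> (wit_asg \<phi> x cs)) \<le> p (inst M (InfF x \<phi>) (wit_asg \<phi> x cs)) + e" if "0 < e" for e
      using pP[of "(e, {})"] that wf by (auto simp: J_def P_def witnessed_def)
    then show "p (inst M \<phi> (wit_asg \<phi> x cs)) \<le> p (inst M (InfF x \<phi>) (wit_asg \<phi> x cs)) + 0"
      by (simp add: field_le_epsilon)
  qed
  have sep: "separated M UNIV p"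
    unfolding separated_def
  proof (intro ballI impI)
    fix k l :: 'k assume "k \<noteq> l"
    then show "1 \<le> p (?d k l)"
      using pP[of "(1, {k, l})"] by (simp add: J_def P_def separated_def)
  qed
  have "extreme_state ?E p"
    unfolding extreme_state_def
  proof (intro conjI[OF pE] ballI allI impI)
    fix q1 q2 and t :: real
    assume q: "q1 \<in> states ?E" "q2 \<in> states ?E" and t: "0 < t" "t < 1"
      and eq: "p = (\<lambda>g. (1 - t) * q1 g + t * q2 g)"
    interpret q1: state ?E q1 using q(1) by unfold_locales
    interpret q2: state ?E q2 using q(2) by unfold_locales
    have zero: "x \<le> 0" "y \<le> 0" if "0 \<le> x" "0 \<le> y" "(1 - t) * x + t * y \<le> 0" for x y
    proof -
      have "0 \<le> (1 - t) * x" "0 \<le> t * y" using that t by auto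
      then have "(1 - t) * x \<le> 0" "t * y \<le> 0" using that(3) by linarith+
      then show "x \<le> 0" "y \<le> 0" using t by (auto simp: mult_le_0_iff)
    qed
    have w: "q1 (inst M \<phi> (wit_asg \<phi> x cs)) \<le> q1 (inst M (InfF x \<phi>) (wit_asg \<phi> x cs)) \<and>
        q2 (inst M \<phi> (wit_asg \<phi> x cs)) \<le> q2 (inst M (InfF x \<phi>) (wit_asg \<phi> x cs))"
      if wf: "wf_fm L \<phi>" for \<phi> x cs
    proof -
      let ?f = "inst M \<phi> (wit_asg \<phi> x cs)" and ?g = "inst M (InfF x \<phi>) (wit_asg \<phi> x cs)"
      have in_E: "?f \<in> ?E" "?g \<in> ?E" using wf by (auto intro!: inst_in_UNIV)
      have le: "?g I \<le> ?f I" for I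
        using inst_InfF_le[OF wf, of x "wit_asg \<phi> x cs" I "wit_asg \<phi> x cs x"] by simp
      have "0 \<le> q1 ?f - q1 ?g" "0 \<le> q2 ?f - q2 ?g"
        using q1.p_mono[OF in_E(2,1) le] q2.p_mono[OF in_E(2,1) le] by auto
      moreover have "p ?f \<le> p ?g" using wit wf by (simp add: witnessed_def)
      then have "(1 - t) * (q1 ?f - q1 ?g) + t * (q2 ?f - q2 ?g) \<le> 0"
        unfolding eq by (simp add: algebra_simps)
      ultimately have "q1 ?f - q1 ?g \<le> 0" "q2 ?f - q2 ?g \<le> 0" by (rule zero)+
      then show ?thesis by simp
    qed
    have s: "1 \<le> q1 (?d k l) \<and> 1 \<le> q2 (?d k l)" if "k \<noteq> l" for k l
    proof -
      have in_E: "?d k l \<in> ?E" by (rule inst_in_UNIV) simp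
      have le: "?d k l I \<le> 1" for I
        by (simp add: inst_def dst_le_1 retract_in)
      have "0 \<le> 1 - q1 (?d k l)" "0 \<le> 1 - q2 (?d k l)"
        using q1.p_mono[OF in_E E.one le] q2.p_mono[OF in_E E.one le] q1.p_one q2.p_one by auto
      moreover have "1 \<le> p (?d k l)" using sep that by (simp add: separated_def)
      then have "(1 - t) * (1 - q1 (?d k l)) + t * (1 - q2 (?d k l)) \<le> 0"
        unfolding eq by (simp add: algebra_simps)
      ultimately have "1 - q1 (?d k l) \<le> 0" "1 - q2 (?d k l) \<le> 0" by (rule zero)+
      then show ?thesis by simp
    qed
    have "q1 \<in> K" "q2 \<in> K"
      using q w s by (auto intro!: K_I simp: witnessed_def separated_def)
    then have "q1 = q2" using ext[rule_format, OF _ _ t eq] by simp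
    then show "q1 = p \<and> q2 = p" using eq by (simp add: algebra_simps)
  qed
  then show ?thesis using wit sep by (rule that)
qed

end

section \<open>The model of the witnesses\<close>

lemma fm_val_SupF: "fm_val M (SupF x \<phi>) v = - fm_val M (InfF x (Scale (- 1) \<phi>)) v"
  by (simp add: Inf_real_def image_image)

locale witnessed_state = struct L M
  for L :: "('c, 'f, 'r) language" and M :: "('c, 'f, 'r, 'a) lstruct" +
  fixes p :: "((('c, 'f, 'r, 'k) wit \<Rightarrow> 'a) \<Rightarrow> real) \<Rightarrow> real"
  assumes p_state: "p \<in> states (inst_space L M UNIV)" and p_witnessed: "witnessed L M 0 p"
begin

sublocale S: state "inst_space L M UNIV" p
  using function_space_inst p_state by (simp add: state_def state_axioms_def)

definition term_dist where
  "term_dist s v t w = p (\<lambda>I. dst M (tm_inst M s v I) (tm_inst M t w I))"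

definition wit_dist where "wit_dist c d = term_dist (Var 0) (\<lambda>_. c) (Var 0) (\<lambda>_. d)"

lemma term_dist_Var_left: "term_dist (Var x) v t w = term_dist (Var 0) (\<lambda>_. v x) t w"
  by (simp add: term_dist_def tm_inst_def)

lemma term_dist_nonneg: "wf_tm L s \<Longrightarrow> wf_tm L t \<Longrightarrow> 0 \<le> term_dist s v t w"
  unfolding term_dist_def by (intro S.p_nonneg dst_inst_in_space) auto

lemma term_dist_refl: "wf_tm L s \<Longrightarrow> term_dist s v s v = 0"
  unfolding term_dist_def using S.p_const[of 0] by (simp add: tm_inst_in)

lemma term_dist_sym: "term_dist s v t w = term_dist t w s v"
  unfolding term_dist_def by (simp add: commute)

lemma term_dist_triangle:
  assumes "wf_tm L s" "wf_tm L t" "wf_tm L u"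
  shows "term_dist s v u w \<le> term_dist s v t z + term_dist t z u w"
proof -
  let ?f = "\<lambda>I. dst M (tm_inst M s v I) (tm_inst M t z I)"
  let ?g = "\<lambda>I. dst M (tm_inst M t z I) (tm_inst M u w I)"
  have "term_dist s v u w \<le> p (\<lambda>I. ?f I + ?g I)"
    unfolding term_dist_def using assms
    by (intro S.p_mono S.add dst_inst_in_space triangle tm_inst_in)
  also have "\<dots> = term_dist s v t z + term_dist t z u w"
    unfolding term_dist_def using assms by (intro S.p_add dst_inst_in_space)
  finally show ?thesis .
qed

lemma term_dist_le_1: "wf_tm L s \<Longrightarrow> wf_tm L t \<Longrightarrow> term_dist s v t w \<le> 1"
  using S.p_mono[OF dst_inst_in_space S.one, of s t v w] S.p_one
  by (simp add: term_dist_def dst_le_1 tm_inst_in)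

lemma tuple_dist_state:
  fixes v w :: "nat \<Rightarrow> ('c, 'f, 'r, 'k) wit"
  assumes "list_all (wf_tm L) ts" "list_all (wf_tm L) ss" "length ts = n" "length ss = n"
  defines "h \<equiv> \<lambda>I. tuple_dist (dst M) (map (\<lambda>t. tm_inst M t v I) ts) (map (\<lambda>t. tm_inst M t w I) ss)"
  shows "h \<in> inst_space L M UNIV" "p h = (\<Sum>i<n. (1/2) ^ i * term_dist (ts ! i) v (ss ! i) w)"
proof -
  let ?g = "\<lambda>i I. (1/2) ^ i * dst M (tm_inst M (ts ! i) v I) (tm_inst M (ss ! i) w I)"
  have h: "h = (\<lambda>I. \<Sum>i\<in>{..<n}. ?g i I)"
    using assms(3,4) by (auto simp: h_def tuple_dist_def)
  have d: "(\<lambda>I. dst M (tm_inst M (ts ! i) v I) (tm_inst M (ss ! i) w I)) \<in> inst_space L M UNIV"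
    if "i < n" for i using assms that by (intro dst_inst_in_space) (auto simp: list_all_length)
  have g: "?g i \<in> inst_space L M UNIV" if "i \<in> {..<n}" for i
    using d that by (intro S.scale) auto
  show "h \<in> inst_space L M UNIV" unfolding h by (rule S.sum[OF _ g]) auto
  have "p h = (\<Sum>i<n. p (?g i))" unfolding h by (rule S.p_sum[OF _ g]) auto
  also have "\<dots> = (\<Sum>i<n. (1/2) ^ i * term_dist (ts ! i) v (ss ! i) w)"
    unfolding term_dist_def using d by (intro sum.cong HOL.refl S.p_scale) auto
  finally show "p h = (\<Sum>i<n. (1/2) ^ i * term_dist (ts ! i) v (ss ! i) w)" .
qed

lemma tm_inst_tuple:
  "list_all (wf_tm L) ts \<Longrightarrow> length ts = n \<Longrightarrow> map (\<lambda>t. tm_inst M t v I) ts \<in> tuples (carr M) n"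
  by (auto simp: tuples_def list_all_iff intro: tm_inst_in)

lemma term_dist_App:
  assumes "wf_tm L (App F ts)" "wf_tm L (App F ss)"
  shows "term_dist (App F ts) v (App F ss) w \<le>
    fun_lip L F * (\<Sum>i<fun_ar L F. (1/2) ^ i * term_dist (ts ! i) v (ss ! i) w)"
proof -
  let ?h = "\<lambda>I. tuple_dist (dst M) (map (\<lambda>t. tm_inst M t v I) ts) (map (\<lambda>t. tm_inst M t w I) ss)"
  have *: "list_all (wf_tm L) ts" "list_all (wf_tm L) ss" "length ts = fun_ar L F" "length ss = fun_ar L F"
    "F \<in> fun_syms L" using assms by auto
  have "term_dist (App F ts) v (App F ss) w \<le> p (\<lambda>I. fun_lip L F * ?h I)"
    unfolding term_dist_def
  proof (rule S.p_mono[OF dst_inst_in_space[OF assms] S.scale[OF tuple_dist_state(1)[OF *(1-4)]]])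
    show "dst M (tm_inst M (App F ts) v I) (tm_inst M (App F ss) w I) \<le> fun_lip L F * ?h I" for I
      using fun_lip[OF *(5) tm_inst_tuple tm_inst_tuple] * by (simp add: tm_inst_def)
  qed
  also have "\<dots> = fun_lip L F * p ?h" by (rule S.p_scale[OF tuple_dist_state(1)[OF *(1-4)]])
  also have "p ?h = (\<Sum>i<fun_ar L F. (1/2) ^ i * term_dist (ts ! i) v (ss ! i) w)"
    by (rule tuple_dist_state(2)[OF *(1-4)])
  finally show ?thesis .
qed

lemma p_Rel:
  assumes "wf_fm L (Rel R ts)" "wf_fm L (Rel R ss)"
  shows "\<bar>p (inst M (Rel R ts) v) - p (inst M (Rel R ss) w)\<bar> \<le>
    rel_lip L R * (\<Sum>i<rel_ar L R. (1/2) ^ i * term_dist (ts ! i) v (ss ! i) w)"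
proof -
  let ?h = "\<lambda>I. tuple_dist (dst M) (map (\<lambda>t. tm_inst M t v I) ts) (map (\<lambda>t. tm_inst M t w I) ss)"
  have *: "list_all (wf_tm L) ts" "list_all (wf_tm L) ss" "length ts = rel_ar L R" "length ss = rel_ar L R"
    "R \<in> rel_syms L" using assms by auto
  have in_E: "inst M (Rel R ts) v \<in> inst_space L M UNIV" "inst M (Rel R ss) w \<in> inst_space L M UNIV"
    using assms by (auto intro!: inst_in_UNIV simp del: wf_fm.simps)
  have "\<bar>p (\<lambda>I. inst M (Rel R ts) v I - inst M (Rel R ss) w I)\<bar> \<le> p (\<lambda>I. rel_lip L R * ?h I)"
  proof (rule S.p_abs_le[OF S.diff[OF in_E] S.scale[OF tuple_dist_state(1)[OF *(1-4)]]])
    show "\<bar>inst M (Rel R ts) v I - inst M (Rel R ss) w I\<bar> \<le> rel_lip L R * ?h I" for I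
      using rel_lip[OF *(5) tm_inst_tuple tm_inst_tuple] * by (simp add: tm_inst_def inst_def)
  qed
  also have "\<dots> = rel_lip L R * p ?h" by (rule S.p_scale[OF tuple_dist_state(1)[OF *(1-4)]])
  also have "p ?h = (\<Sum>i<rel_ar L R. (1/2) ^ i * term_dist (ts ! i) v (ss ! i) w)"
    by (rule tuple_dist_state(2)[OF *(1-4)])
  finally show ?thesis using S.p_diff[OF in_E] by simp
qed

definition denotation where "denotation t v = (SOME c. term_dist t v (Var 0) (\<lambda>_. c) = 0)"

text \<open>
  The formula \<open>d(t, z)\<close> has infimum \<open>0\<close> over \<open>z\<close>, attained at \<open>z = t\<close>; the witness of this infimum
  therefore has distance \<open>0\<close> from \<open>t\<close>.
\<close>

lemma denotation:
  assumes wf: "wf_tm L t"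
  shows "term_dist t v (Var 0) (\<lambda>_. denotation t v) = 0"
proof -
  obtain z where z: "\<And>x. x \<in> fv_tm t \<Longrightarrow> x < z"
    using finite_fv_tm[of t] by (meson finite_nat_set_iff_bounded)
  let ?\<phi> = "Dist t (Var z)"
  let ?cs = "map v [0..<z]"
  let ?u = "wit_asg ?\<phi> z ?cs"
  let ?c = "Wit ?\<phi> z ?cs"
  have "tm_inst M t ?u = tm_inst M t v"
    by (rule tm_inst_cong) (use z in \<open>force simp: wit_asg_def\<close>)
  moreover have "tm_inst M (Var z) ?u = tm_inst M (Var 0) (\<lambda>_. ?c)"
    by (simp add: tm_inst_def wit_asg_def)
  ultimately have "term_dist t v (Var 0) (\<lambda>_. ?c) = p (inst M ?\<phi> ?u)"
    by (simp add: term_dist_def inst_Dist)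
  also have "\<dots> \<le> p (inst M (InfF z ?\<phi>) ?u)"
    using p_witnessed wf by (simp add: witnessed_def)
  also have "\<dots> \<le> p (\<lambda>_. 0)"
  proof (rule S.p_mono)
    show "inst M (InfF z ?\<phi>) ?u \<in> inst_space L M UNIV" using wf by (intro inst_in_UNIV) simp
    fix I
    let ?w = "\<lambda>x. retract M (I (?u x))"
    let ?a = "tm_val M ?w t"
    have "inst M (InfF z ?\<phi>) ?u I = (INF b\<in>carr M. fm_val M ?\<phi> (?w(z := b)))"
      by (simp add: inst_def)
    also have "\<dots> \<le> fm_val M ?\<phi> (?w(z := ?a))"
    proof (rule cINF_lower)
      show "bdd_below ((\<lambda>b. fm_val M ?\<phi> (?w(z := b))) ` carr M)"
        by (rule bdd_belowI2[of _ 0]) simp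
      show "?a \<in> carr M" using wf by (intro tm_val_in retract_in)
    qed
    also have "tm_val M (?w(z := ?a)) t = ?a" by (rule tm_val_cong) (use z in force)
    then have "fm_val M ?\<phi> (?w(z := ?a)) = 0"
      using tm_val_in[OF wf, of ?w] retract_in by simp
    finally show "inst M (InfF z ?\<phi>) ?u I \<le> 0" .
  qed (rule S.const)
  finally have "term_dist t v (Var 0) (\<lambda>_. ?c) \<le> 0" by (simp add: S.p_const)
  moreover have "0 \<le> term_dist t v (Var 0) (\<lambda>_. ?c)" using wf by (intro term_dist_nonneg) auto
  ultimately have "term_dist t v (Var 0) (\<lambda>_. ?c) = 0" by simp
  then show ?thesis unfolding denotation_def by (rule someI)
qed

lemma wit_dist_denotation:
  assumes "wf_tm L s" "wf_tm L t"
  shows "wit_dist (denotation s v) (denotation t w) = term_dist s v t w"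
proof (rule antisym)
  have V: "wf_tm L (Var 0)" by simp
  have s0: "term_dist (Var 0) (\<lambda>_. denotation s v) s v = 0" using denotation[OF assms(1)] by (metis term_dist_sym)
  have t0: "term_dist (Var 0) (\<lambda>_. denotation t w) t w = 0" using denotation[OF assms(2)] by (metis term_dist_sym)
  show "wit_dist (denotation s v) (denotation t w) \<le> term_dist s v t w"
    using term_dist_triangle[OF V assms(1) V, of "\<lambda>_. denotation s v" "\<lambda>_. denotation t w" v]
      term_dist_triangle[OF assms V, of v "\<lambda>_. denotation t w" w] s0 denotation[OF assms(2), of w] by (simp add: wit_dist_def)
  show "term_dist s v t w \<le> wit_dist (denotation s v) (denotation t w)"
    using term_dist_triangle[OF assms(1) V assms(2), of v w "\<lambda>_. denotation s v"]
      term_dist_triangle[OF V V assms(2), of "\<lambda>_. denotation s v" w "\<lambda>_. denotation t w"] t0 denotation[OF assms(1), of v]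
    by (simp add: wit_dist_def)
qed

lemma term_dist_Var: "term_dist (Var x) v (Var y) w = wit_dist (v x) (w y)"
  by (simp add: wit_dist_def term_dist_def tm_inst_def)

end

text \<open>
  The completion of the witnesses, by the properties that determine it. Functions are given by
  denotations of terms, relations by the state. On all of the carrier they are determined by density
  and the Lipschitz conditions.
\<close>

locale witness_model = witnessed_state L M p
  for L :: "('c, 'f, 'r) language" and M :: "('c, 'f, 'r, 'a) lstruct"
    and p :: "((('c, 'f, 'r, 'k) wit \<Rightarrow> 'a) \<Rightarrow> real) \<Rightarrow> real" +
  fixes N :: "('c, 'f, 'r, 'u) lstruct" and j :: "('c, 'f, 'r, 'k) wit \<Rightarrow> 'u"
  assumes N_structure: "is_structure L N"
    and j_in: "j c \<in> carr N"
    and j_dst: "dst N (j c) (j d) = wit_dist c d"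
    and j_dense: "y \<in> carr N \<Longrightarrow> 0 < e \<Longrightarrow> \<exists>c. dst N (j c) y < e"
    and N_cst: "b \<in> cst_syms L \<Longrightarrow> cst_of N b = j (denotation (Cst b) (\<lambda>_. Ext undefined))"
    and N_fun: "F \<in> fun_syms L \<Longrightarrow> length cs = fun_ar L F \<Longrightarrow>
      fun_of N F (map j cs) = j (denotation (App F (map Var [0..<fun_ar L F])) (\<lambda>i. cs ! i))"
    and N_rel: "R \<in> rel_syms L \<Longrightarrow> length cs = rel_ar L R \<Longrightarrow>
      rel_of N R (map j cs) = p (inst M (Rel R (map Var [0..<rel_ar L R])) (\<lambda>i. cs ! i))"

context witnessed_state begin

lemma witness_model_exists:
  assumes "\<exists>enc :: (('c, 'f, 'r, 'k) wit \<Rightarrow> real) \<Rightarrow> 'u. inj enc"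
  shows "\<exists>(N :: ('c, 'f, 'r, 'u) lstruct) j. witness_model L M p N j"
proof -
  obtain enc :: "(('c, 'f, 'r, 'k) wit \<Rightarrow> real) \<Rightarrow> 'u" where enc: "inj enc" using assms by blast
  obtain Y dY j where Y: "Metric_space Y dY" "Metric_space.mcomplete Y dY"
    and le_1: "\<And>y z. y \<in> Y \<Longrightarrow> z \<in> Y \<Longrightarrow> dY y z \<le> (1 :: real)"
    and j: "\<And>c. j c \<in> (Y :: 'u set)" and dY: "\<And>c c'. dY (j c) (j c') = wit_dist c c'"
    and dense: "\<And>y e. y \<in> Y \<Longrightarrow> 0 < e \<Longrightarrow> \<exists>c. dY (j c) y < e"
  proof (rule pseudometric_completion[OF _ _ _ _ _ enc, of wit_dist])
    show "wit_dist x x = 0" for x by (simp add: wit_dist_def term_dist_refl)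
    show "wit_dist x y = wit_dist y x" for x y unfolding wit_dist_def by (rule term_dist_sym)
    show "wit_dist x z \<le> wit_dist x y + wit_dist y z" for x y z unfolding wit_dist_def by (intro term_dist_triangle) auto
    show "0 \<le> wit_dist x y" "wit_dist x y \<le> 1" for x y unfolding wit_dist_def by (auto intro: term_dist_nonneg term_dist_le_1)
  qed blast
  have td: "tuple_dist dY (map j cs) (map j ds) = (\<Sum>i<n. (1/2) ^ i * wit_dist (cs ! i) (ds ! i))"
    if "length cs = n" "length ds = n" for cs ds n
    using that by (simp add: tuple_dist_def dY)
  define G where "G F cs = denotation (App F (map Var [0..<fun_ar L F])) (\<lambda>i. cs ! i)" for F and cs :: "('c, 'f, 'r, 'k) wit list"
  define GR where "GR R cs = p (inst M (Rel R (map Var [0..<rel_ar L R])) (\<lambda>i. cs ! i))" for R and cs :: "('c, 'f, 'r, 'k) wit list"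
  have "\<exists>H. (\<forall>ys\<in>tuples Y (fun_ar L F). H ys \<in> Y) \<and> (\<forall>cs. length cs = fun_ar L F \<longrightarrow> H (map j cs) = j (G F cs)) \<and>
    (\<forall>ys\<in>tuples Y (fun_ar L F). \<forall>zs\<in>tuples Y (fun_ar L F). dY (H ys) (H zs) \<le> fun_lip L F * tuple_dist dY ys zs)"
    if F: "F \<in> fun_syms L" for F
  proof -
    have wf: "wf_tm L (App F (map Var [0..<fun_ar L F]))" using F by (simp add: list_all_iff)
    have lip: "dY (j (G F cs)) (j (G F ds)) \<le> fun_lip L F * tuple_dist dY (map j cs) (map j ds)"
      if "length cs = fun_ar L F" "length ds = fun_ar L F" for cs ds
      using term_dist_App[OF wf wf, of "\<lambda>i. cs ! i" "\<lambda>i. ds ! i"] that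
      by (simp add: dY G_def wit_dist_denotation[OF wf wf] td[OF that] term_dist_Var)
    show ?thesis
    proof (rule lipschitz_extends_from_dense[OF Y(1) j dense Y j lip fun_lip_nonneg[OF F]])
      fix H assume "\<And>ys. ys \<in> tuples Y (fun_ar L F) \<Longrightarrow> H ys \<in> Y"
        "\<And>cs. length cs = fun_ar L F \<Longrightarrow> H (map j cs) = j (G F cs)"
        "\<And>ys zs. ys \<in> tuples Y (fun_ar L F) \<Longrightarrow> zs \<in> tuples Y (fun_ar L F) \<Longrightarrow>
          dY (H ys) (H zs) \<le> fun_lip L F * tuple_dist dY ys zs"
      then show ?thesis by (intro exI[of _ H] conjI ballI allI impI) simp_all
    qed
  qed
  then obtain fH where fH: "\<And>F. F \<in> fun_syms L \<Longrightarrow> (\<forall>ys\<in>tuples Y (fun_ar L F). fH F ys \<in> Y) \<and>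
    (\<forall>cs. length cs = fun_ar L F \<longrightarrow> fH F (map j cs) = j (G F cs)) \<and>
    (\<forall>ys\<in>tuples Y (fun_ar L F). \<forall>zs\<in>tuples Y (fun_ar L F). dY (fH F ys) (fH F zs) \<le> fun_lip L F * tuple_dist dY ys zs)"
    by metis
  have "\<exists>H. (\<forall>ys\<in>tuples Y (rel_ar L R). H ys \<in> {- 1..1}) \<and> (\<forall>cs. length cs = rel_ar L R \<longrightarrow> H (map j cs) = GR R cs) \<and>
    (\<forall>ys\<in>tuples Y (rel_ar L R). \<forall>zs\<in>tuples Y (rel_ar L R). dist (H ys) (H zs) \<le> rel_lip L R * tuple_dist dY ys zs)"
    if R: "R \<in> rel_syms L" for R
  proof -
    let ?\<phi> = "Rel R (map Var [0..<rel_ar L R])"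
    have wf: "wf_fm L ?\<phi>" using R by (simp add: list_all_iff)
    interpret I: Submetric UNIV dist "{- 1..1 :: real}" by unfold_locales simp
    have compl: "I.sub.mcomplete"
      by (rule I.closedin_mcomplete_imp_mcomplete) (simp_all add: complete_UNIV)
    have lip: "dist (GR R cs) (GR R ds) \<le> rel_lip L R * tuple_dist dY (map j cs) (map j ds)"
      if "length cs = rel_ar L R" "length ds = rel_ar L R" for cs ds
      using p_Rel[OF wf wf, of "\<lambda>i. cs ! i" "\<lambda>i. ds ! i"] that
      by (simp add: GR_def td[OF that] term_dist_Var dist_real_def)
    have bound: "GR R cs \<in> {- 1..1}" if "length cs = rel_ar L R" for cs
    proof -
      have "\<bar>inst M ?\<phi> v I\<bar> \<le> 1" for v :: "nat \<Rightarrow> ('c, 'f, 'r, 'k) wit" and I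
        unfolding inst_def using fm_val_bounded[OF wf, of "\<lambda>x. retract M (I (v x))"] retract_in by simp
      then have "\<bar>GR R cs\<bar> \<le> p (\<lambda>_. 1)"
        unfolding GR_def using wf by (intro S.p_abs_le inst_in_UNIV S.one)
      then show ?thesis using S.p_one by (simp add: abs_le_iff)
    qed
    show ?thesis
    proof (rule lipschitz_extends_from_dense[OF Y(1) j dense I.sub.Metric_space_axioms compl bound lip
          rel_lip_nonneg[OF R]])
      fix H assume "\<And>ys. ys \<in> tuples Y (rel_ar L R) \<Longrightarrow> H ys \<in> {- 1..1}"
        "\<And>cs. length cs = rel_ar L R \<Longrightarrow> H (map j cs) = GR R cs"
        "\<And>ys zs. ys \<in> tuples Y (rel_ar L R) \<Longrightarrow> zs \<in> tuples Y (rel_ar L R) \<Longrightarrow>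
          dist (H ys) (H zs) \<le> rel_lip L R * tuple_dist dY ys zs"
      then show ?thesis by (intro exI[of _ H] conjI ballI allI impI) simp_all
    qed
  qed
  then obtain rH where rH: "\<And>R. R \<in> rel_syms L \<Longrightarrow> (\<forall>ys\<in>tuples Y (rel_ar L R). rH R ys \<in> {- 1..1}) \<and>
    (\<forall>cs. length cs = rel_ar L R \<longrightarrow> rH R (map j cs) = GR R cs) \<and>
    (\<forall>ys\<in>tuples Y (rel_ar L R). \<forall>zs\<in>tuples Y (rel_ar L R). dist (rH R ys) (rH R zs) \<le> rel_lip L R * tuple_dist dY ys zs)"
    by metis
  let ?N = "\<lparr>carr = Y, dst = dY, cst_of = \<lambda>c. j (denotation (Cst c) (\<lambda>_. Ext undefined)), fun_of = fH, rel_of = rH\<rparr>"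
  have "is_structure L ?N"
    unfolding is_structure_def
  proof (intro conjI ballI)
    show "\<bar>rel_of ?N R xs\<bar> \<le> 1" if "R \<in> rel_syms L" "xs \<in> tuples (carr ?N) (rel_ar L R)" for R xs
      using rH that by (auto simp: abs_le_iff)
    show "\<bar>rel_of ?N R xs - rel_of ?N R ys\<bar> \<le> rel_lip L R * tuple_dist (dst ?N) xs ys"
      if "R \<in> rel_syms L" "xs \<in> tuples (carr ?N) (rel_ar L R)" "ys \<in> tuples (carr ?N) (rel_ar L R)" for R xs ys
      using rH that by (simp add: dist_real_def)
  qed (use Y le_1 j fH in auto)
  then have "witness_model L M p ?N j"
    using j dY dense fH rH
    by (intro witness_model.intro witnessed_state_axioms witness_model_axioms.intro)
      (auto simp: G_def GR_def)
  then show ?thesis by blast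
qed

end

context witness_model begin

sublocale N: struct L N
  by unfold_locales (rule lang, rule N_structure)

lemma j_eq: "wit_dist c d = 0 \<Longrightarrow> j c = j d"
  using N.zero[OF j_in j_in] by (simp add: j_dst)

lemma j_denotation_cong: "wf_tm L s \<Longrightarrow> wf_tm L t \<Longrightarrow> term_dist s v t w = 0 \<Longrightarrow> j (denotation s v) = j (denotation t w)"
  by (rule j_eq) (simp add: wit_dist_denotation)

text \<open>
  Replacing the arguments of a function symbol by their denotations changes the term by distance \<open>0\<close>,
  by \<open>term_dist_App\<close>.
\<close>

lemma tm_val_j: "wf_tm L t \<Longrightarrow> tm_val N (j \<circ> v) t = j (denotation t v)"
proof (induction t)
  case (Var x)
  have "wit_dist (v x) (denotation (Var x) v) = 0"
    using denotation[of "Var x" v] by (simp add: wit_dist_def term_dist_Var_left[of x v])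
  from j_eq[OF this] show ?case by simp
next
  case (Cst c)
  have "term_dist (Cst c) (\<lambda>_. Ext undefined) (Cst c) v = term_dist (Cst c) v (Cst c) v"
    by (simp add: term_dist_def tm_inst_def)
  then have "term_dist (Cst c) (\<lambda>_. Ext undefined) (Cst c) v = 0" using term_dist_refl[OF Cst] by simp
  from j_denotation_cong[OF Cst Cst this] show ?case using N_cst Cst by simp
next
  case (App F ts)
  let ?ds = "map (\<lambda>t. denotation t v) ts"
  let ?n = "fun_ar L F"
  let ?G = "App F (map Var [0..<?n])"
  have F: "F \<in> fun_syms L" "length ts = ?n" "list_all (wf_tm L) ts" using App.prems by auto
  have wf: "wf_tm L ?G" using F by (simp add: list_all_iff)
  have "tm_val N (j \<circ> v) t = j (denotation t v)" if "t \<in> set ts" for t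
    using App.IH[OF that] F(3) that by (simp only: list_all_iff)
  then have "map (tm_val N (j \<circ> v)) ts = map (\<lambda>t. j (denotation t v)) ts" by (rule map_cong[OF HOL.refl])
  also have "\<dots> = map j ?ds" by simp
  finally have "tm_val N (j \<circ> v) (App F ts) = fun_of N F (map j ?ds)" by (simp only: tm_val.simps)
  also have "\<dots> = j (denotation ?G (\<lambda>i. ?ds ! i))" using F by (intro N_fun) auto
  also have "\<dots> = j (denotation (App F ts) v)"
  proof (rule j_denotation_cong[OF wf App.prems])
    have "term_dist (Var i) (\<lambda>i. ?ds ! i) (ts ! i) v = 0" if "i < ?n" for i
    proof -
      have "wf_tm L (ts ! i)" using F that by (simp add: list_all_length)
      from denotation[OF this, of v] have "term_dist (Var 0) (\<lambda>_. denotation (ts ! i) v) (ts ! i) v = 0" by (metis term_dist_sym)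
      then show ?thesis unfolding term_dist_Var_left[of i "\<lambda>i. ?ds ! i"] using that F by simp
    qed
    then have "term_dist ?G (\<lambda>i. ?ds ! i) (App F ts) v \<le> 0"
      using term_dist_App[OF wf App.prems, of "\<lambda>i. ?ds ! i" v] by simp
    then show "term_dist ?G (\<lambda>i. ?ds ! i) (App F ts) v = 0"
      using term_dist_nonneg[OF wf App.prems] by (meson antisym)
  qed
  finally show ?case .
qed

text \<open>
  The quantifier step of the truth lemma. The witness of the infimum gives one inequality. For the
  other, the infimum bounds the values at all witnesses, and these are dense while the formula is
  Lipschitz.
\<close>

lemma fm_val_InfF_j:
  assumes wf: "wf_fm L \<phi>" and IH: "\<And>v. fm_val N \<phi> (j \<circ> v) = p (inst M \<phi> v)"
  shows "fm_val N (InfF x \<phi>) (j \<circ> v) = p (inst M (InfF x \<phi>) v)"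
proof (rule antisym)
  have upd: "(j \<circ> v)(x := j c) = j \<circ> v(x := c)" for c by auto
  have glb: "c \<le> fm_val N (InfF x \<phi>) (j \<circ> v) \<longleftrightarrow> (\<forall>a\<in>carr N. c \<le> fm_val N \<phi> ((j \<circ> v)(x := a)))" for c
    unfolding fm_val.simps using wf j_in by (intro N.le_INF_iff_bounded) auto
  obtain m where m: "\<And>y. y \<in> fv \<phi> \<Longrightarrow> y < m"
    using finite_fv[of \<phi>] by (meson finite_nat_set_iff_bounded)
  let ?cs = "map v [0..<m]"
  let ?u = "wit_asg \<phi> x ?cs"
  have u: "y \<in> fv \<phi> \<Longrightarrow> ?u y = (v(x := Wit \<phi> x ?cs)) y" for y using m by (auto simp: wit_asg_def)
  have "fm_val N (InfF x \<phi>) (j \<circ> v) \<le> fm_val N \<phi> ((j \<circ> v)(x := j (Wit \<phi> x ?cs)))"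
    using glb j_in by blast
  also have "\<dots> = p (inst M \<phi> (v(x := Wit \<phi> x ?cs)))" unfolding upd IH ..
  also have "inst M \<phi> (v(x := Wit \<phi> x ?cs)) = inst M \<phi> ?u"
    by (rule inst_cong) (use u in simp)
  also have "p (inst M \<phi> ?u) \<le> p (inst M (InfF x \<phi>) ?u)"
    using p_witnessed wf by (simp add: witnessed_def)
  also have "inst M (InfF x \<phi>) ?u = inst M (InfF x \<phi>) v"
    by (rule inst_cong) (use u in auto)
  finally show "fm_val N (InfF x \<phi>) (j \<circ> v) \<le> p (inst M (InfF x \<phi>) v)" .
  show "p (inst M (InfF x \<phi>) v) \<le> fm_val N (InfF x \<phi>) (j \<circ> v)"
    unfolding glb
  proof
    fix a assume a: "a \<in> carr N"
    show "p (inst M (InfF x \<phi>) v) \<le> fm_val N \<phi> ((j \<circ> v)(x := a))"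
    proof (rule field_le_epsilon)
      fix e :: real assume e: "0 < e"
      let ?K = "\<bar>fm_lip L \<phi>\<bar> + 1"
      have d: "0 < e / ?K" using e by simp
      obtain c where c: "dst N (j c) a < e / ?K" using j_dense[OF a d] by blast
      have "p (inst M (InfF x \<phi>) v) \<le> p (inst M \<phi> (v(x := c)))"
        using wf by (intro S.p_mono inst_in_UNIV inst_InfF_le) auto
      also have "\<dots> = fm_val N \<phi> ((j \<circ> v)(x := j c))" unfolding upd IH ..
      finally have 1: "p (inst M (InfF x \<phi>) v) \<le> fm_val N \<phi> ((j \<circ> v)(x := j c))" .
      have "\<bar>fm_val N \<phi> ((j \<circ> v)(x := j c)) - fm_val N \<phi> ((j \<circ> v)(x := a))\<bar> \<le> fm_lip L \<phi> * (e / ?K)"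
        using wf a j_in c d by (intro N.fm_val_lipschitz) (auto intro: less_imp_le)
      also have "\<dots> \<le> ?K * (e / ?K)" using d by (intro mult_right_mono) auto
      also have "\<dots> = e" by simp
      finally show "p (inst M (InfF x \<phi>) v) \<le> fm_val N \<phi> ((j \<circ> v)(x := a)) + e" using 1 by linarith
    qed
  qed
qed

text \<open>
  The truth lemma of the Henkin construction. A supremum is treated as a negated infimum.
\<close>

lemma fm_val_j: "wf_fm L \<phi> \<Longrightarrow> fm_val N \<phi> (j \<circ> v) = p (inst M \<phi> v)"
proof (induction \<phi> arbitrary: v)
  case (Const r)
  then show ?case by (simp add: inst_Const S.p_const)
next
  case (Dist s t)
  then have "fm_val N (Dist s t) (j \<circ> v) = wit_dist (denotation s v) (denotation t v)"
    unfolding fm_val.simps by (simp only: tm_val_j wf_fm.simps j_dst)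
  also have "\<dots> = term_dist s v t v" using Dist by (intro wit_dist_denotation) auto
  finally show ?case by (simp only: term_dist_def inst_Dist)
next
  case (Rel R ts)
  let ?ds = "map (\<lambda>t. denotation t v) ts"
  let ?n = "rel_ar L R"
  let ?G = "Rel R (map Var [0..<?n])"
  have R: "R \<in> rel_syms L" "length ts = ?n" "list_all (wf_tm L) ts" using Rel by auto
  have wf: "wf_fm L ?G" using R by (simp add: list_all_iff)
  have "tm_val N (j \<circ> v) t = j (denotation t v)" if "t \<in> set ts" for t
    using tm_val_j[of t v] R(3) that by (simp only: list_all_iff)
  then have "map (tm_val N (j \<circ> v)) ts = map (\<lambda>t. j (denotation t v)) ts" by (rule map_cong[OF HOL.refl])
  also have "\<dots> = map j ?ds" by simp
  finally have "fm_val N (Rel R ts) (j \<circ> v) = rel_of N R (map j ?ds)" by (simp only: fm_val.simps)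
  also have "\<dots> = p (inst M ?G (\<lambda>i. ?ds ! i))" using R by (intro N_rel) auto
  also have "\<dots> = p (inst M (Rel R ts) v)"
  proof -
    have "term_dist (Var i) (\<lambda>i. ?ds ! i) (ts ! i) v = 0" if "i < ?n" for i
    proof -
      have "wf_tm L (ts ! i)" using R that by (simp add: list_all_length)
      from denotation[OF this, of v] have "term_dist (Var 0) (\<lambda>_. denotation (ts ! i) v) (ts ! i) v = 0" by (metis term_dist_sym)
      then show ?thesis unfolding term_dist_Var_left[of i "\<lambda>i. ?ds ! i"] using that R by simp
    qed
    then show ?thesis using p_Rel[OF wf Rel, of "\<lambda>i. ?ds ! i" v] by simp
  qed
  finally show ?case .
next
  case (Scale r \<phi>)
  then show ?case by (simp add: inst_Scale S.p_scale inst_in_UNIV)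
next
  case (Add \<phi> \<psi>)
  then show ?case by (simp add: inst_Add S.p_add inst_in_UNIV)
next
  case (InfF x \<phi>)
  then have wf: "wf_fm L \<phi>" by simp
  show ?case by (rule fm_val_InfF_j[OF wf InfF.IH[OF wf]])
next
  case (SupF x \<phi>)
  let ?\<psi> = "Scale (- 1) \<phi>"
  have wf: "wf_fm L \<phi>" using SupF by simp
  have "fm_val N ?\<psi> (j \<circ> v) = p (inst M ?\<psi> v)" for v
    unfolding fm_val.simps SupF.IH[OF wf] inst_Scale by (rule S.p_scale[OF inst_in_UNIV[OF wf], symmetric])
  then have "fm_val N (InfF x ?\<psi>) (j \<circ> v) = p (inst M (InfF x ?\<psi>) v)"
    using wf by (intro fm_val_InfF_j) (simp_all only: wf_fm.simps)
  moreover have "inst M (SupF x \<phi>) v = (\<lambda>I. - inst M (InfF x ?\<psi>) v I)"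
    unfolding inst_def fm_val_SupF ..
  moreover have "p (\<lambda>I. - inst M (InfF x ?\<psi>) v I) = - p (inst M (InfF x ?\<psi>) v)"
    using wf by (intro S.p_uminus inst_in_UNIV) simp
  ultimately show ?case unfolding fm_val_SupF by simp
qed

lemma sentence_value:
  assumes "\<sigma> \<in> sentences L" "range v \<subseteq> carr N" "range w \<subseteq> carr M"
  shows "fm_val N \<sigma> v = fm_val M \<sigma> w"
proof -
  have \<sigma>: "wf_fm L \<sigma>" "fv \<sigma> = {}" using assms(1) by (auto simp: sentences_def)
  let ?v = "\<lambda>_ :: nat. Ext undefined"
  have "fm_val N \<sigma> v = fm_val N \<sigma> (j \<circ> ?v)" by (rule fm_val_cong) (simp add: \<sigma>)
  also have "\<dots> = p (inst M \<sigma> ?v)" by (rule fm_val_j[OF \<sigma>(1)])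
  also have "inst M \<sigma> ?v = (\<lambda>_. fm_val M \<sigma> w)"
    unfolding inst_def by (intro ext fm_val_cong) (simp add: \<sigma>)
  also have "p \<dots> = fm_val M \<sigma> w" by (rule S.p_const)
  finally show ?thesis .
qed

end

section \<open>Types realized in the model of the witnesses\<close>

text \<open>
  A complete theory determines the values of sentences, so inequalities between formulas pass from
  one model to all others.
\<close>

lemma entails_if_le_in_model:
  fixes M :: "('c, 'f, 'r, 'm) lstruct"
  assumes lang: "is_language L" and T: "complete_theory TYPE('m) L T" and M: "is_model L T M"
    and wf: "wf_fm L \<phi>" "wf_fm L \<psi>"
    and le: "\<And>w. range w \<subseteq> carr M \<Longrightarrow> fm_val M \<phi> w \<le> fm_val M \<psi> w"
  shows "entails TYPE('m) L T (\<phi>, \<psi>)"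
  unfolding entails_def
proof (intro allI impI)
  fix N :: "('c, 'f, 'r, 'm) lstruct" assume N: "is_model L T N"
  have st: "struct L M" "struct L N" using M N lang by (simp_all add: struct_def is_model_def)
  have eq: "fm_val N \<sigma> v = fm_val M \<sigma> w"
    if \<sigma>: "\<sigma> \<in> sentences L" "range v \<subseteq> carr N" "range w \<subseteq> carr M" for \<sigma> v w
  proof -
    obtain r where "entails_eq TYPE('m) L T \<sigma> (Const r)"
      using T \<sigma>(1) unfolding complete_theory_def by blast
    then have "fm_val K \<sigma> u = r" if "is_model L T K" "range u \<subseteq> carr K" for K :: "('c, 'f, 'r, 'm) lstruct" and u
      using that by (fastforce simp: entails_eq_def entails_def holds_def intro: antisym)
    then show ?thesis using M N \<sigma> by simp
  qed
  have "0 \<le> fm_val N (Add \<psi> (Scale (- 1) \<phi>)) v" if "range v \<subseteq> carr N" for v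
    using le that wf by (intro lower_bound_transfers[OF st(2,1) eq]) auto
  then show "holds N (\<phi>, \<psi>)" by (simp add: holds_def)
qed

lemma entails_eq_iff:
  fixes U :: "'m itself"
  shows "entails_eq U L T \<phi> \<psi> \<longleftrightarrow> (\<forall>M :: ('c, 'f, 'r, 'm) lstruct. is_model L T M \<longrightarrow>
    (\<forall>v. range v \<subseteq> carr M \<longrightarrow> fm_val M \<phi> v = fm_val M \<psi> v))"
  unfolding entails_eq_def entails_def holds_def fst_conv snd_conv order_eq_iff[where 'a = real] by blast

lemma fm_class_eq:
  assumes "entails_eq U L T \<phi> \<psi>" "\<phi> \<in> formulas L n" "\<psi> \<in> formulas L n"
  shows "fm_class U L T n \<phi> = fm_class U L T n \<psi>"
proof -
  have "entails_eq U L T \<phi> \<theta> \<longleftrightarrow> entails_eq U L T \<psi> \<theta>" for \<theta>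
    using assms(1) by (simp add: entails_eq_iff)
  then show ?thesis using assms unfolding fm_class_def fm_equiv_def by auto
qed

lemma n_types_eqI:
  assumes "q1 \<in> n_types U L T n" "q2 \<in> n_types U L T n"
    and "\<And>\<phi>. \<phi> \<in> formulas L n \<Longrightarrow> q1 (fm_class U L T n \<phi>) = q2 (fm_class U L T n \<phi>)"
  shows "q1 = q2"
proof (rule extensionalityI)
  show "q1 \<in> extensional (D_space U L T n)" "q2 \<in> extensional (D_space U L T n)"
    using assms(1,2) by (auto simp: n_types_def)
  show "q1 X = q2 X" if "X \<in> D_space U L T n" for X
    using that assms(3) unfolding D_space_def fm_class_def by (auto elim!: quotientE)
qed

text \<open>
  The joint type, over \<open>M\<close>, of a family of points in a structure that agrees with \<open>M\<close> on sentences.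
  The proof consists in showing that the value depends on the function defined by a formula and not
  on the formula, which holds by transfer of lower bounds.
\<close>

lemma type_state_of_tuple:
  fixes M :: "('c, 'f, 'r, 'a) lstruct" and N :: "('c, 'f, 'r, 'u) lstruct" and b :: "'i \<Rightarrow> 'u"
  assumes M: "struct L M" and N: "struct L N"
    and eq: "\<And>\<sigma> v w. \<sigma> \<in> sentences L \<Longrightarrow> range v \<subseteq> carr N \<Longrightarrow> range w \<subseteq> carr M \<Longrightarrow>
      fm_val N \<sigma> v = fm_val M \<sigma> w"
    and b: "range b \<subseteq> carr N"
  obtains P where "P \<in> states (inst_space L M UNIV)"
    "\<And>\<phi> v. wf_fm L \<phi> \<Longrightarrow> P (inst M \<phi> v) = fm_val N \<phi> (b \<circ> v)"
proof -
  interpret M: struct L M by (rule M)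
  interpret N: struct L N by (rule N)
  let ?E = "inst_space L M (UNIV :: 'i set)"
  have nonneg: "0 \<le> fm_val N \<phi> (b \<circ> v)" if wf: "wf_fm L \<phi>" and pos: "\<And>I. 0 \<le> inst M \<phi> v I" for \<phi> v
  proof -
    obtain u and f :: "nat \<Rightarrow> nat" where u: "\<And>x. x \<in> fv \<phi> \<Longrightarrow> u (f x) = v x"
      and inj: "inj_on u (fv (ren \<phi> f))" using identify_variables[of \<phi> v] by metis
    have "fm_val N \<phi> (b \<circ> v) = fm_val N (ren \<phi> f) (b \<circ> u)"
      unfolding fm_val_ren by (rule fm_val_cong) (simp add: u)
    also have "0 \<le> \<dots>"
    proof (rule lower_bound_transfers[OF N M eq])
      fix w :: "nat \<Rightarrow> 'a" assume w: "range w \<subseteq> carr M"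
      define I where "I i = w (inv_into (fv (ren \<phi> f)) u i)" for i
      have "inst M \<phi> v = inst M (ren \<phi> f) u" unfolding inst_ren by (rule inst_cong) (simp add: u)
      moreover have "inst M (ren \<phi> f) u I = fm_val M (ren \<phi> f) w"
        unfolding inst_def
      proof (rule fm_val_cong)
        fix x assume "x \<in> fv (ren \<phi> f)"
        then have "I (u x) = w x" using inj by (simp add: I_def)
        then show "retract M (I (u x)) = w x" using w by (auto intro: M.retract_id)
      qed
      ultimately show "0 \<le> fm_val M (ren \<phi> f) w" using pos[of I] by simp
    qed (use b wf wf_ren in auto)
    finally show ?thesis .
  qed
  have le: "fm_val N \<phi> (b \<circ> v) \<le> fm_val N \<psi> (b \<circ> w)"
    if wf: "wf_fm L \<phi>" "wf_fm L \<psi>" and le: "\<And>I. inst M \<phi> v I \<le> inst M \<psi> w I" for \<phi> \<psi> v w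
  proof -
    obtain u and f g :: "nat \<Rightarrow> nat" where u: "u \<circ> f = v" "u \<circ> g = w" by (rule merge_assignments[of v w])
    have "0 \<le> fm_val N (Add (ren \<psi> g) (Scale (- 1) (ren \<phi> f))) (b \<circ> u)"
      using wf le by (intro nonneg) (auto simp: wf_ren inst_Add inst_Scale inst_ren u)
    then show ?thesis by (simp add: fm_val_ren u comp_assoc)
  qed
  define P where "P g = (if g \<in> ?E then THE r. \<exists>\<phi> v. wf_fm L \<phi> \<and> g = inst M \<phi> v \<and> r = fm_val N \<phi> (b \<circ> v) else 0)" for g
  have P: "P (inst M \<phi> v) = fm_val N \<phi> (b \<circ> v)" if wf: "wf_fm L \<phi>" for \<phi> v
  proof -
    have "(THE r. \<exists>\<psi> w. wf_fm L \<psi> \<and> inst M \<phi> v = inst M \<psi> w \<and> r = fm_val N \<psi> (b \<circ> w)) = fm_val N \<phi> (b \<circ> v)"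
    proof (rule the_equality)
      fix r assume "\<exists>\<psi> w. wf_fm L \<psi> \<and> inst M \<phi> v = inst M \<psi> w \<and> r = fm_val N \<psi> (b \<circ> w)"
      then obtain \<psi> w where "wf_fm L \<psi>" "inst M \<phi> v = inst M \<psi> w" "r = fm_val N \<psi> (b \<circ> w)" by blast
      then show "r = fm_val N \<phi> (b \<circ> v)" using wf le[of \<phi> \<psi> v w] le[of \<psi> \<phi> w v] by simp
    qed (use wf in blast)
    then show ?thesis using inst_in_UNIV[OF wf, of M v] by (simp add: P_def)
  qed
  have "P \<in> states ?E"
  proof (rule statesI)
    show "P g = 0" if "g \<notin> ?E" for g using that by (simp add: P_def)
  next
    fix g h assume "g \<in> ?E" "h \<in> ?E"
    then obtain \<phi> v \<psi> w where g: "g = inst M \<phi> v" "wf_fm L \<phi>" and h: "h = inst M \<psi> w" "wf_fm L \<psi>"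
      by (metis inst_spaceE)
    obtain u and f f' :: "nat \<Rightarrow> nat" where u: "u \<circ> f = v" "u \<circ> f' = w" by (rule merge_assignments[of v w])
    have "(\<lambda>I. g I + h I) = inst M (Add (ren \<phi> f) (ren \<psi> f')) u"
      by (simp add: inst_Add inst_ren u g(1) h(1))
    then have "P (\<lambda>I. g I + h I) = fm_val N (Add (ren \<phi> f) (ren \<psi> f')) (b \<circ> u)"
      using g h by (simp only: P wf_fm.simps wf_ren)
    then show "P (\<lambda>I. g I + h I) = P g + P h"
      using g h by (simp add: fm_val_ren u comp_assoc P)
  next
    fix s g assume "g \<in> ?E"
    then obtain \<phi> v where g: "g = inst M \<phi> v" "wf_fm L \<phi>" by (rule inst_spaceE)
    then show "P (\<lambda>I. s * g I) = s * P g"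
      using P[of "Scale s \<phi>" v] by (simp add: inst_Scale P)
  next
    fix g assume "g \<in> ?E" and pos: "\<And>I. 0 \<le> g I"
    then obtain \<phi> v where g: "g = inst M \<phi> v" "wf_fm L \<phi>" by (metis inst_spaceE)
    then show "0 \<le> P g" using nonneg[OF g(2), of v] pos by (simp add: P)
  next
    show "P (\<lambda>_. 1) = 1" using P[of "Const 1" undefined] by (simp add: inst_Const)
  qed
  then show ?thesis using P by (rule that)
qed

lemma inst_space_initial_variables:
  fixes e :: "nat \<Rightarrow> 'i"
  assumes "g \<in> inst_space L M (e ` {..<n})"
  obtains \<phi> where "\<phi> \<in> formulas L n" "g = inst M \<phi> e"
proof -
  obtain \<phi> v where g: "g = inst M \<phi> v" "wf_fm L \<phi>" "v ` fv \<phi> \<subseteq> e ` {..<n}"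
    using assms by (rule inst_spaceE)
  let ?f = "inv_into {..<n} e \<circ> v"
  have f: "?f x \<in> {..<n}" "e (?f x) = v x" if "x \<in> fv \<phi>" for x
  proof -
    have "v x \<in> e ` {..<n}" using g(3) that by blast
    then show "?f x \<in> {..<n}" "e (?f x) = v x"
      by (simp_all only: comp_apply inv_into_into f_inv_into_f)
  qed
  show ?thesis
  proof (rule that[of "ren \<phi> ?f"])
    show "g = inst M (ren \<phi> ?f) e"
      unfolding inst_ren g(1) by (rule inst_cong) (use f in simp)
    have "fv (ren \<phi> ?f) \<subseteq> {..<n}" using fv_ren[of \<phi> ?f] f(1) by blast
    then show "ren \<phi> ?f \<in> formulas L n" using wf_ren[OF g(2)] unfolding formulas_def by blast
  qed
qed

text \<open>
  Types are functionals on classes of formulas, and states are functionals on the functions that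
  formulas define. For a complete theory these are the same, as two formulas are equivalent exactly
  when they define the same function on \<open>M\<close>.
\<close>

lemma state_of_n_type:
  fixes M :: "('c, 'f, 'r, 'm) lstruct" and e :: "nat \<Rightarrow> 'i"
  assumes lang: "is_language L" and T: "complete_theory TYPE('m) L T" and M: "is_model L T M"
    and e: "inj e" and q: "q \<in> n_types TYPE('m) L T n"
  obtains s where "s \<in> states (inst_space L M (e ` {..<n}))"
    "\<And>\<phi>. \<phi> \<in> formulas L n \<Longrightarrow> s (inst M \<phi> e) = q (fm_class TYPE('m) L T n \<phi>)"
proof -
  interpret struct L M using lang M by (simp add: struct_def is_model_def)
  let ?A = "inst_space L M (e ` {..<n})"
  let ?cl = "fm_class TYPE('m) L T n"
  have rep: "\<exists>\<phi>\<in>formulas L n. g = inst M \<phi> e" if "g \<in> ?A" for g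
    using that by (rule inst_space_initial_variables) blast
  have in_A: "inst M \<phi> e \<in> ?A" if "\<phi> \<in> formulas L n" for \<phi>
    using that by (intro inst_in_space) (auto simp: formulas_def)
  have val: "\<exists>I. \<forall>\<phi>. fm_val M \<phi> w = inst M \<phi> e I" if w: "range w \<subseteq> carr M" for w :: "nat \<Rightarrow> 'm"
  proof (intro exI allI)
    fix \<phi>
    have "retract M (w (inv e (e x))) = w x" for x using e w by (simp add: retract_id range_subsetD)
    then show "fm_val M \<phi> w = inst M \<phi> e (\<lambda>i. w (inv e i))" unfolding inst_def by simp
  qed
  have ent: "entails TYPE('m) L T (\<phi>, \<psi>)"
    if "\<phi> \<in> formulas L n" "\<psi> \<in> formulas L n" "\<And>I. inst M \<phi> e I \<le> inst M \<psi> e I" for \<phi> \<psi>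
  proof (rule entails_if_le_in_model[OF lang T M])
    show "fm_val M \<phi> w \<le> fm_val M \<psi> w" if "range w \<subseteq> carr M" for w
      using val[OF that] \<open>\<And>I. inst M \<phi> e I \<le> inst M \<psi> e I\<close> by metis
  qed (use that in \<open>auto simp: formulas_def\<close>)
  have cl: "?cl \<phi> = ?cl \<psi>" if "\<phi> \<in> formulas L n" "\<psi> \<in> formulas L n" "inst M \<phi> e = inst M \<psi> e" for \<phi> \<psi>
    using that ent[of \<phi> \<psi>] ent[of \<psi> \<phi>] by (intro fm_class_eq) (auto simp: entails_eq_def)
  obtain f where f: "\<And>g. g \<in> ?A \<Longrightarrow> f g \<in> formulas L n \<and> g = inst M (f g) e" using rep by metis
  define s where "s g = (if g \<in> ?A then q (?cl (f g)) else 0)" for g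
  have s: "s (inst M \<phi> e) = q (?cl \<phi>)" if \<phi>: "\<phi> \<in> formulas L n" for \<phi>
  proof -
    have "f (inst M \<phi> e) \<in> formulas L n" "inst M (f (inst M \<phi> e)) e = inst M \<phi> e"
      using f[OF in_A[OF \<phi>]] by auto
    then have "?cl (f (inst M \<phi> e)) = ?cl \<phi>" using \<phi> by (intro cl)
    then show ?thesis using in_A[OF \<phi>] by (simp add: s_def)
  qed
  have closed: "Add \<phi> \<psi> \<in> formulas L n" "Scale r \<phi> \<in> formulas L n" "Const r \<in> formulas L n"
    if "\<phi> \<in> formulas L n" "\<psi> \<in> formulas L n" for \<phi> \<psi> r
    using that by (auto simp: formulas_def)
  have "s \<in> states ?A"
  proof (rule statesI)
    show "s g = 0" if "g \<notin> ?A" for g using that by (simp add: s_def)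
  next
    fix g h assume "g \<in> ?A" "h \<in> ?A"
    then obtain \<phi> \<psi> where \<phi>: "\<phi> \<in> formulas L n" "g = inst M \<phi> e" and \<psi>: "\<psi> \<in> formulas L n" "h = inst M \<psi> e"
      using rep by metis
    have "s (\<lambda>x. g x + h x) = q (?cl (Add \<phi> \<psi>))"
      using s[OF closed(1)[OF \<phi>(1) \<psi>(1)]] \<phi> \<psi> by (simp add: inst_Add)
    then show "s (\<lambda>x. g x + h x) = s g + s h"
      using q \<phi> \<psi> by (simp add: n_types_def s)
  next
    fix r g assume "g \<in> ?A"
    then obtain \<phi> where \<phi>: "\<phi> \<in> formulas L n" "g = inst M \<phi> e" using rep by metis
    have "s (\<lambda>x. r * g x) = q (?cl (Scale r \<phi>))"
      using s[OF closed(2)[OF \<phi>(1) \<phi>(1)]] \<phi> by (simp add: inst_Scale)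
    then show "s (\<lambda>x. r * g x) = r * s g" using q \<phi> by (simp add: n_types_def s)
  next
    fix g assume "g \<in> ?A" and pos: "\<And>x. 0 \<le> g x"
    then obtain \<phi> where \<phi>: "\<phi> \<in> formulas L n" "g = inst M \<phi> e" using rep by metis
    have "entails TYPE('m) L T (Const 0, \<phi>)"
      using \<phi> pos by (intro ent closed(3)[OF \<phi>(1) \<phi>(1)]) (auto simp: inst_Const)
    then show "0 \<le> s g" using q \<phi> by (simp add: n_types_def s)
  next
    have "Const 1 \<in> formulas L n" by (simp add: formulas_def)
    from s[OF this] show "s (\<lambda>_. 1) = 1" using q by (simp add: n_types_def inst_Const)
  qed
  then show ?thesis using s by (rule that)
qed

context witness_model begin

text \<open>
  Indices are the variables of the type, tagged by \<open>Inl\<close>, and the witnesses, tagged by \<open>Inr\<close>. The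
  decomposition of the type of \<open>a\<close> is lifted to the joint type \<open>P\<close> of \<open>a\<close> and the witnesses. Both
  lifted states restrict to the extreme state \<open>p\<close> on witnesses, and both find \<open>a\<close> close to suitable
  witnesses \<open>c\<close>, up to the factors \<open>1 / (1 - t)\<close> and \<open>1 / t\<close>.
\<close>

lemma realized_type_indecomposable:
  fixes q1 q2 :: "('c, 'f, 'r) fm set \<Rightarrow> real"
  assumes T: "complete_theory TYPE('a) L T" and M: "is_model L T M"
    and extreme: "extreme_state (inst_space L M UNIV) p"
    and q: "q1 \<in> n_types TYPE('a) L T n" "q2 \<in> n_types TYPE('a) L T n" and t: "0 < t" "t < 1"
    and real: "realizes TYPE('a) L T n N a (\<lambda>X. (1 - t) * q1 X + t * q2 X)"
  shows "q1 = q2"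
proof -
  let ?E = "inst_space L M (UNIV :: (nat + ('c, 'f, 'r, 'k) wit) set)"
  let ?x = "Inl :: nat \<Rightarrow> nat + ('c, 'f, 'r, 'k) wit"
  let ?y = "Inr :: ('c, 'f, 'r, 'k) wit \<Rightarrow> nat + ('c, 'f, 'r, 'k) wit"
  let ?A = "inst_space L M (?x ` {..<n})"
  let ?cl = "fm_class TYPE('a) L T n"
  have a: "a i \<in> carr N" if "i < n" for i using real that by (simp add: realizes_def)
  define b where "b z = (case z of Inl i \<Rightarrow> if i < n then a i else j (Ext undefined) | Inr c \<Rightarrow> j c)" for z
  have b: "range b \<subseteq> carr N" using a j_in by (auto simp: b_def split: sum.splits)
  obtain P where P: "P \<in> states ?E" and P_inst: "\<And>\<phi> v. wf_fm L \<phi> \<Longrightarrow> P (inst M \<phi> v) = fm_val N \<phi> (b \<circ> v)"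
    using type_state_of_tuple[OF struct_axioms N.struct_axioms sentence_value b] by metis
  obtain s1 where s1: "s1 \<in> states ?A" "\<And>\<phi>. \<phi> \<in> formulas L n \<Longrightarrow> s1 (inst M \<phi> ?x) = q1 (?cl \<phi>)"
    using state_of_n_type[OF lang T M _ q(1), of ?x] by (metis inj_Inl)
  obtain s2 where s2: "s2 \<in> states ?A" "\<And>\<phi>. \<phi> \<in> formulas L n \<Longrightarrow> s2 (inst M \<phi> ?x) = q2 (?cl \<phi>)"
    using state_of_n_type[OF lang T M _ q(2), of ?x] by (metis inj_Inl)
  have P_A: "P g = (1 - t) * s1 g + t * s2 g" if g: "g \<in> ?A" for g
  proof -
    obtain \<phi> where \<phi>: "\<phi> \<in> formulas L n" "g = inst M \<phi> ?x" using g by (rule inst_space_initial_variables)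
    have "P g = fm_val N \<phi> (b \<circ> ?x)" using \<phi> P_inst by (simp add: formulas_def)
    also have "\<dots> = fm_val N \<phi> a"
      using \<phi>(1) by (intro fm_val_cong) (auto simp: formulas_def b_def)
    also have "\<dots> = (1 - t) * q1 (?cl \<phi>) + t * q2 (?cl \<phi>)"
      using real \<phi>(1) by (simp add: realizes_def)
    finally show ?thesis using s1(2) s2(2) \<phi> by simp
  qed
  obtain r1 r2 where r: "r1 \<in> states ?E" "r2 \<in> states ?E"
    and r_A: "\<And>g. g \<in> ?A \<Longrightarrow> r1 g = s1 g" "\<And>g. g \<in> ?A \<Longrightarrow> r2 g = s2 g"
    and P_eq: "P = (\<lambda>g. (1 - t) * r1 g + t * r2 g)"
  proof (rule convex_decomposition_lifts[OF function_space_inst function_space_inst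
        inst_space_mono[OF subset_UNIV] P s1(1) s2(1) t P_A greatest_lower_bound_in_inst_space])
    fix r1 r2 assume "r1 \<in> states ?E" "r2 \<in> states ?E" "\<And>g. g \<in> ?A \<Longrightarrow> r1 g = s1 g"
      "\<And>g. g \<in> ?A \<Longrightarrow> r2 g = s2 g" "P = (\<lambda>g. (1 - t) * r1 g + t * r2 g)"
    then show thesis by (rule that)
  qed
  \<comment> \<open>restriction of a state to the formulas about witnesses only\<close>
  define res where "res r g = (if g \<in> inst_space L M UNIV then r (\<lambda>I. g (\<lambda>c. I (?y c))) else 0)"
    for r :: "((nat + ('c, 'f, 'r, 'k) wit \<Rightarrow> 'a) \<Rightarrow> real) \<Rightarrow> real" and g
  have lift_inst: "(\<lambda>I. inst M \<phi> v (\<lambda>c. I (?y c))) = inst M \<phi> (?y \<circ> v)" for \<phi> v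
    by (simp add: inst_def)
  have lift_in: "(\<lambda>I. g (\<lambda>c. I (?y c))) \<in> ?E" if g: "g \<in> inst_space L M UNIV" for g
  proof -
    obtain \<phi> v where "g = inst M \<phi> v" "wf_fm L \<phi>" using g by (rule inst_spaceE)
    then show ?thesis using inst_in_UNIV[of L \<phi> M "?y \<circ> v"] by (simp add: lift_inst)
  qed
  have res_inst: "res r (inst M \<phi> v) = r (inst M \<phi> (?y \<circ> v))" if "wf_fm L \<phi>" for r \<phi> v
    by (simp add: res_def lift_inst inst_in_UNIV[OF that])
  have res_state: "res r \<in> states (inst_space L M UNIV)" if "r \<in> states ?E" for r
  proof -
    interpret r: state ?E r using that function_space_inst by (simp add: state_def state_axioms_def)
    show ?thesis
    proof (rule statesI)
      show "res r g = 0" if "g \<notin> inst_space L M UNIV" for g using that by (simp add: res_def)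
      show "res r (\<lambda>x. g x + h x) = res r g + res r h"
        if "g \<in> inst_space L M UNIV" "h \<in> inst_space L M UNIV" for g h
        using that S.add[OF that] r.p_add[OF lift_in lift_in, OF that] by (simp add: res_def)
      show "res r (\<lambda>x. s * g x) = s * res r g" if "g \<in> inst_space L M UNIV" for s g
        using that S.scale[OF that] r.p_scale[OF lift_in, OF that] by (simp add: res_def)
      show "0 \<le> res r g" if "g \<in> inst_space L M UNIV" "\<And>x. 0 \<le> g x" for g
        using that r.p_nonneg[OF lift_in[OF that(1)]] by (simp add: res_def)
      show "res r (\<lambda>_. 1) = 1" using S.one r.p_one by (simp add: res_def)
    qed
  qed
  have "p = (\<lambda>g. (1 - t) * res r1 g + t * res r2 g)"
  proof
    fix g
    show "p g = (1 - t) * res r1 g + t * res r2 g"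
    proof (cases "g \<in> inst_space L M UNIV")
      case True
      then obtain \<phi> v where \<phi>: "g = inst M \<phi> v" "wf_fm L \<phi>" by (rule inst_spaceE)
      have "b \<circ> (?y \<circ> v) = j \<circ> v" by (auto simp: b_def)
      then have "p g = P (inst M \<phi> (?y \<circ> v))" using \<phi> by (simp only: fm_val_j P_inst)
      then show ?thesis using \<phi> by (simp only: P_eq res_inst)
    next
      case False
      then show ?thesis using S.p_outside by (simp add: res_def)
    qed
  qed
  then have "res r1 = p \<and> res r2 = p"
    using extreme res_state[OF r(1)] res_state[OF r(2)] t unfolding extreme_state_def by blast
  then have r_y: "r1 (inst M \<phi> (?y \<circ> c)) = p (inst M \<phi> c)" "r2 (inst M \<phi> (?y \<circ> c)) = p (inst M \<phi> c)"
    if "wf_fm L \<phi>" for \<phi> c using res_inst[OF that] by metis+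
  \<comment> \<open>\<open>w\<close> is the weight of \<open>r\<close> in \<open>P\<close>; the right-hand side is the value of \<open>P\<close> at a Lipschitz bound\<close>
  have close: "w * \<bar>r (inst M \<phi> ?x) - r (inst M \<phi> (?y \<circ> c))\<bar> \<le> \<bar>fm_lip L \<phi>\<bar> * (\<Sum>i<n. dst N (a i) (j (c i)))"
    if r: "r \<in> states ?E" and w: "0 < w" and le: "\<And>g. g \<in> ?E \<Longrightarrow> (\<And>I. 0 \<le> g I) \<Longrightarrow> w * r g \<le> P g"
      and \<phi>: "\<phi> \<in> formulas L n" for r w \<phi> c
  proof -
    interpret r: state ?E r using r function_space_inst by (simp add: state_def state_axioms_def)
    interpret P: state ?E P using P function_space_inst by (simp add: state_def state_axioms_def)
    have wf: "wf_fm L \<phi>" and fv: "fv \<phi> \<subseteq> {..<n}" using \<phi> by (auto simp: formulas_def)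
    define d where "d i = inst M (Dist (Var 0) (Var 1)) (\<lambda>k. if k = 0 then ?x i else ?y (c i))" for i
    have d_in: "d i \<in> ?E" for i unfolding d_def by (rule inst_in_UNIV) simp
    have d_nonneg: "0 \<le> d i I" for i I by (simp add: d_def inst_def)
    have sum_in: "(\<lambda>I. \<Sum>i\<in>{..<n}. d i I) \<in> ?E" by (intro r.sum d_in) auto
    let ?h = "\<lambda>I. \<bar>fm_lip L \<phi>\<bar> * (\<Sum>i\<in>{..<n}. d i I)"
    have h_in: "?h \<in> ?E" by (rule r.scale[OF sum_in])
    have in_E: "inst M \<phi> ?x \<in> ?E" "inst M \<phi> (?y \<circ> c) \<in> ?E" using wf by (auto intro: inst_in_UNIV)
    have "\<bar>inst M \<phi> ?x I - inst M \<phi> (?y \<circ> c) I\<bar> \<le> ?h I" for I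
    proof -
      let ?s = "\<Sum>i\<in>{..<n}. d i I"
      have s: "0 \<le> ?s" by (intro sum_nonneg d_nonneg)
      have "\<bar>inst M \<phi> ?x I - inst M \<phi> (?y \<circ> c) I\<bar> \<le> fm_lip L \<phi> * ?s"
        unfolding inst_def
      proof (rule fm_val_lipschitz[OF wf s])
        fix x assume "x \<in> fv \<phi>"
        then have "x \<in> {..<n}" using fv by blast
        then have "d x I \<le> ?s" using d_nonneg by (intro member_le_sum) auto
        then show "dst M (retract M (I (?x x))) (retract M (I ((?y \<circ> c) x))) \<le> ?s"
          by (simp add: d_def inst_def)
      qed (rule retract_in)+
      also have "\<dots> \<le> ?h I" using s by (intro mult_right_mono) auto
      finally show ?thesis .
    qed
    then have "\<bar>r (\<lambda>I. inst M \<phi> ?x I - inst M \<phi> (?y \<circ> c) I)\<bar> \<le> r ?h"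
      by (intro r.p_abs_le r.diff in_E h_in)
    then have "w * \<bar>r (inst M \<phi> ?x) - r (inst M \<phi> (?y \<circ> c))\<bar> \<le> w * r ?h"
      using w by (simp add: r.p_diff[OF in_E])
    also have "\<dots> \<le> P ?h" by (rule le[OF h_in]) (auto intro!: mult_nonneg_nonneg sum_nonneg d_nonneg)
    also have "P ?h = \<bar>fm_lip L \<phi>\<bar> * (\<Sum>i<n. P (d i))"
      using P.p_scale[OF sum_in] P.p_sum[of "{..<n}" d] d_in by simp
    also have "(\<Sum>i<n. P (d i)) = (\<Sum>i<n. dst N (a i) (j (c i)))"
      unfolding d_def by (intro sum.cong HOL.refl) (simp add: P_inst b_def)
    finally show ?thesis .
  qed
  interpret r1: state ?E r1 using r function_space_inst by (simp add: state_def state_axioms_def)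
  interpret r2: state ?E r2 using r function_space_inst by (simp add: state_def state_axioms_def)
  have le1: "(1 - t) * r1 g \<le> P g" and le2: "t * r2 g \<le> P g" if "g \<in> ?E" "\<And>I. 0 \<le> g I" for g
    using r1.p_nonneg[OF that] r2.p_nonneg[OF that] t by (simp_all add: P_eq)
  show ?thesis
  proof (rule n_types_eqI[OF q])
    fix \<phi> assume \<phi>: "\<phi> \<in> formulas L n"
    then have wf: "wf_fm L \<phi>" by (simp add: formulas_def)
    have "inst M \<phi> ?x \<in> ?A" using \<phi> by (intro inst_in_space) (auto simp: formulas_def)
    then have X: "r1 (inst M \<phi> ?x) = q1 (?cl \<phi>)" "r2 (inst M \<phi> ?x) = q2 (?cl \<phi>)"
      using r_A s1(2)[OF \<phi>] s2(2)[OF \<phi>] by simp_all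
    let ?K = "\<bar>fm_lip L \<phi>\<bar> * real n"
    let ?B = "?K / (1 - t) + ?K / t"
    have pos: "0 < 1 - t" using t by simp
    have B: "0 \<le> ?B" using t by simp
    have "\<bar>q1 (?cl \<phi>) - q2 (?cl \<phi>)\<bar> \<le> 0"
    proof (rule field_le_epsilon)
      fix e :: real assume e: "0 < e"
      define d where "d = e / (?B + 1)"
      have d: "0 < d" using e B by (simp add: d_def)
      have "\<exists>c. i < n \<longrightarrow> dst N (a i) (j c) < d" for i
        using j_dense[OF a d, of i] by (auto simp: N.commute)
      then obtain c where c: "\<And>i. i < n \<Longrightarrow> dst N (a i) (j (c i)) < d" by metis
      let ?p = "p (inst M \<phi> c)"
      have "(\<Sum>i<n. dst N (a i) (j (c i))) \<le> (\<Sum>i<n. d)"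
        using c by (intro sum_mono) (auto intro: less_imp_le)
      then have sum: "\<bar>fm_lip L \<phi>\<bar> * (\<Sum>i<n. dst N (a i) (j (c i))) \<le> ?K * d"
        by (simp add: mult.assoc mult_left_mono)
      have "(1 - t) * \<bar>q1 (?cl \<phi>) - ?p\<bar> \<le> ?K * d"
        using order_trans[OF close[OF r(1) pos le1 \<phi>] sum] unfolding X(1) r_y(1)[OF wf] .
      then have 1: "\<bar>q1 (?cl \<phi>) - ?p\<bar> \<le> ?K / (1 - t) * d" using pos by (simp add: pos_le_divide_eq mult.commute)
      have "t * \<bar>q2 (?cl \<phi>) - ?p\<bar> \<le> ?K * d"
        using order_trans[OF close[OF r(2) t(1) le2 \<phi>] sum] unfolding X(2) r_y(2)[OF wf] .
      then have 2: "\<bar>q2 (?cl \<phi>) - ?p\<bar> \<le> ?K / t * d" using t(1) by (simp add: pos_le_divide_eq mult.commute)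
      have "\<bar>q1 (?cl \<phi>) - q2 (?cl \<phi>)\<bar> \<le> ?B * d"
        using 1 2 unfolding distrib_right by linarith
      also have "\<dots> \<le> (?B + 1) * d" using d by simp
      also have "\<dots> = e" using B by (simp add: d_def)
      finally show "\<bar>q1 (?cl \<phi>) - q2 (?cl \<phi>)\<bar> \<le> 0 + e" by simp
    qed
    then show "q1 (?cl \<phi>) = q2 (?cl \<phi>)" by simp
  qed
qed

lemma witness_model_is_model:
  assumes "affine_theory L T" "is_model L T M"
  shows "is_model L T N"
  unfolding is_model_def
proof (intro conjI ballI)
  fix c assume "c \<in> T"
  then obtain \<phi> \<psi> where c: "c = (\<phi>, \<psi>)" "\<phi> \<in> sentences L" "\<psi> \<in> sentences L" and "holds M c"
    using assms unfolding affine_theory_def is_model_def by blast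
  obtain m where "m \<in> carr M" using nonempty by blast
  then have m: "range (\<lambda>_ :: nat. m) \<subseteq> carr M" by auto
  then have "fm_val M \<phi> (\<lambda>_. m) \<le> fm_val M \<psi> (\<lambda>_. m)" using \<open>holds M c\<close> c(1) by (simp add: holds_def)
  then show "holds N c" using sentence_value[OF c(2) _ m] sentence_value[OF c(3) _ m] c(1) by (simp add: holds_def)
qed (rule N_structure)

text \<open>
  Points at distance \<open>1\<close> are different, so \<open>k \<mapsto> j (Ext k)\<close> is injective.
\<close>

lemma separated_imp_card_le:
  fixes lam :: "'k rel"
  assumes "separated M UNIV p" "Card_order lam"
  shows "lam \<le>o |carr N|"
proof -
  have "inj (\<lambda>k. j (Ext k))"
  proof (rule injI, rule ccontr)
    fix k l :: 'k assume jk: "j (Ext k) = j (Ext l)" and "k \<noteq> l"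
    then have "1 \<le> wit_dist (Ext k) (Ext l)"
      using assms(1) by (simp add: separated_def wit_dist_def term_dist_def inst_Dist tm_inst_def)
    then show False using jk by (metis N.zero j_dst j_in not_one_le_zero)
  qed
  then have "|UNIV :: 'k set| \<le>o |carr N|"
    using j_in by (intro card_of_ordLeqI[of "\<lambda>k. j (Ext k)"]) auto
  moreover have "lam \<le>o |UNIV :: 'k set|"
    using card_of_Field_ordIso[OF assms(2)] card_of_mono1[of "Field lam" UNIV]
    by (meson ordIso_ordLeq_trans ordIso_symmetric subset_UNIV)
  ultimately show ?thesis by (rule ordLeq_transitive[rotated])
qed

end

theorem proposition4p5:
  fixes L :: "('c, 'f, 'r) language"
    and T :: "('c, 'f, 'r) condition set"
    and lam :: "'k rel"
  assumes "is_language L"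
    and "affine_theory L T"
    and "complete_theory TYPE('m) L T"
    and "ample_theory TYPE('m) L T"
    and "Card_order lam" and "cinfinite lam"
  shows "\<exists>M :: ('c, 'f, 'r, ('c, 'f, 'r, 'k) univ) lstruct.
           is_model L T M \<and>
           (\<forall>n. \<forall>p \<in> n_types TYPE('m) L T n - extreme_types TYPE('m) L T n.
              omits TYPE('m) L T n M p) \<and>
           lam \<le>o |carr M|"
proof -
  obtain M :: "('c, 'f, 'r, 'm) lstruct" and a :: "nat \<Rightarrow> 'm" where M: "is_model L T M"
    and a: "range a \<subseteq> carr M" "\<And>m n. m \<noteq> n \<Longrightarrow> dst M (a m) (a n) = 1"
    using assms(4) unfolding ample_theory_def by blast
  interpret M: struct L M using M assms(1) by (simp add: struct_def is_model_def)
  obtain p :: "((('c, 'f, 'r, 'k) wit \<Rightarrow> 'm) \<Rightarrow> real) \<Rightarrow> real"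
    where extreme: "extreme_state (inst_space L M UNIV) p" and wit: "witnessed L M 0 p"
    and sep: "separated M UNIV p"
    by (rule M.extreme_witnessed_state_exists[OF a])
  interpret witnessed_state L M p
    using extreme wit by unfold_locales (simp_all add: extreme_state_def)
  obtain N :: "('c, 'f, 'r, ('c, 'f, 'r, 'k) univ) lstruct" and j where "witness_model L M p N j"
    using witness_model_exists[OF ex_inj_wit_functions_univ] by blast
  then interpret witness_model L M p N j .
  have "omits TYPE('m) L T n N x" if nonextreme: "x \<in> n_types TYPE('m) L T n - extreme_types TYPE('m) L T n" for n x
  proof -
    obtain q1 q2 t where q: "q1 \<in> n_types TYPE('m) L T n" "q2 \<in> n_types TYPE('m) L T n" "q1 \<noteq> q2"
      and t: "0 < t" "t < 1" and x: "x = (\<lambda>X. (1 - t) * q1 X + t * q2 X)"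
      using nonextreme unfolding extreme_types_def by blast
    show ?thesis
      unfolding omits_def x
      using realized_type_indecomposable[OF assms(3) M extreme q(1,2) t] q(3) by blast
  qed
  then show ?thesis
    using witness_model_is_model[OF assms(2) M] separated_imp_card_le[OF sep assms(5)] by blast
qed

end
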